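(* Let $(X,\mathcal{X},\mu)$ be a standard Lebesgue space and let $G=\mathrm{Aut}(X,\mathcal{X},\mu)$. The collection of whirly transformations is a dense $G_\delta$ subset of $G$.
   Context: A standard Lebesgue space here is a (nonatomic) standard probability space, isomorphic to $[0,1]$ with Lebesgue measure. $\mathrm{Aut}(X,\mathcal{X},\mu)$ is the Polish group of equivalence classes (mod null sets) of invertible measure preserving transformations $X\to X$, with the topology whose neighborhoods of the identity are generated by the sets $\{T:\mu(A\triangle TA)<\varepsilon\}$, $A\in\mathcal{X}$, $\varepsilon>0$. An automorphism $T\in G$ is whirly if for every neighborhood $U$ of the identity in $G$ and any two sets $A,B\in\mathcal{X}$ of positive measure there is $n\in\mathbb{Z}$ such that $T^n\in U$ and $\mu(T^nA\cap B)>0$. *)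

theory Defs
  imports "HOL-Probability.Probability" "HOL-Algebra.Coset"
begin

section \<open>Standard Lebesgue spaces\<close>

definition mp_iso :: "'a measure \<Rightarrow> 'b measure \<Rightarrow> ('a \<Rightarrow> 'b) \<Rightarrow> bool" where
  "mp_iso M N f \<longleftrightarrow>
     f \<in> measurable M N \<and> bij_betw f (space M) (space N) \<and>
     inv_into (space M) f \<in> measurable N M \<and> distr M N f = N"

definition iso_mod_null :: "'a measure \<Rightarrow> 'b measure \<Rightarrow> bool" where
  "iso_mod_null M N \<longleftrightarrow>
     (\<exists>X0\<in>sets M. \<exists>Y0\<in>sets N.
        emeasure M (space M - X0) = 0 \<and> emeasure N (space N - Y0) = 0 \<and>
        (\<exists>f. mp_iso (restrict_space M X0) (restrict_space N Y0) f))"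

text \<open>
  Both customary readings of ``the unit interval with Lebesgue measure'' are admitted: with its
  Borel sets, which gives the nonatomic standard Borel probability spaces, and with its
  Lebesgue measurable sets, which gives their completions.
\<close>

definition standard_Lebesgue_space :: "'a measure \<Rightarrow> bool" where
  "standard_Lebesgue_space M \<longleftrightarrow>
     prob_space M \<and>
     (iso_mod_null M (restrict_space lborel {0..1::real}) \<or>
      iso_mod_null M (lebesgue_on {0..1::real}))"

section \<open>The automorphism group\<close>

definition aut_class :: "'a measure \<Rightarrow> ('a \<Rightarrow> 'a) \<Rightarrow> ('a \<Rightarrow> 'a) set" where
  "aut_class M t = {s. mp_iso M M s \<and> (AE x in M. s x = t x)}"

definition Aut :: "'a measure \<Rightarrow> ('a \<Rightarrow> 'a) set monoid" where
  "Aut M = \<lparr>carrier = aut_class M ` {t. mp_iso M M t},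
            mult = (\<lambda>S T. \<Union>s\<in>S. \<Union>t\<in>T. aut_class M (s \<circ> t)),
            one = aut_class M id\<rparr>"

section \<open>The topology\<close>

text \<open>
  The number \<open>\<mu>(A \<triangle> TA)\<close> does not depend on the representative \<open>t\<close> of the class \<open>T\<close>, and classes in
  the carrier are nonempty, so the quantifier over representatives is harmless; likewise below.
\<close>

definition aut_nbhd :: "'a measure \<Rightarrow> 'a set \<Rightarrow> real \<Rightarrow> ('a \<Rightarrow> 'a) set set" where
  "aut_nbhd M A e = {T \<in> carrier (Aut M). \<forall>t\<in>T. measure M (sym_diff A (t ` A)) < e}"

text \<open>
  Translating the neighbourhoods of the identity to all group elements yields a subbase. The
  translate of \<open>aut_nbhd M A e\<close> by \<open>S\<close> is \<open>{T. \<mu>(SA \<triangle> TA) < e}\<close>; if it contains the identity,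
  it includes \<open>aut_nbhd M A d\<close> for \<open>d = e - \<mu>(SA \<triangle> A)\<close>. Hence the neighbourhoods of the identity
  are exactly those generated by the sets \<open>aut_nbhd M A e\<close>.
\<close>

definition aut_topology :: "'a measure \<Rightarrow> ('a \<Rightarrow> 'a) set topology" where
  "aut_topology M = topology_generated_by
     {S <#\<^bsub>Aut M\<^esub> aut_nbhd M A e | S A e. S \<in> carrier (Aut M) \<and> A \<in> sets M \<and> 0 < e}"

section \<open>Whirly automorphisms\<close>

definition identity_nbhd :: "'a measure \<Rightarrow> ('a \<Rightarrow> 'a) set set \<Rightarrow> bool" where
  "identity_nbhd M U \<longleftrightarrow> U \<subseteq> carrier (Aut M) \<and>
     (\<exists>V. openin (aut_topology M) V \<and> \<one>\<^bsub>Aut M\<^esub> \<in> V \<and> V \<subseteq> U)"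

definition whirly :: "'a measure \<Rightarrow> ('a \<Rightarrow> 'a) set \<Rightarrow> bool" where
  "whirly M T \<longleftrightarrow> T \<in> carrier (Aut M) \<and>
     (\<forall>U A B. identity_nbhd M U \<longrightarrow> A \<in> sets M \<longrightarrow> B \<in> sets M \<longrightarrow>
        0 < measure M A \<longrightarrow> 0 < measure M B \<longrightarrow>
        (\<exists>n::int. T [^]\<^bsub>Aut M\<^esub> n \<in> U \<and>
           (\<forall>t \<in> T [^]\<^bsub>Aut M\<^esub> n. 0 < measure M (t ` A \<inter> B))))"

section \<open>Basic facts\<close>

lemma mp_iso_id: "mp_iso M M id"
proof -
  have "inv_into (space M) id \<in> measurable M M"
    by (subst measurable_cong[where g = "\<lambda>x. x"]) auto
  then show ?thesis
    by (auto simp: mp_iso_def bij_betw_def distr_id2 id_def)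
qed

lemma mp_iso_comp:
  assumes f: "mp_iso M N f" and g: "mp_iso N K g"
  shows "mp_iso M K (g \<circ> f)"
proof -
  have bf: "bij_betw f (space M) (space N)" and bg: "bij_betw g (space N) (space K)"
    and m: "f \<in> measurable M N" "g \<in> measurable N K" "inv_into (space M) f \<in> measurable N M"
      "inv_into (space N) g \<in> measurable K N"
    and d: "distr M N f = N" "distr N K g = K"
    using f g by (auto simp: mp_iso_def)
  have "inv_into (space M) (g \<circ> f) \<in> measurable K M"
  proof (subst measurable_cong)
    fix w assume "w \<in> space K"
    then show "inv_into (space M) (g \<circ> f) w = (inv_into (space M) f \<circ> inv_into (space N) g) w"
      using bf bg by (metis bij_betw_def inv_into_comp comp_apply)
  qed (use m in simp)
  moreover have "distr M K (g \<circ> f) = K"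
    using distr_distr[OF m(2,1)] d by simp
  ultimately show ?thesis
    using m bij_betw_trans[OF bf bg] by (auto simp: mp_iso_def)
qed

lemma mp_iso_inv:
  assumes f: "mp_iso M N f"
  shows "mp_iso N M (inv_into (space M) f)"
proof -
  let ?g = "inv_into (space M) f"
  have bf: "bij_betw f (space M) (space N)" and m: "f \<in> measurable M N" "?g \<in> measurable N M"
    and d: "distr M N f = N" using f by (auto simp: mp_iso_def)
  have "inv_into (space N) ?g \<in> measurable M N"
    using m(1) bf
    by (subst measurable_cong[where g = f]) (auto simp: inv_into_inv_into_eq)
  moreover have "distr N M ?g = M"
  proof -
    have "distr N M ?g = distr M M (?g \<circ> f)" using distr_distr[OF m(2,1)] d by simp
    also have "\<dots> = distr M M (\<lambda>x. x)"
      by (rule distr_cong) (use bf in \<open>auto simp: bij_betw_def inv_into_f_f\<close>)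
    finally show ?thesis by (simp add: distr_id2)
  qed
  ultimately show ?thesis
    using m bij_betw_inv_into[OF bf] by (auto simp: mp_iso_def)
qed

lemma AE_mp_iso:
  assumes "mp_iso M N f" and "AE y in N. P y" shows "AE x in M. P (f x)"
proof (rule AE_distrD[where f = f and M = M and M' = N and P = P])
  have d: "distr M N f = N" and m: "f \<in> measurable M N"
    using assms(1) by (simp_all add: mp_iso_def)
  show "f \<in> measurable M N" by (rule m)
  show "AE y in distr M N f. P y" unfolding d by (rule assms(2))
qed

lemma aut_class_self: "mp_iso M M t \<Longrightarrow> t \<in> aut_class M t"
  by (simp add: aut_class_def)

lemma aut_class_eqI: "AE x in M. s x = t x \<Longrightarrow> aut_class M s = aut_class M t"
  unfolding aut_class_def by auto

lemma Aut_mult: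
  assumes s: "mp_iso M M s" and t: "mp_iso M M t"
  shows "aut_class M s \<otimes>\<^bsub>Aut M\<^esub> aut_class M t = aut_class M (s \<circ> t)"
proof -
  have "aut_class M (s' \<circ> t') = aut_class M (s \<circ> t)"
    if "s' \<in> aut_class M s" "t' \<in> aut_class M t" for s' t'
  proof (rule aut_class_eqI)
    have "AE x in M. s' x = s x" "AE x in M. t' x = t x"
      using that by (simp_all add: aut_class_def)
    with AE_mp_iso[OF t, of "\<lambda>y. s' y = s y"]
    have "AE x in M. s' (t x) = s (t x)" "AE x in M. t' x = t x"
      by blast+
    then show "AE x in M. (s' \<circ> t') x = (s \<circ> t) x" by eventually_elim simp
  qed
  then have "(\<Union>s'\<in>aut_class M s. \<Union>t'\<in>aut_class M t. aut_class M (s' \<circ> t')) = aut_class M (s \<circ> t)"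
    using aut_class_self[OF s] aut_class_self[OF t] by blast
  then show ?thesis by (simp add: Aut_def)
qed

lemma carrier_Aut: "carrier (Aut M) = aut_class M ` {t. mp_iso M M t}"
  by (simp add: Aut_def)

lemma one_Aut: "\<one>\<^bsub>Aut M\<^esub> = aut_class M id"
  by (simp add: Aut_def)

lemma group_Aut: "group (Aut M)"
proof -
  have rep: "\<exists>s. mp_iso M M s \<and> S = aut_class M s" if "S \<in> carrier (Aut M)" for S
    using that by (auto simp: carrier_Aut)
  have cl: "aut_class M s \<in> carrier (Aut M)" if "mp_iso M M s" for s
    using that by (simp add: carrier_Aut)
  show ?thesis
  proof (rule groupI)
    fix S T assume "S \<in> carrier (Aut M)" "T \<in> carrier (Aut M)"
    with rep obtain s t where "mp_iso M M s" "S = aut_class M s" "mp_iso M M t" "T = aut_class M t"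
      by metis
    then show "S \<otimes>\<^bsub>Aut M\<^esub> T \<in> carrier (Aut M)"
      by (simp add: Aut_mult cl mp_iso_comp)
  next
    show "\<one>\<^bsub>Aut M\<^esub> \<in> carrier (Aut M)"
      by (simp add: one_Aut cl mp_iso_id)
  next
    fix R S T assume "R \<in> carrier (Aut M)" "S \<in> carrier (Aut M)" "T \<in> carrier (Aut M)"
    with rep obtain r s t where "mp_iso M M r" "R = aut_class M r"
      "mp_iso M M s" "S = aut_class M s" "mp_iso M M t" "T = aut_class M t"
      by metis
    then show "R \<otimes>\<^bsub>Aut M\<^esub> S \<otimes>\<^bsub>Aut M\<^esub> T = R \<otimes>\<^bsub>Aut M\<^esub> (S \<otimes>\<^bsub>Aut M\<^esub> T)"
      by (simp add: Aut_mult mp_iso_comp o_assoc)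
  next
    fix S assume "S \<in> carrier (Aut M)"
    with rep obtain s where s: "mp_iso M M s" and S: "S = aut_class M s" by metis
    show "\<one>\<^bsub>Aut M\<^esub> \<otimes>\<^bsub>Aut M\<^esub> S = S"
      by (simp add: S one_Aut Aut_mult s mp_iso_id)
    have "aut_class M (inv_into (space M) s \<circ> s) = aut_class M id"
      using s by (intro aut_class_eqI AE_I2) (auto simp: mp_iso_def bij_betw_def)
    then show "\<exists>T\<in>carrier (Aut M). T \<otimes>\<^bsub>Aut M\<^esub> S = \<one>\<^bsub>Aut M\<^esub>"
      using s mp_iso_inv[OF s] cl by (intro bexI[of _ "aut_class M (inv_into (space M) s)"])
        (simp_all add: S Aut_mult one_Aut)
  qed
qed

lemma topspace_aut_topology: "topspace (aut_topology M) = carrier (Aut M)"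
proof -
  interpret group "Aut M" by (rule group_Aut)
  have "aut_nbhd M {} 1 = carrier (Aut M)" by (auto simp: aut_nbhd_def)
  moreover have "\<one>\<^bsub>Aut M\<^esub> <#\<^bsub>Aut M\<^esub> carrier (Aut M) = carrier (Aut M)"
    by (auto simp: l_coset_def)
  ultimately have "carrier (Aut M) \<in>
      {S <#\<^bsub>Aut M\<^esub> aut_nbhd M A e | S A e. S \<in> carrier (Aut M) \<and> A \<in> sets M \<and> 0 < e}"
    by (intro CollectI exI[of _ "\<one>\<^bsub>Aut M\<^esub>"] exI[of _ "{}"] exI[of _ 1]) auto
  moreover have "S <#\<^bsub>Aut M\<^esub> aut_nbhd M A e \<subseteq> carrier (Aut M)" if "S \<in> carrier (Aut M)" for S A e
    using that by (auto simp: l_coset_def aut_nbhd_def)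
  ultimately show ?thesis
    unfolding aut_topology_def topology_generated_by_topspace by blast
qed

end

theory Submission
  imports Defs "HOL-Number_Theory.Cong" "HOL-Combinatorics.Cycles"
begin

text \<open>
  An isomorphism with the unit interval cuts the space, for every \<open>R\<close>, into \<open>R\<close> cells of measure
  \<open>1 / R\<close>. The topology of the automorphism group can be read off from the cells: \<open>s\<close> is close to
  \<open>t\<close> if \<open>s x\<close> and \<open>t x\<close> lie in the same cell of rank \<open>k\<close> for all \<open>x\<close> outside a set of measure less
  than \<open>1 / k\<close>, where \<open>k\<close> is large in the sense of divisibility (\<open>openin_aut_topology_iff\<close>).

  \<^bold>\<open>The whirly automorphisms form a \<open>G\<^sub>\<delta>\<close> set.\<close> Whirliness quantifies over all pairs of sets of positive
  measure. Testing it on a countable dense family of pairs is too weak, since \<open>T\<^sup>n A \<inter> B\<close> may be so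
  small that it disappears when \<open>A\<close> and \<open>B\<close> are slightly diminished. The remedy is to use many powers at
  once: for two cells of rank \<open>k\<close>, ask for finitely many powers of \<open>T\<close>, all within \<open>1 / k\<close> of the
  identity, that carry disjoint pieces of the first cell into disjoint pieces of the second one, and
  move more than three quarters of its measure in total. A whirly \<open>T\<close> does this, because
  moving greedily whatever can be moved must exhaust the cell (\<open>carries_if_whirls\<close>). Conversely, if
  \<open>T\<close> does this for all \<open>k\<close>, it is whirly, because arbitrary sets \<open>A\<close> and \<open>B\<close> fill more than
  three quarters of suitable cells, and so much mass cannot be moved without moving some of \<open>A\<close>
  into \<open>B\<close> (\<open>carries_meets\<close>). For fixed powers and pieces the condition is a strict inequality between
  continuous functions of \<open>T\<close>, hence open (\<open>carries_open\<close>).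

  \<^bold>\<open>They are dense.\<close> Every automorphism is close to a permutation \<open>\<pi>\<close> of cells
  (\<open>ex_permutation_near\<close>), and \<open>\<pi>\<close> is close to permutations \<open>\<sigma>\<close> of smaller cells of the following
  kind (\<open>ex_shuffling_extension\<close>): up to a few fixed cells, \<open>\<sigma>\<close> consists of many cycles (columns) that
  follow the orbits of \<open>\<pi>\<close>, visit every coarse cell equally often, and have pairwise coprime
  lengths. By the Chinese remainder theorem an arbitrary rotation of one column is a power of \<open>\<sigma>\<close> that
  fixes all other columns. Such a power is close to the identity because a single column is small, and
  these powers together carry any coarse cell to any other one. Repeat this with rapidly decreasing
  errors. The permutations converge almost everywhere to an automorphism
  (\<open>ex_limit_automorphism\<close>). It inherits the transport property of every stage, since only powers up
  to a bound matter, and this bound is known before the next error has to be chosen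
  (\<open>transports_of_stage\<close>).
\<close>

section \<open>Permutations with cycles of coprime lengths\<close>

text \<open>
  A function with fibres of equal size can be turned into the quotient of a numbering. This realises an
  abstract system, labelled by coarse cells, on the fine cells of the unit interval.
\<close>
lemma ex_bij_betw_equal_fibres:
  fixes f :: "'b \<Rightarrow> nat"
  assumes fin: "finite \<Omega>" and f: "f \<in> \<Omega> \<rightarrow> {..<R}" and D: "0 < D"
    and fibre: "\<And>l. l < R \<Longrightarrow> card {x \<in> \<Omega>. f x = l} = D"
  shows "\<exists>E. bij_betw E \<Omega> {..<R * D} \<and> (\<forall>x\<in>\<Omega>. E x div D = f x)"
proof -
  have "\<exists>g. bij_betw g {x \<in> \<Omega>. f x = l} {..<D}" if "l < R" for l
    using fibre[OF that] fin by (intro finite_same_card_bij) auto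
  then obtain g where g: "\<And>l. l < R \<Longrightarrow> bij_betw (g l) {x \<in> \<Omega>. f x = l} {..<D}"
    by metis
  define E where "E x = f x * D + g (f x) x" for x
  have gD: "g (f x) x < D" if "x \<in> \<Omega>" for x
    using g[of "f x"] that f by (auto simp: bij_betw_def Pi_iff)
  have div: "E x div D = f x" and md: "E x mod D = g (f x) x" if "x \<in> \<Omega>" for x
    using gD[OF that] D by (simp_all add: E_def)
  have "bij_betw E \<Omega> {..<R * D}"
  proof (rule bij_betw_imageI)
    show "inj_on E \<Omega>"
    proof (rule inj_onI)
      fix x y assume xy: "x \<in> \<Omega>" "y \<in> \<Omega>" "E x = E y"
      then have "f x = f y" "g (f x) x = g (f x) y" using div md by metis+
      moreover have "inj_on (g (f x)) {z \<in> \<Omega>. f z = f x}"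
        using g[of "f x"] f xy by (auto simp: bij_betw_def)
      ultimately show "x = y" using xy by (auto dest: inj_onD)
    qed
    show "E ` \<Omega> = {..<R * D}"
    proof (intro equalityI subsetI)
      fix a assume "a \<in> E ` \<Omega>"
      then obtain x where x: "x \<in> \<Omega>" "a = E x" by auto
      have "a div D < R" using div[OF x(1)] x f by auto
      then show "a \<in> {..<R * D}" using D by (simp add: div_less_iff_less_mult)
    next
      fix a assume a: "a \<in> {..<R * D}"
      then have l: "a div D < R" by (simp add: less_mult_imp_div_less)
      have "a mod D \<in> g (a div D) ` {x \<in> \<Omega>. f x = a div D}"
        using g[OF l] D by (auto simp: bij_betw_def)
      then obtain x where "x \<in> \<Omega>" "f x = a div D" "g (a div D) x = a mod D" by auto
      then have "E x = a" by (simp add: E_def)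
      with \<open>x \<in> \<Omega>\<close> show "a \<in> E ` \<Omega>" by auto
    qed
  qed
  with div show ?thesis by blast
qed

text \<open>
  The finite form of the transport condition on \<open>k\<close> blocks: for any two blocks there are powers of \<open>\<sigma>\<close>
  that move few points and carry, injectively and point by point, seven eighths of the first block
  into the second one. If every block contains \<open>card \<Omega> / k\<close> points, \<open>7 * card \<Omega> \<le> 8 * k * card Z\<close> says
  that \<open>Z\<close> is that large a part. The margin between \<open>7 / 8\<close> and the \<open>3 / 4\<close> of the measure theoretic
  condition absorbs later errors.
\<close>
definition shuffles :: "nat \<Rightarrow> 'b set \<Rightarrow> ('b \<Rightarrow> nat) \<Rightarrow> ('b \<Rightarrow> 'b) \<Rightarrow> bool" where
  "shuffles k \<Omega> \<beta> \<sigma> \<longleftrightarrow> (\<forall>i<k. \<forall>j<k. \<exists>Z n.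
     Z \<subseteq> {a \<in> \<Omega>. \<beta> a = i} \<and> 7 * card \<Omega> \<le> 8 * k * card Z \<and>
     inj_on (\<lambda>a. (\<sigma> ^^ n a) a) Z \<and>
     (\<forall>a\<in>Z. (\<sigma> ^^ n a) a \<in> \<Omega> \<and> \<beta> ((\<sigma> ^^ n a) a) = j \<and>
        4 * k * card {b \<in> \<Omega>. (\<sigma> ^^ n a) b \<noteq> b} \<le> card \<Omega>))"

lemma shuffles_conj:
  assumes sh: "shuffles k \<Omega> \<beta>' \<gamma>" and E: "bij_betw E \<Omega> \<Omega>'" and fin: "finite \<Omega>"
    and \<beta>: "\<And>x. x \<in> \<Omega> \<Longrightarrow> \<beta> (E x) = \<beta>' x"
    and \<gamma>: "\<And>x. x \<in> \<Omega> \<Longrightarrow> \<gamma> x \<in> \<Omega>" and \<sigma>: "\<And>x. x \<in> \<Omega> \<Longrightarrow> \<sigma> (E x) = E (\<gamma> x)"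
  shows "shuffles k \<Omega>' \<beta> \<sigma>"
  unfolding shuffles_def
proof (intro allI impI)
  fix i j assume "i < k" "j < k"
  then obtain Z n where Z: "Z \<subseteq> {a \<in> \<Omega>. \<beta>' a = i}" "7 * card \<Omega> \<le> 8 * k * card Z"
     "inj_on (\<lambda>a. (\<gamma> ^^ n a) a) Z"
     "\<And>a. a\<in>Z \<Longrightarrow> (\<gamma> ^^ n a) a \<in> \<Omega> \<and> \<beta>' ((\<gamma> ^^ n a) a) = j \<and>
        4 * k * card {b \<in> \<Omega>. (\<gamma> ^^ n a) b \<noteq> b} \<le> card \<Omega>"
    using sh unfolding shuffles_def by meson
  define F where "F = inv_into \<Omega> E"
  have F: "F (E x) = x" if "x \<in> \<Omega>" for x using E that by (simp add: F_def bij_betw_def)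
  have injE: "inj_on E \<Omega>" and imE: "E ` \<Omega> = \<Omega>'" using E by (auto simp: bij_betw_def)
  have pow: "(\<gamma> ^^ m) x \<in> \<Omega> \<and> (\<sigma> ^^ m) (E x) = E ((\<gamma> ^^ m) x)" if "x \<in> \<Omega>" for x m
    using that by (induction m) (auto simp: \<gamma> \<sigma>)
  have cards: "card \<Omega>' = card \<Omega>" using E by (metis bij_betw_same_card)
  show "\<exists>Z n. Z \<subseteq> {a \<in> \<Omega>'. \<beta> a = i} \<and> 7 * card \<Omega>' \<le> 8 * k * card Z \<and>
     inj_on (\<lambda>a. (\<sigma> ^^ n a) a) Z \<and>
     (\<forall>a\<in>Z. (\<sigma> ^^ n a) a \<in> \<Omega>' \<and> \<beta> ((\<sigma> ^^ n a) a) = j \<and>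
        4 * k * card {b \<in> \<Omega>'. (\<sigma> ^^ n a) b \<noteq> b} \<le> card \<Omega>')"
  proof (intro exI[of _ "E ` Z"] exI[of _ "\<lambda>a. n (F a)"] conjI ballI)
    show "E ` Z \<subseteq> {a \<in> \<Omega>'. \<beta> a = i}" using Z(1) imE \<beta> by auto
    have "inj_on E Z" using Z(1) injE by (auto intro: inj_on_subset)
    then show "7 * card \<Omega>' \<le> 8 * k * card (E ` Z)" using Z(2) cards by (simp add: card_image)
    show "inj_on (\<lambda>a. (\<sigma> ^^ n (F a)) a) (E ` Z)"
    proof (rule inj_onI, clarify)
      fix x y assume xy: "x \<in> Z" "y \<in> Z" "(\<sigma> ^^ n (F (E x))) (E x) = (\<sigma> ^^ n (F (E y))) (E y)"
      then have xO: "x \<in> \<Omega>" "y \<in> \<Omega>" using Z(1) by auto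
      then have "E ((\<gamma> ^^ n x) x) = E ((\<gamma> ^^ n y) y)" using xy pow F by auto
      then have "(\<gamma> ^^ n x) x = (\<gamma> ^^ n y) y" using injE pow xO by (auto dest: inj_onD)
      then show "E x = E y" using Z(3) xy by (auto dest: inj_onD)
    qed
    fix a assume "a \<in> E ` Z"
    then obtain x where x: "x \<in> Z" "a = E x" "x \<in> \<Omega>" using Z(1) by auto
    note zx = Z(4)[OF x(1)]
    show "(\<sigma> ^^ n (F a)) a \<in> \<Omega>'" using zx x F pow imE by auto
    show "\<beta> ((\<sigma> ^^ n (F a)) a) = j" using zx x F pow \<beta> by auto
    have "{b \<in> \<Omega>'. (\<sigma> ^^ n (F a)) b \<noteq> b} \<subseteq> E ` {b \<in> \<Omega>. (\<gamma> ^^ n x) b \<noteq> b}"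
      using x F pow imE by (auto simp: imE[symmetric] image_iff)
    then have "card {b \<in> \<Omega>'. (\<sigma> ^^ n (F a)) b \<noteq> b} \<le> card {b \<in> \<Omega>. (\<gamma> ^^ n x) b \<noteq> b}"
      using fin by (intro surj_card_le) auto
    then show "4 * k * card {b \<in> \<Omega>'. (\<sigma> ^^ n (F a)) b \<noteq> b} \<le> card \<Omega>'"
      using zx cards by (metis (no_types, lifting) le_trans mult_le_mono2)
  qed
qed

text \<open>
  Column \<open>c\<close> is a cycle of length \<open>p c\<close>; the points from \<open>p c\<close> onwards are fixed.
\<close>
definition cyc :: "(nat \<Rightarrow> nat) \<Rightarrow> nat \<times> nat \<Rightarrow> nat \<times> nat" where
  "cyc p = (\<lambda>(c, x). if x < p c then (c, Suc x mod p c) else (c, x))"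

lemma cyc_pow: "x < p c \<Longrightarrow> (cyc p ^^ n) (c, x) = (c, (x + n) mod p c)"
proof (induction n)
  case (Suc n)
  then have "(x + n) mod p c < p c" by simp
  with Suc show ?case by (simp add: cyc_def mod_Suc_eq)
qed simp

lemma cyc_pow_fixed: "\<not> x < p c \<Longrightarrow> (cyc p ^^ n) (c, x) = (c, x)"
  by (induction n) (auto simp: cyc_def)

text \<open>
  A common prime factor \<open>q\<close> of \<open>a c - 1\<close> and \<open>a d - 1\<close> divides their difference \<open>B * fact Q * (d - c)\<close>. If
  it divides \<open>d - c < Q\<close>, it also divides \<open>fact Q\<close>; so it divides \<open>a c\<close> in any case, and then \<open>1\<close>. The
  lengths \<open>a c\<close>, for \<open>c < Q\<close>, differ by a factor of at most two, so no column dominates.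
\<close>
lemma coprime_lengths:
  fixes Q B c d :: nat
  defines "a \<equiv> \<lambda>c. B * (fact Q * (Q + c))"
  assumes "c < d" "d < Q" "0 < B"
  shows "coprime (a c - 1) (a d - 1)"
proof (rule ccontr)
  assume "\<not> coprime (a c - 1) (a d - 1)"
  then have "gcd (a c - 1) (a d - 1) \<noteq> 1" by (simp add: coprime_iff_gcd_eq_1)
  then obtain q where q: "prime q" "q dvd gcd (a c - 1) (a d - 1)"
    using prime_factor_nat by blast
  then have qd: "q dvd a c - 1" "q dvd a d - 1" by auto
  have pos: "0 < a e" for e unfolding a_def using assms(2-4) by (intro mult_pos_pos) auto
  have ndvd: "\<not> q dvd a c"
  proof
    assume "q dvd a c"
    then have "q dvd a c - (a c - 1)" using qd(1) by (rule dvd_diff_nat)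
    moreover have "a c - (a c - 1) = 1" using pos[of c] by linarith
    ultimately show False using q(1) by (simp add: prime_nat_iff)
  qed
  have "q dvd (a d - 1) - (a c - 1)" by (rule dvd_diff_nat[OF qd(2) qd(1)])
  also have "(a d - 1) - (a c - 1) = a d - a c" using pos[of c] by linarith
  also have "\<dots> = (B * fact Q) * (d - c)"
    unfolding a_def by (simp only: diff_mult_distrib2[symmetric] Nat.diff_cancel mult.assoc)
  finally have "q dvd B * fact Q \<or> q dvd d - c"
    using q(1) prime_dvd_multD by blast
  moreover have "q dvd fact Q" if "q dvd d - c"
  proof (rule dvd_fact)
    show "1 \<le> q" using q(1) prime_ge_1_nat by blast
    have "q \<le> d - c" using that assms(2) by (intro dvd_imp_le) auto
    then show "q \<le> Q" using assms(3) by linarith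
  qed
  ultimately have "q dvd B * fact Q" by (meson dvd_mult)
  then have "q dvd (B * fact Q) * (Q + c)" by (rule dvd_mult2)
  then show False using ndvd unfolding a_def by (simp only: mult.assoc)
qed

text \<open>
  The exponent \<open>n\<close> comes from the Chinese remainder theorem: \<open>n\<close> is divisible by the lengths of the other
  columns and congruent to \<open>y - x\<close> modulo the length of column \<open>c\<close>.
\<close>
lemma coprime_cycles_shift:
  fixes p :: "nat \<Rightarrow> nat"
  assumes cop: "\<And>c d. c < Q \<Longrightarrow> d < Q \<Longrightarrow> c \<noteq> d \<Longrightarrow> coprime (p c) (p d)"
    and c: "c < Q" and x: "x < p c" and y: "y < p c"
  shows "\<exists>n. (cyc p ^^ n) (c, x) = (c, y) \<and> (\<forall>d z. d < Q \<longrightarrow> d \<noteq> c \<longrightarrow> (cyc p ^^ n) (d, z) = (d, z))"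
proof -
  define P where "P = (\<Prod>d\<in>{..<Q} - {c}. p d)"
  have "coprime P (p c)" unfolding P_def using cop c by (intro prod_coprime_left) auto
  then obtain n where n: "[n = 0] (mod P)" "[n = y + (p c - x)] (mod p c)"
    using binary_chinese_remainder_nat by blast
  have "(cyc p ^^ n) (c, x) = (c, y)"
  proof -
    have "[x + n = x + (y + (p c - x))] (mod p c)" using n(2) by (simp only: cong_add_lcancel_nat)
    moreover have "x + (y + (p c - x)) = y + p c" using x by simp
    ultimately have "(x + n) mod p c = y" using y by (simp add: cong_def)
    then show ?thesis using x by (simp add: cyc_pow)
  qed
  moreover have "(cyc p ^^ n) (d, z) = (d, z)" if d: "d < Q" "d \<noteq> c" for d z
  proof (cases "z < p d")
    case True
    have "p d dvd P" unfolding P_def using d by (intro dvd_prodI) auto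
    moreover have "P dvd n" using n(1) by (simp only: cong_0_iff)
    ultimately have "p d dvd n" by (rule dvd_trans)
    then obtain e where "n = p d * e" ..
    then have "(z + n) mod p d = z" using True by simp
    with True show ?thesis by (simp add: cyc_pow)
  qed (simp add: cyc_pow_fixed)
  ultimately show ?thesis by blast
qed

text \<open>
  The sequence \<open>x \<mapsto> (\<pi> ^^ (x mod K)) ((x div K) mod R)\<close> runs through the orbit segments of length \<open>K\<close> of
  all points in turn. It applies \<open>\<pi>\<close> at every step but the last one of a segment, and it
  visits all points equally often, because for each \<open>j\<close> the map \<open>\<pi> ^^ j\<close> is a bijection.
\<close>
lemma itinerary_fibre:
  fixes \<pi> :: "nat \<Rightarrow> nat"
  assumes \<pi>: "\<pi> permutes {..<R}" and l: "l < R" and K: "0 < K"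
  shows "card {x \<in> {..<R * K * r}. (\<pi> ^^ (x mod K)) ((x div K) mod R) = l} = K * r"
proof -
  have pp: "(\<pi> ^^ j) permutes {..<R}" for j
    using \<pi> by (rule permutes_funpow)
  define h where "h j = inv_into UNIV (\<pi> ^^ j) l" for j
  have hR: "h j < R" for j
    using permutes_in_image[OF permutes_inv[OF pp[of j]], of l] l by (simp add: h_def)
  have hj: "(\<pi> ^^ j) a = l \<longleftrightarrow> a = h j" for j a
    using permutes_inverses[OF pp[of j]] by (auto simp: h_def)
  have R: "0 < R" using l by simp
  let ?S = "{x \<in> {..<R * K * r}. (\<pi> ^^ (x mod K)) ((x div K) mod R) = l}"
  define f where "f = (\<lambda>(j, t). j + K * (h j + R * t))"
  have "bij_betw f ({..<K} \<times> {..<r}) ?S"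
  proof (rule bij_betw_imageI)
    have dm: "f (j, t) mod K = j" "f (j, t) div K = h j + R * t"
       "f (j, t) div K div R = t" "f (j, t) div K mod R = h j" if "j < K" for j t
      using that K R hR[of j] by (simp_all add: f_def)
    show "inj_on f ({..<K} \<times> {..<r})"
    proof (rule inj_onI)
      fix u v assume uv: "u \<in> {..<K} \<times> {..<r}" "v \<in> {..<K} \<times> {..<r}" "f u = f v"
      have rec: "u = (f u mod K, f u div K div R)" if "u \<in> {..<K} \<times> {..<r}" for u
        using that dm(1,3)[of "fst u" "snd u"] by auto
      show "u = v" using rec[OF uv(1)] rec[OF uv(2)] uv(3) by simp
    qed
    show "f ` ({..<K} \<times> {..<r}) = ?S"
    proof (intro equalityI subsetI)
      fix x assume "x \<in> f ` ({..<K} \<times> {..<r})"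
      then obtain j t where jt: "j < K" "t < r" "x = f (j, t)" by auto
      have "h j + R * t < R * r"
      proof -
        have "h j + R * t < R + R * t" using hR by simp
        also have "\<dots> = R * Suc t" by simp
        also have "\<dots> \<le> R * r" using jt by (intro mult_le_mono2) simp
        finally show ?thesis .
      qed
      then have "x div K < R * r" using jt dm by simp
      then have "x < R * K * r" using K
        by (metis div_less_iff_less_mult mult.assoc mult.commute)
      then show "x \<in> ?S" using jt dm hj by simp
    next
      fix x assume x: "x \<in> ?S"
      have "x div K div R < r" using x K R
        by (simp add: div_mult2_eq[symmetric] div_less_iff_less_mult mult_ac)
      moreover have "x = f (x mod K, x div K div R)"
      proof -
        have "h (x mod K) = x div K mod R" using x hj by auto
        then show ?thesis by (simp add: f_def)
      qed
      ultimately show "x \<in> f ` ({..<K} \<times> {..<r})" using K by auto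
    qed
  qed
  then have "card ({..<K} \<times> {..<r}) = card ?S" by (rule bij_betw_same_card)
  then show ?thesis by (simp add: card_cartesian_product)
qed

text \<open>
  Within a column, match the positions in block \<open>i\<close> with those in block \<open>j\<close>; each match is a
  rotation of this column, and a power of the whole map realises it without moving the other columns. With
  \<open>8 * k\<close> columns of comparable sizes a single column contains at most a \<open>4 * k\<close>-th of all points.
\<close>
lemma coprime_cycles_shuffle:
  fixes p r :: "nat \<Rightarrow> nat" and B k Q :: nat
  assumes Q: "Q = 8 * k"
  defines "r \<equiv> \<lambda>c. fact Q * (Q + c)"
  defines "p \<equiv> \<lambda>c. B * r c - 1"
  defines "\<Omega> \<equiv> SIGMA c:{..<Q}. {..<B * r c}"
  assumes B: "0 < B" and k: "0 < k"
    and fibre: "\<And>c i. c < Q \<Longrightarrow> i < k \<Longrightarrow> k * card {x \<in> {..<B * r c}. v x = i} = B * r c"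
  shows "shuffles k \<Omega> (v \<circ> snd) (cyc p)"
  unfolding shuffles_def
proof (intro allI impI)
  fix i j assume i: "i < k" and j: "j < k"
  have Qpos: "0 < Q" using k Q by simp
  have rpos: "0 < r c" for c unfolding r_def using Qpos by (intro mult_pos_pos) auto
  have "0 < B * r c" for c using rpos B by (intro mult_pos_pos)
  then have pB: "p c < B * r c" "B * r c = Suc (p c)" for c unfolding p_def by (simp_all del: mult_eq_0_iff)
  have finO: "finite \<Omega>" by (simp add: \<Omega>_def)
  have cardO: "card \<Omega> = (\<Sum>c<Q. B * r c)" by (simp add: \<Omega>_def)
  have cop: "coprime (p c) (p d)" if "c < Q" "d < Q" "c \<noteq> d" for c d
  proof (cases "c < d")
    case True
    then show ?thesis using coprime_lengths[of c d Q B] that B by (simp add: p_def r_def)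
  next
    case False
    then have "d < c" using that by simp
    then show ?thesis using coprime_lengths[of d c Q B] that B
      by (subst coprime_commute) (simp add: p_def r_def)
  qed
  define A where "A c l = {x \<in> {..<B * r c}. v x = l}" for c l
  have cardA: "k * card (A c l) = B * r c" if "c < Q" "l < k" for c l
    using fibre[OF that] by (simp add: A_def)
  define A' where "A' c l = {x \<in> {..<p c}. v x = l}" for c l
  have AA': "card (A c l) \<le> Suc (card (A' c l))" for c l
  proof -
    have "A c l \<subseteq> insert (p c) (A' c l)" by (auto simp: A_def A'_def pB(2))
    then have "card (A c l) \<le> card (insert (p c) (A' c l))" by (intro card_mono) (auto simp: A'_def)
    also have "\<dots> \<le> Suc (card (A' c l))" by (rule card_insert_le_m1) auto
    finally show ?thesis .
  qed
  have "\<exists>Y h. Y \<subseteq> A' c i \<and> card (A c i) \<le> Suc (card Y) \<and> inj_on h Y \<and> h ` Y \<subseteq> A' c j" if c: "c < Q" for c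
  proof -
    have eq: "card (A c i) = card (A c j)"
      using cardA[OF c i] cardA[OF c j] k by (metis mult_left_cancel less_not_refl)
    (* the fixed last point of a column may belong to either block, hence the loss of one point *)
    define m where "m = card (A c i) - 1"
    have "m \<le> card (A' c i)" "m \<le> card (A' c j)" using AA'[of c i] AA'[of c j] eq by (auto simp: m_def)
    then obtain Y Y' where Y: "Y \<subseteq> A' c i" "card Y = m" "Y' \<subseteq> A' c j" "card Y' = m"
      by (meson obtain_subset_with_card_n)
    have "finite Y" "finite Y'" using Y by (auto intro: finite_subset simp: A'_def)
    then obtain h where "bij_betw h Y Y'" using Y by (metis finite_same_card_bij)
    then show ?thesis using Y
      by (intro exI[of _ Y] exI[of _ h]) (auto simp: bij_betw_def m_def)
  qed
  then obtain Y h where Y: "\<And>c. c < Q \<Longrightarrow> Y c \<subseteq> A' c i \<and> card (A c i) \<le> Suc (card (Y c)) \<and>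
     inj_on (h c) (Y c) \<and> h c ` Y c \<subseteq> A' c j" by metis
  define Z where "Z = (SIGMA c:{..<Q}. Y c)"
  have finY: "finite (Y c)" if "c < Q" for c
    using Y[OF that] by (auto intro: finite_subset simp: A'_def)
  have "\<exists>n. (cyc p ^^ n) (c, x) = (c, h c x) \<and> (\<forall>d z. d < Q \<longrightarrow> d \<noteq> c \<longrightarrow> (cyc p ^^ n) (d, z) = (d, z))"
    if "c < Q" "x \<in> Y c" for c x
  proof -
    have "x < p c" "h c x < p c" using Y[OF that(1)] that(2) by (auto simp: A'_def)
    then show ?thesis using coprime_cycles_shift[of Q p c x "h c x"] cop that(1) by blast
  qed
  then have "\<forall>a\<in>Z. \<exists>n. (cyc p ^^ n) a = (fst a, h (fst a) (snd a)) \<and>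
      (\<forall>d z. d < Q \<longrightarrow> d \<noteq> fst a \<longrightarrow> (cyc p ^^ n) (d, z) = (d, z))"
    by (auto simp: Z_def)
  then obtain n where n': "\<forall>a\<in>Z. (cyc p ^^ n a) a = (fst a, h (fst a) (snd a)) \<and>
      (\<forall>d z. d < Q \<longrightarrow> d \<noteq> fst a \<longrightarrow> (cyc p ^^ n a) (d, z) = (d, z))"
    by (auto dest: bchoice)
  have n: "(cyc p ^^ n (c, x)) (c, x) = (c, h c x)"
    "d < Q \<Longrightarrow> d \<noteq> c \<Longrightarrow> (cyc p ^^ n (c, x)) (d, z) = (d, z)"
    if "c < Q" "x \<in> Y c" for c x d z
    using n' that by (auto simp: Z_def)
  have big: "B * fact Q * Q * Q \<le> card \<Omega>"
  proof -
    have "B * fact Q * Q * Q = (\<Sum>c<Q. B * (fact Q * Q))" by simp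
    also have "\<dots> \<le> card \<Omega>" unfolding cardO r_def by (intro sum_mono mult_le_mono2) simp
    finally show ?thesis .
  qed
  show "\<exists>Z n. Z \<subseteq> {a \<in> \<Omega>. (v \<circ> snd) a = i} \<and> 7 * card \<Omega> \<le> 8 * k * card Z \<and>
     inj_on (\<lambda>a. (cyc p ^^ n a) a) Z \<and>
     (\<forall>a\<in>Z. (cyc p ^^ n a) a \<in> \<Omega> \<and> (v \<circ> snd) ((cyc p ^^ n a) a) = j \<and>
        4 * k * card {b \<in> \<Omega>. (cyc p ^^ n a) b \<noteq> b} \<le> card \<Omega>)"
  proof (intro exI[of _ Z] exI[of _ n] conjI ballI)
    show "Z \<subseteq> {a \<in> \<Omega>. (v \<circ> snd) a = i}"
    proof
      fix a assume "a \<in> Z"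
      then obtain c x where cx: "a = (c, x)" "c < Q" "x \<in> Y c" by (auto simp: Z_def)
      then have "x < p c" "v x = i" using Y[OF cx(2)] by (auto simp: A'_def)
      then show "a \<in> {a \<in> \<Omega>. (v \<circ> snd) a = i}"
        using cx pB(1)[of c] by (simp add: \<Omega>_def)
    qed
    have "card \<Omega> = (\<Sum>c<Q. k * card (A c i))" using cardA i by (simp add: cardO)
    also have "\<dots> \<le> (\<Sum>c<Q. k * Suc (card (Y c)))" using Y by (intro sum_mono mult_le_mono2) auto
    also have "\<dots> = k * Q + k * card Z"
      using finY by (simp add: Z_def sum.distrib sum_distrib_left)
    finally have 1: "card \<Omega> \<le> k * Q + k * card Z" .
    have "8 * k * Q \<le> B * fact Q * Q * Q"
    proof -
      have "1 * (Q * Q) \<le> (B * fact Q) * (Q * Q)" using B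
        by (intro mult_le_mono1) (simp add: Suc_le_eq)
      then show ?thesis by (simp only: Q[symmetric] mult_1 mult.assoc)
    qed
    then have "8 * k * Q \<le> card \<Omega>" using big by (rule le_trans)
    then have "8 * (k * Q) \<le> card \<Omega>" by (simp only: mult.assoc)
    with 1 show "7 * card \<Omega> \<le> 8 * k * card Z" by simp
    show "inj_on (\<lambda>a. (cyc p ^^ n a) a) Z"
    proof (rule inj_onI)
      fix a b assume ab: "a \<in> Z" "b \<in> Z" "(cyc p ^^ n a) a = (cyc p ^^ n b) b"
      obtain c x d y where cx: "a = (c, x)" "c < Q" "x \<in> Y c" "b = (d, y)" "d < Q" "y \<in> Y d"
        using ab(1,2) by (auto simp: Z_def)
      have "(cyc p ^^ n a) a = (c, h c x)" "(cyc p ^^ n b) b = (d, h d y)" using cx n(1) by auto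
      then have "(c, h c x) = (d, h d y)" using ab(3) by argo
      then have cd: "c = d" "h c x = h c y" by auto
      then have "x = y" using cx Y[of c] by (meson inj_onD)
      then show "a = b" using cx cd by simp
    qed
    fix a assume "a \<in> Z"
    then obtain c x where cx: "a = (c, x)" "c < Q" "x \<in> Y c" by (auto simp: Z_def)
    have hx: "h c x < p c" "v (h c x) = j" using Y[OF cx(2)] cx(3) unfolding A'_def by blast+
    show "(cyc p ^^ n a) a \<in> \<Omega>" "(v \<circ> snd) ((cyc p ^^ n a) a) = j"
      using cx n(1) hx pB(1)[of c] by (auto simp: \<Omega>_def)
    have gen: "4 * k * (B * (F * (2 * Q))) = B * F * (8 * k) * Q" for F :: nat
      by (simp add: algebra_simps)
    have "{b \<in> \<Omega>. (cyc p ^^ n a) b \<noteq> b} \<subseteq> {c} \<times> {..<B * r c}"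
      using n(2)[OF cx(2,3)] cx by (force simp: \<Omega>_def)
    then have "card {b \<in> \<Omega>. (cyc p ^^ n a) b \<noteq> b} \<le> card ({c} \<times> {..<B * r c})"
      by (intro card_mono) auto
    also have "\<dots> = B * r c" by (simp add: card_cartesian_product)
    also have "\<dots> \<le> B * (fact Q * (2 * Q))"
      unfolding r_def using cx(2) by (intro mult_le_mono2) simp
    finally have "4 * k * card {b \<in> \<Omega>. (cyc p ^^ n a) b \<noteq> b} \<le> 4 * k * (B * (fact Q * (2 * Q)))"
      by (rule mult_le_mono2)
    also have "\<dots> = B * fact Q * (8 * k) * Q" by (rule gen)
    also have "\<dots> = B * fact Q * Q * Q" by (simp only: Q)
    finally show "4 * k * card {b \<in> \<Omega>. (cyc p ^^ n a) b \<noteq> b} \<le> card \<Omega>" using big by simp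
  qed
qed

lemma cyc_bij:
  assumes "\<And>c. c < Q \<Longrightarrow> p c \<le> b c"
  shows "bij_betw (cyc p) (SIGMA c:{..<Q::nat}. {..<b c}) (SIGMA c:{..<Q}. {..<b c})"
proof -
  let ?\<Omega> = "SIGMA c:{..<Q}. {..<b c}"
  have "inj_on (cyc p) ?\<Omega>"
  proof (rule inj_onI)
    fix u v assume uv: "u \<in> ?\<Omega>" "v \<in> ?\<Omega>" "cyc p u = cyc p v"
    obtain c x d y where cx: "u = (c, x)" "v = (d, y)" by (metis surj_pair)
    have "c = d" using uv(3) by (auto simp: cx cyc_def split: if_splits)
    moreover have "x = y"
      using uv(3) \<open>c = d\<close> by (auto simp: cx cyc_def mod_Suc split: if_splits)
    ultimately show "u = v" using cx by simp
  qed
  moreover have "cyc p ` ?\<Omega> \<subseteq> ?\<Omega>"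
  proof
    fix u assume "u \<in> cyc p ` ?\<Omega>"
    then obtain c x where cx: "c < Q" "x < b c" "u = cyc p (c, x)" by auto
    show "u \<in> ?\<Omega>"
    proof (cases "x < p c")
      case True
      then have "Suc x mod p c < b c" using assms[OF cx(1)] by (intro less_le_trans[OF mod_less_divisor]) auto
      then show ?thesis using cx True by (simp add: cyc_def)
    qed (use cx in \<open>simp add: cyc_def\<close>)
  qed
  ultimately show ?thesis by (simp add: bij_betw_def endo_inj_surj)
qed

lemma card_last_residue:
  fixes K N :: nat assumes "0 < K"
  shows "card {x \<in> {..<N * K}. x mod K = K - 1} \<le> N"
proof -
  have "{x \<in> {..<N * K}. x mod K = K - 1} \<subseteq> (\<lambda>q. q * K + (K - 1)) ` {..<N}"
  proof
    fix x assume x: "x \<in> {x \<in> {..<N * K}. x mod K = K - 1}"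
    then have "x div K < N" by (simp add: less_mult_imp_div_less)
    moreover have "x = x div K * K + (K - 1)" using x div_mult_mod_eq[of x K] by simp
    ultimately show "x \<in> (\<lambda>q. q * K + (K - 1)) ` {..<N}" by blast
  qed
  then have "card {x \<in> {..<N * K}. x mod K = K - 1} \<le> card {..<N}"
    by (rule surj_card_le[rotated]) simp
  then show ?thesis by simp
qed

text \<open>
  The columns have lengths \<open>p c\<close> and labels given by the itinerary \<open>w\<close> of \<open>\<pi>\<close>. As every label
  occurs equally often, the system of columns can be transported to the cells that subdivide those of
  \<open>\<pi>\<close>. It violates \<open>\<pi>\<close> only where an orbit segment or a column ends.
\<close>
lemma ex_shuffling_extension:
  assumes \<pi>: "\<pi> permutes {..<R}" and kR: "k dvd R" and R: "0 < R" and k: "0 < k" and \<epsilon>: "0 < (\<epsilon>::real)"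
  shows "\<exists>D \<sigma>. 2 \<le> D \<and> \<sigma> permutes {..<R * D} \<and>
     real (card {a \<in> {..<R * D}. \<sigma> a div D \<noteq> \<pi> (a div D)}) \<le> \<epsilon> * real (R * D) \<and>
     shuffles k {..<R * D} (\<lambda>a. a div (R * D div k)) \<sigma>"
proof -
  (* Orbit segments of length K: a proportion 1 / K of the points are ends of segments. *)
  obtain K0 :: nat where K0: "2 / \<epsilon> \<le> real K0" using real_arch_simple by blast
  define K where "K = K0 + 2"
  have K: "2 \<le> K" "2 \<le> \<epsilon> * real K"
  proof -
    show "2 \<le> K" by (simp add: K_def)
    have "2 / \<epsilon> \<le> real K" using K0 by (simp add: K_def)
    then show "2 \<le> \<epsilon> * real K" using \<epsilon> by (simp add: field_simps)
  qed
  define Q where "Q = 8 * k"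
  define r where "r c = fact Q * (Q + c)" for c :: nat
  define B where "B = R * K"
  define p where "p c = B * r c - 1" for c
  define \<Omega> where "\<Omega> = (SIGMA c:{..<Q}. {..<B * r c})"
  define w where "w x = (\<pi> ^^ (x mod K)) ((x div K) mod R)" for x
  define m where "m = R div k"
  have km: "k * m = R" using kR by (simp add: m_def)
  have m: "0 < m" using km R by (cases m) auto
  have Q: "0 < Q" using k by (simp add: Q_def)
  have rpos: "0 < r c" for c unfolding r_def using Q by (intro mult_pos_pos) auto
  have fw: "card {x \<in> {..<B * r c}. w x = l} = K * r c" if "l < R" for c l
    unfolding B_def w_def using itinerary_fibre[OF \<pi> that] K by simp
  have wR: "w x < R" for x
  proof -
    have "(\<pi> ^^ (x mod K)) permutes {..<R}" using \<pi> by (rule permutes_funpow)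
    then show ?thesis using R permutes_in_image[of _ "{..<R}" "(x div K) mod R"] by (simp add: w_def)
  qed
  have fv: "k * card {x \<in> {..<B * r c}. w x div m = i} = B * r c" if i: "i < k" for c i
  proof -
    have eq: "{x \<in> {..<B * r c}. w x div m = i} = (\<Union>l\<in>{i * m..<i * m + m}. {x \<in> {..<B * r c}. w x = l})"
    proof -
      have "a div m = i \<longleftrightarrow> i * m \<le> a \<and> a < i * m + m" for a
      proof
        assume "a div m = i"
        then show "i * m \<le> a \<and> a < i * m + m"
          using div_mult_mod_eq[of a m] mod_less_divisor[OF m, of a] by auto
      qed (auto intro!: div_nat_eqI simp: mult.commute)
      then have "w x div m = i \<longleftrightarrow> w x \<in> {i * m..<i * m + m}" for x by simp
      then show ?thesis by blast
    qed
    have lR: "l < R" if "l \<in> {i * m..<i * m + m}" for l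
    proof -
      have "l < Suc i * m" using that by simp
      also have "\<dots> \<le> k * m" using i by (intro mult_le_mono1) simp
      finally show ?thesis using km by simp
    qed
    have "card {x \<in> {..<B * r c}. w x div m = i} = (\<Sum>l\<in>{i * m..<i * m + m}. card {x \<in> {..<B * r c}. w x = l})"
      unfolding eq by (rule card_UN_disjoint) auto
    also have "\<dots> = (\<Sum>l\<in>{i * m..<i * m + m}. K * r c)" using lR fw by (intro sum.cong) auto
    also have "\<dots> = m * (K * r c)" by simp
    finally have "k * card {x \<in> {..<B * r c}. w x div m = i} = (k * m) * (K * r c)" by simp
    then show ?thesis by (simp only: km B_def mult.assoc)
  qed
  have sh: "shuffles k \<Omega> ((\<lambda>x. w x div m) \<circ> snd) (cyc p)"
  proof -
    have "0 < B" using R K by (simp add: B_def)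
    from coprime_cycles_shuffle[OF Q_def this k, of "\<lambda>x. w x div m"] fv
    show ?thesis unfolding p_def \<Omega>_def r_def by simp
  qed
  define M where "M = (\<Sum>c<Q. r c)"
  define D where "D = K * M"
  have Mpos: "0 < M"
  proof -
    have "r 0 \<le> M" unfolding M_def using Q by (intro member_le_sum) auto
    then show ?thesis using rpos[of 0] by linarith
  qed
  have D2: "2 \<le> D"
  proof -
    have "2 * 1 \<le> K * M" using K Mpos by (intro mult_le_mono) auto
    then show ?thesis by (simp add: D_def)
  qed
  have fin: "finite \<Omega>" by (simp add: \<Omega>_def)
  have "\<exists>E. bij_betw E \<Omega> {..<R * D} \<and> (\<forall>x\<in>\<Omega>. E x div D = (w \<circ> snd) x)"
  proof (rule ex_bij_betw_equal_fibres[OF fin])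
    show "w \<circ> snd \<in> \<Omega> \<rightarrow> {..<R}" using wR by auto
    show "0 < D" using D2 by simp
    fix l assume l: "l < R"
    have "{x \<in> \<Omega>. (w \<circ> snd) x = l} = (SIGMA c:{..<Q}. {x \<in> {..<B * r c}. w x = l})"
      by (auto simp: \<Omega>_def)
    then have "card {x \<in> \<Omega>. (w \<circ> snd) x = l} = (\<Sum>c<Q. card {x \<in> {..<B * r c}. w x = l})"
      by simp
    also have "\<dots> = D" using fw[OF l] by (simp add: D_def M_def sum_distrib_left)
    finally show "card {x \<in> \<Omega>. (w \<circ> snd) x = l} = D" .
  qed
  then obtain E where E: "bij_betw E \<Omega> {..<R * D}" and Ew: "\<And>x. x \<in> \<Omega> \<Longrightarrow> E x div D = w (snd x)"
    by auto
  define F where "F = inv_into \<Omega> E"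
  have F: "bij_betw F {..<R * D} \<Omega>" unfolding F_def using E by (rule bij_betw_inv_into)
  have FE: "F (E x) = x" if "x \<in> \<Omega>" for x
    using E that by (simp add: F_def bij_betw_def)
  define \<sigma> where "\<sigma> a = (if a < R * D then E (cyc p (F a)) else a)" for a
  have cb: "bij_betw (cyc p) \<Omega> \<Omega>" unfolding \<Omega>_def by (rule cyc_bij) (simp add: p_def)
  have cO: "cyc p x \<in> \<Omega>" if "x \<in> \<Omega>" for x using cb that by (auto simp: bij_betw_def)
  have EO: "E x < R * D" if "x \<in> \<Omega>" for x using E that by (auto simp: bij_betw_def)
  have \<sigma>E: "\<sigma> (E x) = E (cyc p x)" if "x \<in> \<Omega>" for x
    using that EO FE by (simp add: \<sigma>_def)
  have perm: "\<sigma> permutes {..<R * D}"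
  proof (rule bij_imp_permutes)
    have "bij_betw (E \<circ> cyc p \<circ> F) {..<R * D} {..<R * D}"
      using F cb E by (metis bij_betw_trans comp_assoc)
    then show "bij_betw \<sigma> {..<R * D} {..<R * D}"
      by (rule bij_betw_cong[THEN iffD1, rotated]) (simp add: \<sigma>_def)
  qed (simp add: \<sigma>_def)
  have Rk: "R * D div k = m * D"
  proof -
    have "R * D = k * (m * D)" using km by (simp add: mult.assoc[symmetric])
    then show ?thesis unfolding \<open>R * D = k * (m * D)\<close> using k by simp
  qed
  have "shuffles k {..<R * D} (\<lambda>a. a div (R * D div k)) \<sigma>"
  proof (rule shuffles_conj[OF sh E fin])
    fix x assume x: "x \<in> \<Omega>"
    show "E x div (R * D div k) = ((\<lambda>x. w x div m) \<circ> snd) x"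
      unfolding Rk using Ew[OF x] by (simp add: div_mult2_eq mult.commute[of m D])
  qed (use cO \<sigma>E in auto)
  moreover have "real (card {a \<in> {..<R * D}. \<sigma> a div D \<noteq> \<pi> (a div D)}) \<le> \<epsilon> * real (R * D)"
  proof -
    (* In column c, besides the ends of segments only the last point of the cycle behaves differently; it
       has position B * r c - 2, since the point B * r c - 1 is fixed. *)
    define S where "S c = {x \<in> {..<R * r c * K}. x mod K = K - 1}" for c
    define Bad where "Bad = (SIGMA c:{..<Q}. insert (B * r c - 2) (S c))"
    have wS: "w (Suc x) = \<pi> (w x)" if "x mod K \<noteq> K - 1" for x
    proof -
      have "Suc x mod K = Suc (x mod K)" "Suc x div K = x div K"
        using that K by (auto simp: mod_Suc div_Suc)
      then show ?thesis by (simp add: w_def)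
    qed
    have sub: "{a \<in> {..<R * D}. \<sigma> a div D \<noteq> \<pi> (a div D)} \<subseteq> E ` Bad"
    proof
      fix a assume a: "a \<in> {a \<in> {..<R * D}. \<sigma> a div D \<noteq> \<pi> (a div D)}"
      then have "a \<in> E ` \<Omega>" using E by (auto simp: bij_betw_def)
      then obtain c x where cx: "c < Q" "x < B * r c" "a = E (c, x)" "(c, x) \<in> \<Omega>"
        by (auto simp: \<Omega>_def)
      have ne: "w (snd (cyc p (c, x))) \<noteq> \<pi> (w x)"
        using a cx \<sigma>E Ew cO by auto
      have "(c, x) \<in> Bad"
      proof (rule ccontr)
        assume nb: "(c, x) \<notin> Bad"
        have "B * r c = R * r c * K" by (simp add: B_def mult_ac)
        then have "x < R * r c * K" using cx(2) by (simp only:)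
        moreover have "x \<notin> S c" and x2: "x \<noteq> B * r c - 2" using nb cx(1) by (auto simp: Bad_def)
        ultimately have xK: "x mod K \<noteq> K - 1" by (simp add: S_def)
        have "x \<noteq> B * r c - 1"
        proof
          assume "x = B * r c - 1"
          then have "Suc x = R * r c * K" using cx(2) \<open>B * r c = R * r c * K\<close> by linarith
          then have "Suc x mod K = 0" by simp
          then show False using xK by (auto simp: mod_Suc split: if_splits)
        qed
        then have "Suc x < p c" using x2 cx(2) by (simp add: p_def)
        then have "snd (cyc p (c, x)) = Suc x" by (simp add: cyc_def)
        then show False using ne wS[OF xK] by simp
      qed
      then show "a \<in> E ` Bad" using cx(3) by (intro image_eqI)
    qed
    have finS: "finite (S c)" for c
      unfolding S_def by (rule finite_subset[OF _ finite_lessThan]) blast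
    have finB: "finite Bad" unfolding Bad_def using finS by (intro finite_SigmaI finite_lessThan finite.insertI)
    have "card {a \<in> {..<R * D}. \<sigma> a div D \<noteq> \<pi> (a div D)} \<le> card Bad"
      by (rule surj_card_le[OF finB sub])
    also have "card Bad = (\<Sum>c<Q. card (insert (B * r c - 2) (S c)))"
      unfolding Bad_def using finS by (intro card_SigmaI finite_lessThan ballI finite.insertI)
    also have "\<dots> \<le> (\<Sum>c<Q. 2 * (R * r c))"
    proof (rule sum_mono)
      fix c
      have "card (insert (B * r c - 2) (S c)) \<le> Suc (card (S c))" by (rule card_insert_le_m1) auto
      also have "card (S c) \<le> R * r c" unfolding S_def using K by (intro card_last_residue) simp
      also have "Suc (R * r c) \<le> 2 * (R * r c)" using R rpos[of c] by (simp add: Suc_le_eq)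
      finally show "card (insert (B * r c - 2) (S c)) \<le> 2 * (R * r c)" by simp
    qed
    also have "\<dots> = 2 * (R * M)" by (simp add: M_def sum_distrib_left)
    finally have "real (card {a \<in> {..<R * D}. \<sigma> a div D \<noteq> \<pi> (a div D)}) \<le> 2 * real (R * M)"
      by linarith
    also have "\<dots> \<le> (\<epsilon> * real K) * real (R * M)" using K(2) by (rule mult_right_mono) simp
    also have "\<dots> = \<epsilon> * real (R * D)" by (simp add: D_def)
    finally show ?thesis .
  qed
  ultimately show ?thesis using D2 perm by blast
qed

section \<open>Cells of the unit interval\<close>

definition cell :: "nat \<Rightarrow> real \<Rightarrow> nat" where
  "cell R x = nat \<lfloor>real R * x\<rfloor>"

abbreviation unit_interval :: "real measure" where
  "unit_interval \<equiv> restrict_space lborel {0..1}"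

lemma cell_div: "0 \<le> x \<Longrightarrow> cell (R * K) x div K = cell R x" if "0 < K" for x :: real
proof -
  assume x: "0 \<le> x"
  have "\<lfloor>real R * x\<rfloor> = \<lfloor>(real (R * K) * x) / real_of_int (int K)\<rfloor>"
    using that by simp
  also have "\<dots> = \<lfloor>real (R * K) * x\<rfloor> div int K"
    by (rule floor_divide_real_eq_div) simp
  finally show ?thesis
    using x by (simp add: cell_def nat_div_distrib)
qed

lemma cell_eq_iff:
  assumes "0 < R" "0 \<le> x"
  shows "cell R x = i \<longleftrightarrow> real i / real R \<le> x \<and> x < (real i + 1) / real R"
proof -
  have "0 \<le> \<lfloor>real R * x\<rfloor>" using assms by simp
  then have "cell R x = i \<longleftrightarrow> \<lfloor>real R * x\<rfloor> = int i" by (auto simp: cell_def)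
  also have "\<dots> \<longleftrightarrow> real i \<le> real R * x \<and> real R * x < real i + 1"
    by (simp add: floor_eq_iff)
  also have "\<dots> \<longleftrightarrow> real i / real R \<le> x \<and> x < (real i + 1) / real R"
    using assms by (simp add: field_simps)
  finally show ?thesis .
qed

lemma cell_bounds:
  assumes "0 < R" "0 \<le> x"
  shows "real (cell R x) / real R \<le> x" "x < (real (cell R x) + 1) / real R"
proof -
  have *: "real (cell R x) / real R \<le> x \<and> x < (real (cell R x) + 1) / real R"
    by (rule iffD1[OF cell_eq_iff[OF assms] refl])
  from * show "real (cell R x) / real R \<le> x" by (rule conjunct1)
  from * show "x < (real (cell R x) + 1) / real R" by (rule conjunct2)
qed

lemma cell_less: "0 < R \<Longrightarrow> 0 \<le> x \<Longrightarrow> x < 1 \<Longrightarrow> cell R x < R"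
proof -
  assume a: "0 < R" "0 \<le> x" "x < 1"
  have "real (cell R x) \<le> real R * x" using cell_bounds(1)[OF a(1,2)] a(1) by (simp add: field_simps)
  also have "\<dots> < real R * 1" using a by (intro mult_strict_left_mono) auto
  finally show ?thesis by simp
qed

lemma space_unit_interval [simp]: "space unit_interval = {0..1}"
  by (simp add: space_restrict_space)

lemma measurable_unit_intervalI:
  "f \<in> borel_measurable M \<Longrightarrow> (\<And>x. x \<in> space M \<Longrightarrow> f x \<in> {0..1}) \<Longrightarrow> f \<in> measurable M unit_interval"
  by (intro measurable_restrict_space2) auto

lemma borel_measurable_unit_interval [measurable]: "(\<lambda>x. x) \<in> borel_measurable unit_interval"
  by (rule measurable_restrict_space1) simp

lemma measurable_unit_interval_borel: "f \<in> measurable M unit_interval \<Longrightarrow> f \<in> borel_measurable M"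
  using measurable_compose[OF _ borel_measurable_unit_interval] by simp

lemma cell_borel [measurable]: "cell R \<in> measurable borel (count_space UNIV)"
  unfolding cell_def by measurable

lemma cell_measurable [measurable]: "cell R \<in> measurable unit_interval (count_space UNIV)"
  by (rule measurable_restrict_space1) simp

interpretation unit_interval: prob_space unit_interval
  by (rule prob_spaceI) (simp add: emeasure_restrict_space)

lemma AE_unit_interval_less: "AE x in unit_interval. 0 \<le> x \<and> x < 1"
proof -
  have "AE x in lborel. x \<noteq> (1::real)" by (rule AE_lborel_singleton)
  then have "AE x in unit_interval. x \<noteq> 1" by (subst AE_restrict_space_iff) auto
  moreover have "AE x in unit_interval. x \<in> {0..1}" using AE_space[of unit_interval] by simp
  ultimately show ?thesis by eventually_elim auto
qed

lemma measure_cell: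
  assumes "0 < R" "i < R"
  shows "measure unit_interval {x \<in> space unit_interval. cell R x = i} = 1 / real R"
proof -
  have le1: "(real i + 1) / real R \<le> 1" using assms by (simp add: field_simps)
  have eq: "{x \<in> space unit_interval. cell R x = i} = {real i / real R ..< (real i + 1) / real R}"
  proof (rule equalityI; rule subsetI)
    fix x assume "x \<in> {x \<in> space unit_interval. cell R x = i}"
    then have "0 \<le> x" "cell R x = i" by simp_all
    then show "x \<in> {real i / real R ..< (real i + 1) / real R}"
      using cell_eq_iff[OF assms(1)] by (simp only: atLeastLessThan_iff)
  next
    fix x assume "x \<in> {real i / real R ..< (real i + 1) / real R}"
    then have x: "real i / real R \<le> x" "x < (real i + 1) / real R" by simp_all
    moreover have "0 \<le> real i / real R" by simp
    ultimately have "0 \<le> x" "x \<le> 1" using le1 by linarith+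
    moreover from this x have "cell R x = i" using cell_eq_iff[OF assms(1)] by blast
    ultimately show "x \<in> {x \<in> space unit_interval. cell R x = i}" by simp
  qed
  have "measure unit_interval {x \<in> space unit_interval. cell R x = i}
      = measure lborel {real i / real R ..< (real i + 1) / real R}"
    unfolding eq[symmetric] by (rule measure_restrict_space) auto
  also have "\<dots> = (real i + 1) / real R - real i / real R"
    by (rule measure_lborel_Ico) (simp add: divide_right_mono)
  finally show ?thesis by (simp add: diff_divide_distrib[symmetric])
qed

lemma (in prob_space) prob_uniform:
  assumes f: "f \<in> measurable M (count_space UNIV)" and S: "S \<subseteq> {..<R::nat}"
    and unif: "\<And>i. i < R \<Longrightarrow> prob {x \<in> space M. f x = i} = 1 / real R"
  shows "prob {x \<in> space M. f x \<in> S} = card S / real R"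
proof -
  have fin: "finite S" using S by (rule finite_subset) simp
  have m: "{x \<in> space M. f x = i} \<in> sets M" for i
    using measurable_sets[OF f, of "{i}"] by (simp add: vimage_def Int_def conj_commute)
  have "{x \<in> space M. f x \<in> S} = (\<Union>i\<in>S. {x \<in> space M. f x = i})" by auto
  then have "prob {x \<in> space M. f x \<in> S} = prob (\<Union>i\<in>S. {x \<in> space M. f x = i})" by simp
  also have "\<dots> = (\<Sum>i\<in>S. prob {x \<in> space M. f x = i})"
    by (rule finite_measure_finite_Union) (use fin m in \<open>auto simp: disjoint_family_on_def\<close>)
  also have "\<dots> = (\<Sum>i\<in>S. 1 / real R)" using S unif by (intro sum.cong) auto
  finally show ?thesis by simp
qed

lemma measure_cells:
  assumes "0 < R" "S \<subseteq> {..<R}"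
  shows "measure unit_interval {x \<in> space unit_interval. cell R x \<in> S} = card S / real R"
  by (rule unit_interval.prob_uniform[OF cell_measurable assms(2) measure_cell[OF assms(1)]])

text \<open>
  Up to an error \<open>1 / R m\<close>, the event \<open>v x \<le> a\<close> is a union of cells.
\<close>
lemma prob_le_of_uniform_cells:
  assumes v: "v \<in> borel_measurable unit_interval" "\<And>x. x \<in> space unit_interval \<Longrightarrow> v x \<in> {0..1}"
    and R: "\<And>m::nat. 0 < R m" "filterlim R at_top sequentially"
    and unif: "\<And>m b. b < R m \<Longrightarrow> measure unit_interval {x \<in> space unit_interval. cell (R m) (v x) = b} = 1 / real (R m)"
    and a: "0 \<le> a" "a < 1"
  shows "measure unit_interval {x \<in> space unit_interval. v x \<le> a} = a"
proof -
  let ?p = "measure unit_interval {x \<in> space unit_interval. v x \<le> a}"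
  have cv: "(\<lambda>x. cell r (v x)) \<in> measurable unit_interval (count_space UNIV)" for r
    by (rule measurable_compose[OF v(1) cell_borel])
  have meas: "{x \<in> space unit_interval. v x \<le> a} \<in> sets unit_interval"
    using measurable_sets[OF v(1), of "{..a}"] by (simp add: vimage_def Int_def conj_commute)
  have measS: "{x \<in> space unit_interval. cell r (v x) \<in> S} \<in> sets unit_interval" for r S
    using measurable_sets[OF cv, of S r] by (simp add: vimage_def Int_def conj_commute)
  have bound: "\<bar>?p - a\<bar> \<le> 1 / real (R m)" for m
  proof -
    let ?r = "R m"
    define b where "b = cell ?r a"
    have b: "b < ?r" unfolding b_def using R(1) a by (rule cell_less)
    have ab: "real b / ?r \<le> a" "a < (real b + 1) / ?r"
      unfolding b_def using cell_bounds[OF R(1) a(1)] by auto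
    have "measure unit_interval {x \<in> space unit_interval. cell ?r (v x) \<in> {..<b}} = card {..<b} / real ?r"
      using b by (intro unit_interval.prob_uniform[OF cv _ unif]) auto
    moreover have "measure unit_interval {x \<in> space unit_interval. cell ?r (v x) \<in> {..<b}} \<le> ?p"
    proof (rule unit_interval.finite_measure_mono[OF subsetI meas])
      fix x assume "x \<in> {x \<in> space unit_interval. cell ?r (v x) \<in> {..<b}}"
      then have x: "x \<in> space unit_interval" "cell ?r (v x) \<in> {..<b}" by blast+
      have "v x < (real (cell ?r (v x)) + 1) / ?r" using v(2)[OF x(1)] R(1) by (intro cell_bounds) auto
      also have "\<dots> \<le> real b / ?r" using x(2) by (intro divide_right_mono) auto
      finally have "v x \<le> a" using ab by linarith
      with x(1) show "x \<in> {x \<in> space unit_interval. v x \<le> a}" by blast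
    qed
    moreover have "measure unit_interval {x \<in> space unit_interval. cell ?r (v x) \<in> {..b}} = card {..b} / real ?r"
      using b by (intro unit_interval.prob_uniform[OF cv _ unif]) auto
    moreover have "?p \<le> measure unit_interval {x \<in> space unit_interval. cell ?r (v x) \<in> {..b}}"
    proof (rule unit_interval.finite_measure_mono[OF subsetI measS])
      fix x assume "x \<in> {x \<in> space unit_interval. v x \<le> a}"
      then have x: "x \<in> space unit_interval" "v x \<le> a" by blast+
      then have "real ?r * v x \<le> real ?r * a" by (intro mult_left_mono) auto
      then have "cell ?r (v x) \<in> {..b}" unfolding b_def cell_def
        by (simp add: nat_mono floor_mono)
      with x(1) show "x \<in> {x \<in> space unit_interval. cell ?r (v x) \<in> {..b}}" by blast
    qed
    ultimately show ?thesis using ab by (simp add: add_divide_distrib)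
  qed
  have "(\<lambda>m. 1 / real (R m)) \<longlonglongrightarrow> 0"
    by (intro tendsto_divide_0[OF tendsto_const] filterlim_at_top_imp_at_infinity
        filterlim_compose[OF filterlim_real_sequentially R(2)])
  then have "\<bar>?p - a\<bar> \<le> 0" using bound by (intro LIMSEQ_le_const) auto
  then show ?thesis by simp
qed

text \<open>
  The probabilities of the cells determine the distribution function, by \<open>prob_le_of_uniform_cells\<close>.
\<close>
lemma distr_eq_of_uniform_cells:
  assumes v: "v \<in> measurable unit_interval unit_interval"
    and R: "\<And>m::nat. 0 < R m" "filterlim R at_top sequentially"
    and unif: "\<And>m b. b < R m \<Longrightarrow> measure unit_interval {x \<in> space unit_interval. cell (R m) (v x) = b} = 1 / real (R m)"
  shows "distr unit_interval unit_interval v = unit_interval"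
proof -
  have vb: "v \<in> borel_measurable unit_interval" using v by (rule measurable_unit_interval_borel)
  have v01: "v x \<in> {0..1}" if "x \<in> space unit_interval" for x using measurable_space[OF v that] by simp
  have cdfs: "cdf (distr unit_interval borel f) a = (if a < 0 then 0 else if a < 1 then a else 1)"
    if f: "f \<in> borel_measurable unit_interval" "\<And>x. x \<in> space unit_interval \<Longrightarrow> f x \<in> {0..1}"
      "\<And>m b. b < R m \<Longrightarrow> measure unit_interval {x \<in> space unit_interval. cell (R m) (f x) = b} = 1 / real (R m)" for f a
  proof -
    have "cdf (distr unit_interval borel f) a = measure unit_interval {x \<in> space unit_interval. f x \<le> a}"
      unfolding cdf_def using f(1) by (subst measure_distr) (auto intro!: arg_cong[where f = "measure unit_interval"])
    also have "\<dots> = (if a < 0 then 0 else if a < 1 then a else 1)"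
    proof -
      consider "a < 0" | "0 \<le> a" "a < 1" | "1 \<le> a" by linarith
      then show ?thesis
      proof cases
        case 1
        have "\<not> f x \<le> a" if "x \<in> space unit_interval" for x using f(2)[OF that] 1 by simp
        then have e: "{x \<in> space unit_interval. f x \<le> a} = {}" by blast
        show ?thesis unfolding e using 1 by simp
      next
        case 2
        then show ?thesis using prob_le_of_uniform_cells[OF f(1,2) R f(3)] by simp
      next
        case 3
        have "f x \<le> a" if "x \<in> space unit_interval" for x using f(2)[OF that] 3 by simp
        then have e: "{x \<in> space unit_interval. f x \<le> a} = space unit_interval" by blast
        show ?thesis unfolding e unit_interval.prob_space using 3 by simp
      qed
    qed
    finally show ?thesis .
  qed
  have "distr unit_interval borel v = distr unit_interval borel (\<lambda>x. x)"
  proof (rule cdf_unique)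
    show "real_distribution (distr unit_interval borel v)"
      unfolding real_distribution_def real_distribution_axioms_def
      using unit_interval.prob_space_distr[OF vb] by simp
    show "real_distribution (distr unit_interval borel (\<lambda>x. x))"
      unfolding real_distribution_def real_distribution_axioms_def
      using unit_interval.prob_space_distr[OF borel_measurable_unit_interval] by simp
    show "cdf (distr unit_interval borel v) = cdf (distr unit_interval borel (\<lambda>x. x))"
    proof
      fix a
      show "cdf (distr unit_interval borel v) a = cdf (distr unit_interval borel (\<lambda>x. x)) a"
        using cdfs[OF vb v01 unif, of a] cdfs[of "\<lambda>x. x" a] measure_cell R(1) by simp
    qed
  qed
  then have eq: "emeasure unit_interval (v -` B \<inter> space unit_interval) = emeasure unit_interval (B \<inter> space unit_interval)"
    if "B \<in> sets borel" for B
    using that emeasure_distr[OF vb, of B] emeasure_distr[OF borel_measurable_unit_interval, of B]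
    by (simp add: vimage_def)
  show ?thesis
  proof (rule measure_eqI)
    fix A assume "A \<in> sets (distr unit_interval unit_interval v)"
    then have A: "A \<in> sets unit_interval" by simp
    then have "A \<in> sets borel" "A \<subseteq> space unit_interval"
      using sets.sets_into_space[OF A] by (auto simp: sets_restrict_space)
    then show "emeasure (distr unit_interval unit_interval v) A = emeasure unit_interval A"
      using eq[of A] A v by (simp add: emeasure_distr Int_absorb2)
  qed simp
qed

section \<open>Limits of towers of cell permutations\<close>

lemma div_eq_last_iff:
  fixes a q b :: nat
  assumes "0 < q" "a div q = b"
  shows "b * q \<le> a" "a < b * q + q"
proof -
  have "a = b * q + a mod q" using assms(2) by (metis div_mult_mod_eq)
  moreover have "a mod q < q" using assms(1) by simp
  ultimately show "b * q \<le> a" "a < b * q + q" by linarith+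
qed

text \<open>
  A sequence of permutations of finer and finer cells such that \<open>\<pi> (Suc m)\<close> induces \<open>\<pi> m\<close> on the
  coarser cells, up to a set of exceptional cells with summable proportions.
\<close>
locale permutation_tower =
  fixes R D :: "nat \<Rightarrow> nat" and \<pi> :: "nat \<Rightarrow> nat \<Rightarrow> nat"
  assumes R_pos: "\<And>m. 0 < R m" and R_Suc: "\<And>m. R (Suc m) = R m * D m" and D2: "\<And>m. 2 \<le> D m"
    and perm: "\<And>m. \<pi> m permutes {..<R m}"
    and summable_err: "summable (\<lambda>m. card {a \<in> {..<R (Suc m)}. \<pi> (Suc m) a div D m \<noteq> \<pi> m (a div D m)} / real (R (Suc m)))"
begin

definition err :: "nat \<Rightarrow> nat set" where
  "err m = {a \<in> {..<R (Suc m)}. \<pi> (Suc m) a div D m \<noteq> \<pi> m (a div D m)}"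

text \<open>
  From stage \<open>m\<close> on, \<open>x\<close> avoids the exceptional cells, so the image cells at the stages \<open>j \<ge> m\<close> are nested.
\<close>
definition consistent :: "nat \<Rightarrow> real \<Rightarrow> bool" where
  "consistent m x \<longleftrightarrow> (\<forall>j\<ge>m. cell (R (Suc j)) x \<notin> err j)"

lemma R_tends: "filterlim R at_top sequentially"
proof (rule filterlim_at_top_mono[OF filterlim_ident], rule always_eventually, rule allI)
  fix m show "m \<le> R m"
  proof (induction m)
    case (Suc m)
    have "Suc m \<le> R m * 2" using Suc R_pos[of m] by linarith
    also have "\<dots> \<le> R (Suc m)" unfolding R_Suc using D2 by (rule mult_le_mono2)
    finally show ?case .
  qed simp
qed

lemma R_dvd: "m \<le> j \<Longrightarrow> R m dvd R j"
  by (induction j rule: dec_induct) (auto simp: R_Suc)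

lemma R_div: "m \<le> j \<Longrightarrow> R j = R m * (R j div R m)"
  using R_dvd by simp

lemma R_div_pos: "m \<le> j \<Longrightarrow> 0 < R j div R m"
  using R_div[of m j] R_pos[of j] by (metis gr0I mult_0_right less_numeral_extra(3))

lemma cell_coarser: "m \<le> j \<Longrightarrow> 0 \<le> x \<Longrightarrow> cell (R j) x div (R j div R m) = cell (R m) x"
  using cell_div[of "R j div R m" x "R m"] R_div[of m j] R_div_pos[of m j] by metis

lemma perm_less: "a < R m \<Longrightarrow> \<pi> m a < R m"
  using permutes_in_image[OF perm, of m a] by simp

lemma consistent_mono: "consistent m x \<Longrightarrow> m \<le> j \<Longrightarrow> consistent j x"
  by (auto simp: consistent_def)

lemma consistent_images:
  assumes "consistent m x" "0 \<le> x" "x < 1" "m \<le> j"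
  shows "\<pi> j (cell (R j) x) div (R j div R m) = \<pi> m (cell (R m) x)"
  using assms(4)
proof (induction j rule: dec_induct)
  case base
  then show ?case using R_pos[of m] by simp
next
  case (step j)
  let ?a = "cell (R (Suc j)) x"
  have D0: "0 < D j" using D2[of j] by simp
  have "?a \<notin> err j" using assms(1) step(1) by (simp add: consistent_def)
  moreover have "?a < R (Suc j)" using assms R_pos by (intro cell_less)
  ultimately have 1: "\<pi> (Suc j) ?a div D j = \<pi> j (?a div D j)" by (simp add: err_def)
  have 2: "?a div D j = cell (R j) x" unfolding R_Suc using D0 assms(2) by (rule cell_div)
  have "R (Suc j) div R m = D j * (R j div R m)"
    using R_dvd[OF step(1)] unfolding R_Suc by (simp add: div_mult_swap mult.commute)
  then have "\<pi> (Suc j) ?a div (R (Suc j) div R m) = \<pi> (Suc j) ?a div D j div (R j div R m)"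
    by (simp only: div_mult2_eq)
  then show ?case using 1 2 step(3) by simp
qed

text \<open>
  The left end point of the image cell of \<open>x\<close> at stage \<open>m\<close>.
\<close>
definition approx :: "nat \<Rightarrow> real \<Rightarrow> real" where
  "approx m x = real (\<pi> m (cell (R m) x)) / real (R m)"

lemma approx_bounds:
  assumes "consistent m x" "0 \<le> x" "x < 1" "m \<le> j"
  shows "approx m x \<le> approx j x" "approx j x + 1 / real (R j) \<le> approx m x + 1 / real (R m)"
proof -
  define q where "q = R j div R m"
  define b where "b = \<pi> m (cell (R m) x)"
  define a where "a = \<pi> j (cell (R j) x)"
  have q: "0 < q" "R j = R m * q" using R_div_pos R_div assms(4) by (auto simp: q_def)
  have ab: "b * q \<le> a" "a < b * q + q"
    using div_eq_last_iff[OF q(1), of a b] consistent_images[OF assms] unfolding a_def b_def q_def by auto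
  have "real b * real q \<le> real a" using ab(1) by (metis of_nat_le_iff of_nat_mult)
  then have "(real b * real q) / real (R j) \<le> real a / real (R j)" by (rule divide_right_mono) simp
  moreover have "(real b * real q) / real (R j) = real b / real (R m)" using q by simp
  ultimately show "approx m x \<le> approx j x" by (simp add: approx_def a_def b_def)
  have "a + 1 \<le> (b + 1) * q" using ab(2) by simp
  then have "real a + 1 \<le> (real b + 1) * real q" by (metis of_nat_le_iff of_nat_mult of_nat_add of_nat_1)
  then have "(real a + 1) / real (R j) \<le> ((real b + 1) * real q) / real (R j)" by (rule divide_right_mono) simp
  also have "\<dots> = (real b + 1) / real (R m)" using q by simp
  finally show "approx j x + 1 / real (R j) \<le> approx m x + 1 / real (R m)"
    by (simp add: approx_def a_def b_def add_divide_distrib)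
qed

lemma inverse_R_tends: "(\<lambda>m. 1 / real (R m)) \<longlonglongrightarrow> 0"
  by (intro tendsto_divide_0[OF tendsto_const] filterlim_at_top_imp_at_infinity
      filterlim_compose[OF filterlim_real_sequentially R_tends])

lemma approx_convergent:
  assumes "consistent m x" "0 \<le> x" "x < 1"
  shows "convergent (\<lambda>j. approx j x)"
proof -
  have "incseq (\<lambda>j. approx (j + m) x)"
    using approx_bounds(1)[OF consistent_mono[OF assms(1)] assms(2,3)]
    by (intro incseq_SucI) simp
  moreover have "approx (j + m) x \<le> approx m x + 1 / real (R m)" for j
  proof -
    have "approx (j + m) x \<le> approx (j + m) x + 1 / real (R (j + m))" by simp
    also have "\<dots> \<le> approx m x + 1 / real (R m)" using assms by (intro approx_bounds) auto
    finally show ?thesis .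
  qed
  ultimately have "convergent (\<lambda>j. approx (j + m) x)"
    using incseq_convergent by (metis convergent_def)
  then show ?thesis by (auto simp: convergent_def intro: LIMSEQ_offset)
qed

text \<open>
  The cut-off to the unit interval concerns only the null set of points at which the approximations do not converge.
\<close>
definition limit_map :: "real \<Rightarrow> real" where
  "limit_map x = max 0 (min 1 (lim (\<lambda>j. approx j x)))"

lemma approx_borel: "approx m \<in> borel_measurable unit_interval"
proof -
  have "(\<lambda>i. real (\<pi> m i) / real (R m)) \<in> measurable (count_space UNIV) borel" by simp
  from measurable_compose[OF cell_measurable this] show ?thesis unfolding approx_def by (simp add: comp_def)
qed

lemma limit_map_measurable: "limit_map \<in> measurable unit_interval unit_interval"
proof (rule measurable_unit_intervalI)
  have "(\<lambda>x. lim (\<lambda>j. approx j x)) \<in> borel_measurable unit_interval"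
    by (rule borel_measurable_lim_metric) (rule approx_borel)
  then show "limit_map \<in> borel_measurable unit_interval" unfolding limit_map_def by (intro borel_measurable_max borel_measurable_min) auto
qed (simp add: limit_map_def)

lemma limit_map_bounds:
  assumes "consistent m x" "0 \<le> x" "x < 1" "m \<le> j"
  shows "approx j x \<le> limit_map x" "limit_map x \<le> approx j x + 1 / real (R j)"
proof -
  define L where "L = lim (\<lambda>j. approx j x)"
  have L: "(\<lambda>j. approx j x) \<longlonglongrightarrow> L"
    using approx_convergent[OF assms(1-3)] by (simp add: L_def convergent_LIMSEQ_iff)
  have j: "consistent j x" using assms consistent_mono by blast
  have "approx j x \<le> L"
    using L approx_bounds(1)[OF j assms(2,3)] by (intro LIMSEQ_le_const) auto
  moreover have "L \<le> approx j x + 1 / real (R j)"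
  proof (rule LIMSEQ_le_const2[OF L], intro exI allI impI)
    fix i assume "j \<le> i"
    have "approx i x \<le> approx i x + 1 / real (R i)" by simp
    then show "approx i x \<le> approx j x + 1 / real (R j)"
      using approx_bounds(2)[OF j assms(2,3) \<open>j \<le> i\<close>] by linarith
  qed
  moreover have "0 \<le> approx j x" by (simp add: approx_def)
  moreover have "approx j x + 1 / real (R j) \<le> 1"
  proof -
    have "\<pi> j (cell (R j) x) + 1 \<le> R j"
      using perm_less[OF cell_less[OF R_pos assms(2,3)], of j] by simp
    then have "(real (\<pi> j (cell (R j) x)) + 1) / real (R j) \<le> 1" using R_pos[of j] by simp
    then show ?thesis by (simp add: approx_def add_divide_distrib)
  qed
  moreover have "limit_map x = max 0 (min 1 L)" by (simp add: limit_map_def L_def)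
  ultimately show "approx j x \<le> limit_map x" "limit_map x \<le> approx j x + 1 / real (R j)"
    by linarith+
qed

text \<open>
  Nested half-open cells can have an empty intersection, namely if from some stage on each of them is the
  rightmost part of its predecessor. Then the limit is the common right end point, which lies outside
  of these cells.
\<close>
definition edge :: "nat \<Rightarrow> real \<Rightarrow> bool" where
  "edge m x \<longleftrightarrow> (\<forall>j\<ge>m. \<exists>b<R m. \<pi> j (cell (R j) x) + 1 = (b + 1) * (R j div R m))"

text \<open>
  The limit lies in the closure of each image cell, and it is the right end point only if the end points of
  all later image cells coincide with it.
\<close>
lemma limit_map_cell:
  assumes "consistent m x" "0 \<le> x" "x < 1" "\<not> edge m x"
  shows "cell (R m) (limit_map x) = \<pi> m (cell (R m) x)"
proof -
  let ?b = "\<pi> m (cell (R m) x)"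
  have b: "?b < R m" using perm_less[OF cell_less[OF R_pos assms(2,3)]] .
  have lm: "approx m x \<le> limit_map x" "limit_map x \<le> approx m x + 1 / real (R m)"
    using limit_map_bounds[OF assms(1-3) order_refl] by auto
  have "limit_map x \<noteq> approx m x + 1 / real (R m)"
  proof
    assume eq: "limit_map x = approx m x + 1 / real (R m)"
    have "edge m x" unfolding edge_def
    proof (intro allI impI)
      fix j assume j: "m \<le> j"
      define q where "q = R j div R m"
      have q: "0 < q" "R j = R m * q" using R_div_pos R_div j by (auto simp: q_def)
      have "approx j x + 1 / real (R j) = approx m x + 1 / real (R m)"
        using limit_map_bounds(2)[OF assms(1-3) j] approx_bounds(2)[OF assms(1-3) j] eq by linarith
      then have "(real (\<pi> j (cell (R j) x)) + 1) / real (R j) = (real ?b + 1) / real (R m)"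
        by (simp add: approx_def add_divide_distrib)
      then have "(real (\<pi> j (cell (R j) x)) + 1) / real (R j) * real (R j) = (real ?b + 1) / real (R m) * real (R j)"
        by (rule arg_cong)
      moreover have "(real ?b + 1) / real (R m) * real (R j) = (real ?b + 1) * real q"
        unfolding q(2) using R_pos[of m] by simp
      moreover have "(real (\<pi> j (cell (R j) x)) + 1) / real (R j) * real (R j) = real (\<pi> j (cell (R j) x)) + 1"
        using R_pos[of j] by simp
      ultimately have "real (\<pi> j (cell (R j) x)) + 1 = (real ?b + 1) * real q" by argo
      then have "\<pi> j (cell (R j) x) + 1 = (?b + 1) * q"
        by (metis of_nat_eq_iff of_nat_mult of_nat_add of_nat_1)
      then show "\<exists>b<R m. \<pi> j (cell (R j) x) + 1 = (b + 1) * (R j div R m)"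
        using b by (auto simp: q_def)
    qed
    then show False using assms(4) by simp
  qed
  then have "limit_map x < approx m x + 1 / real (R m)" using lm by simp
  moreover have "0 \<le> limit_map x" by (simp add: limit_map_def)
  ultimately show ?thesis using lm(1)
    by (subst cell_eq_iff[OF R_pos]) (simp_all add: approx_def add_divide_distrib)
qed

text \<open>
  At stage \<open>j\<close> at most one cell per cell of stage \<open>m\<close> can be affected, a proportion \<open>R m / R j\<close> that
  tends to zero.
\<close>
lemma AE_not_edge: "AE x in unit_interval. \<not> edge m x"
proof -
  define S where "S j = {a \<in> {..<R j}. \<exists>b<R m. \<pi> j a + 1 = (b + 1) * (R j div R m)}" for j
  define N where "N = (\<Inter>i. {x \<in> space unit_interval. cell (R (m + i)) x \<in> S (m + i)})"
  have meas: "{x \<in> space unit_interval. cell r x \<in> T} \<in> sets unit_interval" for r T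
    using measurable_sets[OF cell_measurable, of T r] by (simp add: vimage_def Int_def conj_commute)
  have NS: "N \<in> sets unit_interval" unfolding N_def using meas by (intro sets.countable_INT) auto
  have bound: "measure unit_interval N \<le> real (R m) * (1 / real (R (m + i)))" for i
  proof -
    let ?j = "m + i"
    have "inj_on (\<lambda>a. \<pi> ?j a + 1) (S ?j)"
      using permutes_inj[OF perm[of ?j]] by (auto simp: inj_on_def inj_def)
    then have "card (S ?j) = card ((\<lambda>a. \<pi> ?j a + 1) ` S ?j)" by (simp add: card_image)
    also have "\<dots> \<le> card ((\<lambda>b. (b + 1) * (R ?j div R m)) ` {..<R m})"
      by (rule card_mono) (auto simp: S_def)
    also have "\<dots> \<le> R m" using card_image_le[of "{..<R m}"] by simp
    finally have cS: "real (card (S ?j)) \<le> real (R m)" by simp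
    have "measure unit_interval N \<le> measure unit_interval {x \<in> space unit_interval. cell (R ?j) x \<in> S ?j}"
      unfolding N_def by (rule unit_interval.finite_measure_mono[OF _ meas]) blast
    also have "\<dots> = card (S ?j) / real (R ?j)" using R_pos by (intro measure_cells) (auto simp: S_def)
    also have "\<dots> \<le> real (R m) / real (R ?j)" using cS by (rule divide_right_mono) simp
    finally show ?thesis by simp
  qed
  have "(\<lambda>i. real (R m) * (1 / real (R (m + i)))) \<longlonglongrightarrow> real (R m) * 0"
    using LIMSEQ_ignore_initial_segment[OF inverse_R_tends, of m]
    by (intro tendsto_mult tendsto_const) (simp add: add.commute)
  then have "measure unit_interval N \<le> 0" using bound by (intro LIMSEQ_le_const) auto
  then have "N \<in> null_sets unit_interval"
    using NS by (simp add: null_sets_def unit_interval.emeasure_eq_measure measure_le_0_iff)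
  then have "AE x in unit_interval. x \<notin> N" by (rule AE_not_in)
  with AE_unit_interval_less show ?thesis
  proof eventually_elim
    case (elim x)
    show ?case
    proof
      assume e: "edge m x"
      have "cell (R (m + i)) x \<in> S (m + i)" for i
        using e elim(1) R_pos by (auto simp: edge_def S_def cell_less)
      then show False using elim by (auto simp: N_def)
    qed
  qed
qed

text \<open>
  Countable subadditivity over the stages after \<open>m\<close>. The bounds \<open>e j\<close> are kept general so that explicit
  geometric bounds can be used later.
\<close>
lemma measure_inconsistent_le:
  assumes "(\<And>j. m \<le> j \<Longrightarrow> card (err j) / real (R (Suc j)) \<le> e j)" "summable (\<lambda>i. e (m + i))"
  shows "{x \<in> space unit_interval. \<not> consistent m x} \<in> sets unit_interval"
    "measure unit_interval {x \<in> space unit_interval. \<not> consistent m x} \<le> (\<Sum>i. e (m + i))"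
proof -
  let ?A = "\<lambda>i. {x \<in> space unit_interval. cell (R (Suc (m + i))) x \<in> err (m + i)}"
  have meas: "{x \<in> space unit_interval. cell r x \<in> T} \<in> sets unit_interval" for r T
    using measurable_sets[OF cell_measurable, of T r] by (simp add: vimage_def Int_def conj_commute)
  have A: "measure unit_interval (?A i) \<le> e (m + i)" for i
  proof -
    have "measure unit_interval (?A i) = card (err (m + i)) / real (R (Suc (m + i)))"
      using R_pos by (intro measure_cells) (auto simp: err_def)
    also have "\<dots> \<le> e (m + i)" using assms(1) by simp
    finally show ?thesis .
  qed
  have eq: "{x \<in> space unit_interval. \<not> consistent m x} = (\<Union>i. ?A i)"
    unfolding consistent_def using le_iff_add[of m] by auto
  show "{x \<in> space unit_interval. \<not> consistent m x} \<in> sets unit_interval"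
    unfolding eq using meas by (intro sets.countable_UN) auto
  have sA: "summable (\<lambda>i. measure unit_interval (?A i))"
    using A by (intro summable_comparison_test_ev[OF _ assms(2)] always_eventually) auto
  have "measure unit_interval (\<Union>i. ?A i) \<le> (\<Sum>i. measure unit_interval (?A i))"
    using meas by (intro unit_interval.finite_measure_subadditive_countably sA) auto
  also have "\<dots> \<le> (\<Sum>i. e (m + i))" using A by (intro suminf_le sA assms(2)) auto
  finally show "measure unit_interval {x \<in> space unit_interval. \<not> consistent m x} \<le> (\<Sum>i. e (m + i))"
    unfolding eq .
qed

definition err_tail :: "nat \<Rightarrow> real" where
  "err_tail m = (\<Sum>i. card (err (m + i)) / real (R (Suc (m + i))))"

lemma err_tail_tends: "err_tail \<longlonglongrightarrow> 0"
proof -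
  let ?e = "\<lambda>j. card (err j) / real (R (Suc j))"
  have s: "summable ?e" using summable_err by (simp add: err_def)
  have "(\<lambda>m. suminf ?e - sum ?e {..<m}) \<longlonglongrightarrow> suminf ?e - suminf ?e"
    by (intro tendsto_diff tendsto_const summable_LIMSEQ s)
  moreover have "suminf ?e - sum ?e {..<m} = err_tail m" for m
    using suminf_minus_initial_segment[OF s, of m] by (simp add: err_tail_def add.commute)
  ultimately show ?thesis by simp
qed

lemma inconsistent:
  shows inconsistent_sets: "{x \<in> space unit_interval. \<not> consistent m x} \<in> sets unit_interval"
    and measure_inconsistent: "measure unit_interval {x \<in> space unit_interval. \<not> consistent m x} \<le> err_tail m"
proof -
  let ?e = "\<lambda>j. card (err j) / real (R (Suc j))"
  have "summable ?e" using summable_err by (simp add: err_def)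
  then have "summable (\<lambda>i. ?e (m + i))" using summable_iff_shift[of ?e m] by (simp add: add.commute)
  from measure_inconsistent_le[of m ?e, OF order_refl this]
  show "{x \<in> space unit_interval. \<not> consistent m x} \<in> sets unit_interval"
    "measure unit_interval {x \<in> space unit_interval. \<not> consistent m x} \<le> err_tail m"
    by (simp_all add: err_tail_def)
qed

lemma AE_eventually_consistent: "AE x in unit_interval. \<exists>m. consistent m x"
proof -
  define N where "N = (\<Inter>m. {x \<in> space unit_interval. \<not> consistent m x})"
  have NS: "N \<in> sets unit_interval" unfolding N_def using inconsistent_sets by (intro sets.countable_INT) auto
  have "measure unit_interval N \<le> err_tail m" for m
  proof -
    have "measure unit_interval N \<le> measure unit_interval {x \<in> space unit_interval. \<not> consistent m x}"
      unfolding N_def by (rule unit_interval.finite_measure_mono[OF _ inconsistent_sets]) blast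
    then show ?thesis using measure_inconsistent[of m] by linarith
  qed
  then have "measure unit_interval N \<le> 0" using err_tail_tends by (intro LIMSEQ_le_const) auto
  then have "N \<in> null_sets unit_interval"
    using NS by (simp add: null_sets_def unit_interval.emeasure_eq_measure measure_le_0_iff)
  then have "AE x in unit_interval. x \<notin> N" by (rule AE_not_in)
  with AE_space show ?thesis by eventually_elim (simp add: N_def)
qed

lemma AE_limit_map_cell:
  "AE x in unit_interval. \<forall>m. consistent m x \<longrightarrow> cell (R m) (limit_map x) = \<pi> m (cell (R m) x)"
proof -
  have "AE x in unit_interval. \<forall>m. \<not> edge m x" unfolding AE_all_countable using AE_not_edge by blast
  with AE_unit_interval_less show ?thesis by eventually_elim (use limit_map_cell in blast)
qed

text \<open>
  On the points that are consistent from stage \<open>j\<close> on, the preimage of a cell under the limit is its preimage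
  under \<open>\<pi> j\<close>, which has the correct measure. Let \<open>j\<close> tend to infinity.
\<close>
lemma distr_limit_map: "distr unit_interval unit_interval limit_map = unit_interval"
proof (rule distr_eq_of_uniform_cells[OF limit_map_measurable R_pos R_tends])
  fix m b assume b: "b < R m"
  let ?A = "{x \<in> space unit_interval. cell (R m) (limit_map x) = b}"
  let ?I = "\<lambda>j. {x \<in> space unit_interval. \<not> consistent j x}"
  have AS: "?A \<in> sets unit_interval"
    using measurable_sets[OF measurable_compose[OF limit_map_measurable cell_measurable], of "{b}" "R m"]
    by (simp add: vimage_def Int_def conj_commute)
  have bound: "\<bar>measure unit_interval ?A - 1 / real (R m)\<bar> \<le> err_tail j" if j: "m \<le> j" for j
  proof -
    define q where "q = R j div R m"
    have q: "0 < q" "R j = R m * q" using R_div_pos R_div j by (auto simp: q_def)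
    define S where "S = {a \<in> {..<R j}. \<pi> j a div q = b}"
    let ?T = "{x \<in> space unit_interval. cell (R j) x \<in> S}"
    have TS: "?T \<in> sets unit_interval"
      using measurable_sets[OF cell_measurable, of S "R j"] by (simp add: vimage_def Int_def conj_commute)
    have "card S = q"
    proof -
      have "\<pi> j ` S = {b * q..<b * q + q}"
      proof (rule equalityI; rule subsetI)
        fix y assume "y \<in> \<pi> j ` S"
        then obtain a where "y = \<pi> j a" "y div q = b" by (auto simp: S_def)
        then show "y \<in> {b * q..<b * q + q}" using div_eq_last_iff[OF q(1), of y b] by simp
      next
        fix y assume y: "y \<in> {b * q..<b * q + q}"
        then have d: "y div q = b" by (intro div_nat_eqI) (auto simp: mult.commute)
        have "(b + 1) * q \<le> R m * q" using b by (intro mult_le_mono1) simp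
        then have "y < R j" using y unfolding q(2) by simp
        then obtain a where "a < R j" "y = \<pi> j a" using permutes_image[OF perm[of j]] by auto
        then show "y \<in> \<pi> j ` S" using d by (auto simp: S_def)
      qed
      moreover have "inj_on (\<pi> j) S" using permutes_inj[OF perm[of j]] by (rule inj_on_subset) simp
      ultimately show ?thesis by (metis card_image card_atLeastLessThan add_diff_cancel_left')
    qed
    moreover have "measure unit_interval ?T = card S / real (R j)"
      using R_pos by (intro measure_cells) (auto simp: S_def)
    ultimately have T: "measure unit_interval ?T = 1 / real (R m)" using q by simp
    have iff: "AE x in unit_interval. consistent j x \<longrightarrow> (x \<in> ?A \<longleftrightarrow> x \<in> ?T)"
      using AE_limit_map_cell AE_unit_interval_less
    proof eventually_elim
      case (elim x)
      show ?case
      proof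
        assume c: "consistent j x"
        have "0 \<le> limit_map x" by (simp add: limit_map_def)
        then have "cell (R m) (limit_map x) = cell (R j) (limit_map x) div q"
          using cell_coarser[OF j] by (simp add: q_def)
        also have "\<dots> = \<pi> j (cell (R j) x) div q" using elim(1) c by simp
        finally have "cell (R m) (limit_map x) = \<pi> j (cell (R j) x) div q" .
        moreover have "cell (R j) x < R j" using elim R_pos by (simp add: cell_less)
        ultimately show "x \<in> ?A \<longleftrightarrow> x \<in> ?T" by (simp add: S_def)
      qed
    qed
    have "measure unit_interval ?A \<le> measure unit_interval (?T \<union> ?I j)"
    proof (rule unit_interval.finite_measure_mono_AE)
      show "AE x in unit_interval. x \<in> ?A \<longrightarrow> x \<in> ?T \<union> ?I j"
        using iff AE_space by eventually_elim blast
    qed (use TS inconsistent_sets in blast)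
    also have "\<dots> \<le> measure unit_interval ?T + measure unit_interval (?I j)"
      by (rule measure_Un_le[OF TS inconsistent_sets])
    finally have 1: "measure unit_interval ?A \<le> 1 / real (R m) + err_tail j"
      using T measure_inconsistent[of j] by linarith
    have "measure unit_interval ?T \<le> measure unit_interval (?A \<union> ?I j)"
    proof (rule unit_interval.finite_measure_mono_AE)
      show "AE x in unit_interval. x \<in> ?T \<longrightarrow> x \<in> ?A \<union> ?I j"
        using iff AE_space by eventually_elim blast
    qed (use AS inconsistent_sets in blast)
    also have "\<dots> \<le> measure unit_interval ?A + measure unit_interval (?I j)"
      by (rule measure_Un_le[OF AS inconsistent_sets])
    finally show ?thesis using 1 T measure_inconsistent[of j] by linarith
  qed
  have "\<bar>measure unit_interval ?A - 1 / real (R m)\<bar> \<le> 0"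
    using err_tail_tends bound by (intro LIMSEQ_le_const) auto
  then show "measure unit_interval ?A = 1 / real (R m)" by simp
qed

text \<open>
  An exceptional cell of \<open>\<pi> (Suc m)\<close> is mapped to an exceptional cell of the inverse, so the
  proportions are the same.
\<close>
lemma inverse_tower: "permutation_tower R D (\<lambda>m. inv_into UNIV (\<pi> m))"
proof
  fix m show "0 < R m" "R (Suc m) = R m * D m" "2 \<le> D m" by (rule R_pos R_Suc D2)+
  show "inv_into UNIV (\<pi> m) permutes {..<R m}" using perm by (rule permutes_inv)
next
  have "card {a \<in> {..<R (Suc m)}. inv_into UNIV (\<pi> (Suc m)) a div D m \<noteq> inv_into UNIV (\<pi> m) (a div D m)}
      = card {a \<in> {..<R (Suc m)}. \<pi> (Suc m) a div D m \<noteq> \<pi> m (a div D m)}" (is "card ?X = card ?Y") for m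
  proof -
    have p: "\<pi> (Suc m) permutes {..<R (Suc m)}" "\<pi> m permutes {..<R m}" by (rule perm)+
    have "\<pi> (Suc m) ` ?Y = ?X"
    proof (rule equalityI; rule subsetI)
      fix y assume "y \<in> \<pi> (Suc m) ` ?Y"
      then obtain a where a: "y = \<pi> (Suc m) a" "a < R (Suc m)" "y div D m \<noteq> \<pi> m (a div D m)" by auto
      then have "y < R (Suc m)" using perm_less by simp
      moreover have "inv_into UNIV (\<pi> (Suc m)) y = a" using a(1) permutes_inverses(2)[OF p(1)] by simp
      moreover have "a div D m \<noteq> inv_into UNIV (\<pi> m) (y div D m)"
        using a(3) permutes_inverses(1)[OF p(2), of "y div D m"] by metis
      ultimately show "y \<in> ?X" by simp
    next
      fix y assume y: "y \<in> ?X"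
      define a where "a = inv_into UNIV (\<pi> (Suc m)) y"
      have ya: "y = \<pi> (Suc m) a" unfolding a_def using permutes_inverses(1)[OF p(1)] by simp
      have "a < R (Suc m)" using y permutes_in_image[OF permutes_inv[OF p(1)], of y] by (simp add: a_def)
      moreover have "y div D m \<noteq> \<pi> m (a div D m)"
      proof
        assume "y div D m = \<pi> m (a div D m)"
        then have "inv_into UNIV (\<pi> m) (y div D m) = a div D m" using permutes_inverses(2)[OF p(2)] by simp
        then show False using y by (simp add: a_def)
      qed
      ultimately show "y \<in> \<pi> (Suc m) ` ?Y" using ya by blast
    qed
    moreover have "inj_on (\<pi> (Suc m)) ?Y" using permutes_inj[OF p(1)] by (rule inj_on_subset) simp
    then have "card (\<pi> (Suc m) ` ?Y) = card ?Y" by (rule card_image)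
    ultimately show ?thesis by (simp only:)
  qed
  then show "summable (\<lambda>m. card {a \<in> {..<R (Suc m)}. inv_into UNIV (\<pi> (Suc m)) a div D m
       \<noteq> inv_into UNIV (\<pi> m) (a div D m)} / real (R (Suc m)))"
    using summable_err by (simp only:)
qed

text \<open>
  For almost all \<open>x\<close> and all late stages, the inverse permutation takes the cell of \<open>limit_map x\<close> back to
  the cell of \<open>x\<close>. So both points are in common cells of arbitrarily small length.
\<close>
lemma AE_limit_map_inverse:
  "AE x in unit_interval. permutation_tower.limit_map R (\<lambda>m. inv_into UNIV (\<pi> m)) (limit_map x) = x"
proof -
  interpret i: permutation_tower R D "\<lambda>m. inv_into UNIV (\<pi> m)" by (rule inverse_tower)
  have d: "AE x in unit_interval. P (limit_map x)" if "AE y in unit_interval. P y" for P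
    by (rule AE_distrD[OF limit_map_measurable]) (simp only: distr_limit_map that)
  show ?thesis
    using AE_eventually_consistent AE_limit_map_cell d[OF i.AE_eventually_consistent]
      d[OF i.AE_limit_map_cell] AE_unit_interval_less
  proof eventually_elim
    case (elim x)
    define z where "z = i.limit_map (limit_map x)"
    obtain m1 m2 where m: "consistent m1 x" "i.consistent m2 (limit_map x)" using elim by blast
    have z0: "0 \<le> z" by (simp add: z_def i.limit_map_def)
    have bound: "\<bar>z - x\<bar> \<le> 1 / real (R m)" if "max m1 m2 \<le> m" for m
    proof -
      have "consistent m x" "i.consistent m (limit_map x)"
        using that m consistent_mono i.consistent_mono by auto
      then have "cell (R m) z = inv_into UNIV (\<pi> m) (\<pi> m (cell (R m) x))" using elim by (simp add: z_def)
      then have "cell (R m) z = cell (R m) x" using permutes_inverses(2)[OF perm] by simp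
      then show ?thesis using cell_bounds[OF R_pos z0, of m] cell_bounds[OF R_pos, of x m] elim(5)
        by (simp add: add_divide_distrib)
    qed
    have "\<bar>z - x\<bar> \<le> 0" using inverse_R_tends bound by (intro LIMSEQ_le_const) blast+
    then show ?case by (simp add: z_def)
  qed
qed

text \<open>
  The inverses of the permutations form a tower as well, and its limit is the inverse almost everywhere.
\<close>
lemma ex_limit_automorphism:
  "\<exists>u u'. u \<in> measurable unit_interval unit_interval \<and> u' \<in> measurable unit_interval unit_interval \<and>
     distr unit_interval unit_interval u = unit_interval \<and> distr unit_interval unit_interval u' = unit_interval \<and>
     (AE x in unit_interval. u' (u x) = x) \<and> (AE x in unit_interval. u (u' x) = x) \<and>
     (AE x in unit_interval. \<forall>m. consistent m x \<longrightarrow> cell (R m) (u x) = \<pi> m (cell (R m) x))"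
proof -
  interpret i: permutation_tower R D "\<lambda>m. inv_into UNIV (\<pi> m)" by (rule inverse_tower)
  have inv2: "(\<lambda>m. inv_into UNIV (inv_into UNIV (\<pi> m))) = \<pi>"
    by (rule ext, rule inv_inv_eq, rule permutes_bij[OF perm])
  show ?thesis
    by (intro exI conjI) (rule limit_map_measurable i.limit_map_measurable distr_limit_map i.distr_limit_map
      AE_limit_map_inverse i.AE_limit_map_inverse[unfolded inv2] AE_limit_map_cell)+
qed

end

section \<open>Measure preserving bijections and the subbase of the topology\<close>

lemma mp_iso_measurable: "mp_iso M M t \<Longrightarrow> t \<in> measurable M M"
  by (simp add: mp_iso_def)

lemma mp_iso_inv_into: "mp_iso M M t \<Longrightarrow> x \<in> space M \<Longrightarrow> inv_into (space M) t (t x) = x"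
  by (simp add: mp_iso_def bij_betw_def)

lemma mp_iso_into_inv: "mp_iso M M t \<Longrightarrow> x \<in> space M \<Longrightarrow> t (inv_into (space M) t x) = x"
  by (auto simp: mp_iso_def bij_betw_def f_inv_into_f)

lemma mp_iso_space: "mp_iso M M t \<Longrightarrow> x \<in> space M \<Longrightarrow> t x \<in> space M"
  by (rule measurable_space[OF mp_iso_measurable])

text \<open>
  Preimages are more convenient than images, since they behave well for composition and need no
  injectivity; the two are exchanged by \<open>pre_image\<close> and \<open>image_pre\<close>.
\<close>
abbreviation pre :: "'a measure \<Rightarrow> ('a \<Rightarrow> 'a) \<Rightarrow> 'a set \<Rightarrow> 'a set" where
  "pre M t A \<equiv> t -` A \<inter> space M"

lemma pre_sets: "mp_iso M M t \<Longrightarrow> A \<in> sets M \<Longrightarrow> pre M t A \<in> sets M"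
  by (rule measurable_sets[OF mp_iso_measurable])

lemma measure_pre:
  assumes t: "mp_iso M M t" and A: "A \<in> sets M"
  shows "measure M (pre M t A) = measure M A"
proof -
  have "measure (distr M M t) A = measure M (pre M t A)"
    using mp_iso_measurable[OF t] A by (rule measure_distr)
  then show ?thesis using t by (simp add: mp_iso_def)
qed

lemma image_eq_pre_inv:
  assumes t: "mp_iso M M t" and A: "A \<subseteq> space M"
  shows "t ` A = pre M (inv_into (space M) t) A"
proof (rule equalityI; rule subsetI)
  fix y assume "y \<in> t ` A"
  then obtain x where "x \<in> A" "y = t x" by blast
  then show "y \<in> pre M (inv_into (space M) t) A"
    using A mp_iso_inv_into[OF t, of x] mp_iso_space[OF t, of x] by auto
next
  fix y assume y: "y \<in> pre M (inv_into (space M) t) A"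
  then have "t (inv_into (space M) t y) = y" using mp_iso_into_inv[OF t] by blast
  then show "y \<in> t ` A" using y by (metis IntD1 imageI vimageD)
qed

lemma image_sets: "mp_iso M M t \<Longrightarrow> A \<in> sets M \<Longrightarrow> t ` A \<in> sets M"
proof -
  assume t: "mp_iso M M t" and A: "A \<in> sets M"
  have "t ` A = pre M (inv_into (space M) t) A"
    using t sets.sets_into_space[OF A] by (rule image_eq_pre_inv)
  moreover have "pre M (inv_into (space M) t) A \<in> sets M"
    using mp_iso_inv[OF t] A by (rule pre_sets)
  ultimately show "t ` A \<in> sets M" by (rule ssubst)
qed

lemma pre_image: "mp_iso M M t \<Longrightarrow> A \<in> sets M \<Longrightarrow> pre M t (t ` A) = A"
proof -
  assume t: "mp_iso M M t" and A: "A \<in> sets M"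
  have "A \<subseteq> space M" using A by (rule sets.sets_into_space)
  show ?thesis
  proof (rule equalityI; rule subsetI)
    fix x assume "x \<in> pre M t (t ` A)"
    then obtain a where a: "a \<in> A" "t x = t a" "x \<in> space M" by blast
    have "a \<in> space M" using a(1) \<open>A \<subseteq> space M\<close> by blast
    have "inv_into (space M) t (t a) = x" unfolding a(2)[symmetric] by (rule mp_iso_inv_into[OF t a(3)])
    then have "a = x" using mp_iso_inv_into[OF t \<open>a \<in> space M\<close>] by argo
    with a(1) show "x \<in> A" by (rule subst[rotated])
  next
    fix x assume "x \<in> A"
    then show "x \<in> pre M t (t ` A)" using \<open>A \<subseteq> space M\<close> by blast
  qed
qed

lemma image_pre: "mp_iso M M t \<Longrightarrow> A \<in> sets M \<Longrightarrow> t ` (pre M t A) = A"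
proof -
  assume t: "mp_iso M M t" and A: "A \<in> sets M"
  have AS: "A \<subseteq> space M" using A by (rule sets.sets_into_space)
  show ?thesis
  proof (rule equalityI; rule subsetI)
    fix x assume "x \<in> A"
    then have x: "x \<in> space M" "t (inv_into (space M) t x) = x"
      using AS mp_iso_into_inv[OF t, of x] by blast+
    then have "inv_into (space M) t x \<in> pre M t A"
      using mp_iso_space[OF mp_iso_inv[OF t] x(1)] \<open>x \<in> A\<close> by simp
    then show "x \<in> t ` pre M t A" using x(2) by (metis imageI)
  qed blast
qed

lemma measure_image: "mp_iso M M t \<Longrightarrow> A \<in> sets M \<Longrightarrow> measure M (t ` A) = measure M A"
proof -
  assume t: "mp_iso M M t" and A: "A \<in> sets M"
  show ?thesis using measure_pre[OF t image_sets[OF t A]] unfolding pre_image[OF t A] by (rule sym)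
qed

lemma AE_mp_iso_inv_eq:
  assumes s: "mp_iso M M s" and t: "mp_iso M M t" and eq: "AE x in M. s x = t x"
  shows "AE x in M. inv_into (space M) s x = inv_into (space M) t x"
proof -
  have "AE x in M. s (inv_into (space M) s x) = t (inv_into (space M) s x)"
    using AE_mp_iso[OF mp_iso_inv[OF s] eq] .
  with AE_space show ?thesis
  proof eventually_elim
    case (elim x)
    then have "t (inv_into (space M) s x) = x" using mp_iso_into_inv[OF s] by metis
    moreover have "inv_into (space M) s x \<in> space M" using mp_iso_space[OF mp_iso_inv[OF s]] elim by blast
    ultimately show ?case using mp_iso_inv_into[OF t] by metis
  qed
qed

lemma measure_image_cong_AE:
  assumes s: "mp_iso M M s" and t: "mp_iso M M t" and eq: "AE x in M. s x = t x"
    and A: "A \<in> sets M" and B: "B \<in> sets M"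
  shows "measure M (sym_diff B (s ` A)) = measure M (sym_diff B (t ` A))"
    and "measure M (s ` A \<inter> B) = measure M (t ` A \<inter> B)"
proof -
  have AS: "A \<subseteq> space M" using A by (rule sets.sets_into_space)
  have iff: "AE x in M. x \<in> s ` A \<longleftrightarrow> x \<in> t ` A"
    using AE_mp_iso_inv_eq[OF s t eq] AE_space
    by eventually_elim (simp add: image_eq_pre_inv[OF s AS] image_eq_pre_inv[OF t AS])
  note im = image_sets[OF s A] image_sets[OF t A]
  show "measure M (sym_diff B (s ` A)) = measure M (sym_diff B (t ` A))"
    using iff im B by (intro measure_eq_AE) auto
  show "measure M (s ` A \<inter> B) = measure M (t ` A \<inter> B)"
    using iff im B by (intro measure_eq_AE) auto
qed

lemma sym_diff_pre: "sym_diff (pre M t A) (pre M t B) = pre M t (sym_diff A B)"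
  by auto

text \<open>
  Apply \<open>s\<inverse>\<close> to \<open>t A \<triangle> s A\<close> and use \<open>s\<inverse> (s A) = A = t\<inverse> (t A)\<close>.
\<close>
lemma measure_sym_diff_images:
  assumes s: "mp_iso M M s" and t: "mp_iso M M t" and A: "A \<in> sets M"
  shows "measure M (sym_diff (t ` A) (s ` A)) = measure M (sym_diff (pre M s (t ` A)) (pre M t (t ` A)))"
proof -
  have "pre M s (sym_diff (t ` A) (s ` A)) = sym_diff (pre M s (t ` A)) (pre M s (s ` A))"
    by (simp only: sym_diff_pre)
  also have "pre M s (s ` A) = pre M t (t ` A)" unfolding pre_image[OF s A] pre_image[OF t A] ..
  finally have eq: "pre M s (sym_diff (t ` A) (s ` A)) = sym_diff (pre M s (t ` A)) (pre M t (t ` A))" .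
  have "sym_diff (t ` A) (s ` A) \<in> sets M" using image_sets[OF s A] image_sets[OF t A] by (intro sets.Un sets.Diff)
  then show ?thesis unfolding eq[symmetric] by (rule measure_pre[OF s, symmetric])
qed

lemma aut_class_eq_iff: "mp_iso M M s \<Longrightarrow> aut_class M s = aut_class M t \<Longrightarrow> AE x in M. s x = t x"
  using aut_class_self[of M s] by (simp add: aut_class_def)

lemma (in finite_measure) measure_sym_diff_triangle:
  assumes "A \<in> sets M" "B \<in> sets M" "C \<in> sets M"
  shows "measure M (sym_diff A C) \<le> measure M (sym_diff A B) + measure M (sym_diff B C)"
proof -
  have "measure M (sym_diff A C) \<le> measure M (sym_diff A B \<union> sym_diff B C)"
    by (rule finite_measure_mono) (use assms in auto)
  also have "\<dots> \<le> measure M (sym_diff A B) + measure M (sym_diff B C)"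
    using assms by (intro measure_Un_le) auto
  finally show ?thesis .
qed

text \<open>
  The class of \<open>t\<close> is the translate of the class of \<open>r = s\<inverse> t\<close>, and \<open>s\<close> preserves the measure of
  \<open>A \<triangle> r A\<close>. So the subbasic sets are balls for the pseudometrics \<open>\<mu>(s A \<triangle> t A)\<close>.
\<close>
lemma aut_class_in_coset_iff:
  assumes s: "mp_iso M M s" and t: "mp_iso M M t" and A: "A \<in> sets M"
  shows "aut_class M t \<in> aut_class M s <#\<^bsub>Aut M\<^esub> aut_nbhd M A e \<longleftrightarrow> measure M (sym_diff (s ` A) (t ` A)) < e"
proof -
  have nb: "aut_class M r \<in> aut_nbhd M A e \<longleftrightarrow> measure M (sym_diff A (r ` A)) < e" if r: "mp_iso M M r" for r
  proof -
    have "measure M (sym_diff A (r' ` A)) = measure M (sym_diff A (r ` A))" if "r' \<in> aut_class M r" for r'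
    proof -
      have r': "mp_iso M M r'" "AE x in M. r' x = r x" using that unfolding aut_class_def by blast+
      show ?thesis by (rule measure_image_cong_AE(1)[OF r'(1) r r'(2) A A])
    qed
    note same = this
    have "aut_class M r \<in> carrier (Aut M)" using r by (simp add: carrier_Aut)
    then have "aut_class M r \<in> aut_nbhd M A e \<longleftrightarrow> (\<forall>r'\<in>aut_class M r. measure M (sym_diff A (r' ` A)) < e)"
      by (simp add: aut_nbhd_def)
    also have "\<dots> \<longleftrightarrow> (\<forall>r'\<in>aut_class M r. measure M (sym_diff A (r ` A)) < e)"
      by (rule ball_cong) (simp_all only: same)
    also have "\<dots> \<longleftrightarrow> measure M (sym_diff A (r ` A)) < e"
      using aut_class_self[OF r] by (metis (no_types))
    finally show ?thesis .
  qed
  have img: "measure M (sym_diff (s ` A) ((s \<circ> r) ` A)) = measure M (sym_diff A (r ` A))" if r: "mp_iso M M r" for r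
  proof -
    have AS: "A \<subseteq> space M" "r ` A \<subseteq> space M"
      using sets.sets_into_space[OF A] sets.sets_into_space[OF image_sets[OF r A]] by auto
    have inj: "inj_on s (space M)" using s by (simp add: mp_iso_def bij_betw_def)
    have "s ` (sym_diff A (r ` A)) = sym_diff (s ` A) (s ` (r ` A))"
    proof -
      have "s ` (A - r ` A) = s ` A - s ` (r ` A)" "s ` (r ` A - A) = s ` (r ` A) - s ` A"
        using AS by (intro inj_on_image_set_diff[OF inj]; blast)+
      then show ?thesis by (simp only: image_Un)
    qed
    moreover have "measure M (s ` (sym_diff A (r ` A))) = measure M (sym_diff A (r ` A))"
      using A image_sets[OF r A] by (intro measure_image[OF s]) auto
    ultimately show ?thesis by (simp add: image_comp)
  qed
  show ?thesis
  proof
    assume "aut_class M t \<in> aut_class M s <#\<^bsub>Aut M\<^esub> aut_nbhd M A e"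
    then obtain H where H: "H \<in> aut_nbhd M A e" "aut_class M t = aut_class M s \<otimes>\<^bsub>Aut M\<^esub> H"
      unfolding l_coset_def by blast
    then obtain r where r: "mp_iso M M r" "H = aut_class M r" by (auto simp: aut_nbhd_def carrier_Aut)
    have "aut_class M t = aut_class M (s \<circ> r)" using H r Aut_mult[OF s r(1)] by simp
    then have eq: "AE x in M. t x = (s \<circ> r) x" by (rule aut_class_eq_iff[OF t])
    have "measure M (sym_diff (s ` A) (t ` A)) = measure M (sym_diff (s ` A) ((s \<circ> r) ` A))"
      by (rule measure_image_cong_AE(1)[OF t mp_iso_comp[OF r(1) s] eq A image_sets[OF s A]])
    then show "measure M (sym_diff (s ` A) (t ` A)) < e" using img[OF r(1)] nb[OF r(1)] H r by simp
  next
    assume le: "measure M (sym_diff (s ` A) (t ` A)) < e"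
    define r where "r = inv_into (space M) s \<circ> t"
    have r: "mp_iso M M r" unfolding r_def using mp_iso_comp[OF t mp_iso_inv[OF s]] .
    have "AE x in M. (s \<circ> r) x = t x"
      using AE_space by eventually_elim (simp add: r_def mp_iso_into_inv[OF s] mp_iso_space[OF t])
    then have cl: "aut_class M (s \<circ> r) = aut_class M t" by (rule aut_class_eqI)
    have eq: "AE x in M. t x = (s \<circ> r) x" by (rule aut_class_eq_iff[OF t cl[symmetric]])
    have "measure M (sym_diff (s ` A) (t ` A)) = measure M (sym_diff (s ` A) ((s \<circ> r) ` A))"
      by (rule measure_image_cong_AE(1)[OF t mp_iso_comp[OF r s] eq A image_sets[OF s A]])
    then have "aut_class M r \<in> aut_nbhd M A e" using le img[OF r] nb[OF r] by simp
    moreover have "aut_class M t = aut_class M s \<otimes>\<^bsub>Aut M\<^esub> aut_class M r"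
      using Aut_mult[OF s r] cl by simp
    ultimately show "aut_class M t \<in> aut_class M s <#\<^bsub>Aut M\<^esub> aut_nbhd M A e"
      unfolding l_coset_def by blast
  qed
qed

section \<open>Spaces with a coordinate in the unit interval\<close>

text \<open>
  What the proof uses of a standard Lebesgue space: a uniformly distributed coordinate that
  generates all measurable sets modulo null sets and along which automorphisms of the unit interval can
  be lifted. Both versions of standard Lebesgue spaces, Borel and complete, have one.
\<close>
locale lebesgue_coordinate = prob_space M for M :: "'a measure" +
  fixes \<phi> :: "'a \<Rightarrow> real"
  assumes coord: "\<phi> \<in> measurable M unit_interval" and distr_coord: "distr M unit_interval \<phi> = unit_interval"
    and coord_generates: "\<And>A. A \<in> sets M \<Longrightarrow> \<exists>B\<in>sets unit_interval. AE x in M. x \<in> A \<longleftrightarrow> \<phi> x \<in> B"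
    and coord_lift: "\<And>u u'. u \<in> measurable unit_interval unit_interval \<Longrightarrow> u' \<in> measurable unit_interval unit_interval \<Longrightarrow>
      distr unit_interval unit_interval u = unit_interval \<Longrightarrow> distr unit_interval unit_interval u' = unit_interval \<Longrightarrow>
      AE x in unit_interval. u' (u x) = x \<Longrightarrow> AE x in unit_interval. u (u' x) = x \<Longrightarrow>
      \<exists>s. mp_iso M M s \<and> (AE x in M. \<phi> (s x) = u (\<phi> x))"
begin

text \<open>
  The number of the cell of rank \<open>R\<close> that contains \<open>x\<close>. It is less than \<open>R\<close> except where \<open>\<phi> x = 1\<close>.
\<close>
definition idx :: "nat \<Rightarrow> 'a \<Rightarrow> nat" where
  "idx R x = cell R (\<phi> x)"

definition cells :: "nat \<Rightarrow> nat set \<Rightarrow> 'a set" where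
  "cells R J = {x \<in> space M. idx R x \<in> J}"

lemma coord_bounds: "x \<in> space M \<Longrightarrow> 0 \<le> \<phi> x" "x \<in> space M \<Longrightarrow> \<phi> x \<le> 1"
  using measurable_space[OF coord, of x] by simp_all

lemma idx_measurable: "idx R \<in> measurable M (count_space UNIV)"
  unfolding idx_def by (rule measurable_compose[OF coord cell_measurable])

lemma cells_sets: "cells R J \<in> sets M"
  using measurable_sets[OF idx_measurable, of J R] by (simp add: cells_def vimage_def Int_def conj_commute)

lemma AE_coord: "AE x in unit_interval. P x \<Longrightarrow> AE x in M. P (\<phi> x)"
  by (rule AE_distrD[OF coord]) (simp only: distr_coord)

lemma AE_idx_less: "0 < R \<Longrightarrow> AE x in M. idx R x < R"
proof -
  assume R: "0 < R"
  have "AE x in unit_interval. cell R x < R"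
    using AE_unit_interval_less by eventually_elim (simp add: cell_less R)
  then show ?thesis unfolding idx_def by (rule AE_coord)
qed

lemma measure_cells_card:
  assumes "0 < R" "J \<subseteq> {..<R}"
  shows "measure M (cells R J) = card J / real R"
proof -
  let ?B = "{y \<in> space unit_interval. cell R y \<in> J}"
  have B: "?B \<in> sets unit_interval"
    using measurable_sets[OF cell_measurable, of J R] by (simp add: vimage_def Int_def conj_commute)
  have "cells R J = \<phi> -` ?B \<inter> space M"
    unfolding cells_def idx_def using measurable_space[OF coord] by blast
  then have "measure M (cells R J) = measure (distr M unit_interval \<phi>) ?B"
    using measure_distr[OF coord B] by (simp only:)
  then show ?thesis unfolding distr_coord using measure_cells[OF assms] by (simp only:)
qed

lemma idx_div: "0 < K \<Longrightarrow> x \<in> space M \<Longrightarrow> idx (R * K) x div K = idx R x"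
  unfolding idx_def by (rule cell_div[OF _ coord_bounds(1)])

text \<open>
  Sets of cells can be rewritten at every multiple of their rank, so finitely many of them have a
  common rank.
\<close>
lemma cells_refine:
  assumes "R dvd S" "0 < S" "J \<subseteq> {..<R}"
  shows "\<exists>J'. J' \<subseteq> {..<S} \<and> cells S J' = cells R J"
proof -
  obtain K where K: "S = R * K" using assms(1) by blast
  then have Kpos: "0 < K" using assms(2) by simp
  define J' where "J' = {a. a div K \<in> J}"
  have "J' \<subseteq> {..<S}"
  proof
    fix a assume "a \<in> J'"
    then have "a div K < R" using assms(3) by (auto simp: J'_def)
    then show "a \<in> {..<S}" using Kpos by (simp add: K div_less_iff_less_mult)
  qed
  moreover have "cells S J' = cells R J"
    unfolding cells_def J'_def K using idx_div[OF Kpos] by auto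
  ultimately show ?thesis by blast
qed

text \<open>
  Induction on the generation of the Borel sets by initial segments: the boundary of an initial segment
  meets one cell only, and a countable union is approximated by a finite one.
\<close>
lemma approx_unit_interval:
  assumes "B \<in> sets unit_interval"
  shows "\<forall>e>0. \<exists>R J. 0 < R \<and> J \<subseteq> {..<R} \<and> measure M (sym_diff (\<phi> -` B \<inter> space M) (cells R J)) < e"
    (is "?P B")
proof -
  let ?pre = "\<lambda>B. \<phi> -` B \<inter> space M"
  have gen: "sets unit_interval = sigma_sets {0..1} (range (\<lambda>a. {0..1} \<inter> {..<a}))"
  proof -
    have b: "sets (borel :: real measure) = sigma_sets UNIV (range lessThan)"
      unfolding borel_Iio by (simp add: sets_measure_of)
    have "{0..1::real} \<in> sigma_sets UNIV (range lessThan)" unfolding b[symmetric] by simp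
    then have "(\<inter>) {0..1::real} ` sigma_sets UNIV (range lessThan) = sigma_sets {0..1} ((\<inter>) {0..1} ` range lessThan)"
      by (rule sigma_sets_Int) simp
    then show ?thesis by (simp add: sets_restrict_space b image_image)
  qed
  show ?thesis using assms unfolding gen
  proof (induction B rule: sigma_sets.induct)
    case (Basic B)
    then obtain a :: real where a: "B = {0..1} \<inter> {..<a}" by blast
    show ?case
    proof (intro allI impI)
      fix e :: real assume e: "0 < e"
      obtain R0 :: nat where R0: "1 / e < real R0" using reals_Archimedean2 by blast
      define R where "R = Suc R0"
      have R: "0 < R" "1 / real R < e"
      proof -
        have "1 / e < real R" using R0 by (simp add: R_def)
        then show "1 / real R < e" using e by (simp add: R_def field_simps)
      qed (simp add: R_def)
      define J where "J = {i \<in> {..<R}. (real i + 1) / real R \<le> a}"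
      define J1 where "J1 = {i \<in> {..<R}. real i / real R < a}"
      have JJ: "J \<subseteq> J1"
      proof
        fix i assume "i \<in> J"
        then have "i < R" "(real i + 1) / real R \<le> a" by (simp_all add: J_def)
        moreover have "real i / real R < (real i + 1) / real R" using R by (intro divide_strict_right_mono) auto
        ultimately show "i \<in> J1" by (simp add: J1_def)
      qed
      (* J1 - J contains at most one index, that of the cell around the end point a. *)
      have card1: "card (J1 - J) \<le> 1"
      proof -
        have "i = j" if "i \<in> J1 - J" "j \<in> J1 - J" for i j
        proof -
          have *: "real i < a * real R" "a * real R < real i + 1" if "i \<in> J1 - J" for i
            using that R(1) by (auto simp: J1_def J_def pos_divide_less_eq not_le pos_less_divide_eq)
          show ?thesis using *[OF that(1)] *[OF that(2)] by linarith
        qed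
        then have "card (J1 - J) \<le> Suc 0"
          by (subst card_le_Suc0_iff_eq) (auto simp: J1_def)
        then show ?thesis by simp
      qed
      have "AE x in M. x \<in> sym_diff (?pre B) (cells R J) \<longrightarrow> x \<in> cells R (J1 - J)"
        using AE_idx_less[OF R(1)] AE_space
      proof eventually_elim
        case (elim x)
        have b: "real (idx R x) / real R \<le> \<phi> x" "\<phi> x < (real (idx R x) + 1) / real R"
          unfolding idx_def using cell_bounds[OF R(1) coord_bounds(1)[OF elim(2)]] .
        have iB: "x \<in> ?pre B \<longleftrightarrow> \<phi> x < a" using a elim(2) coord_bounds[OF elim(2)] by simp
        show ?case
        proof
          assume x: "x \<in> sym_diff (?pre B) (cells R J)"
          show "x \<in> cells R (J1 - J)"
          proof (cases "x \<in> cells R J")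
            case True
            then have "\<phi> x < a" using b by (simp add: cells_def J_def)
            then show ?thesis using x True iB by blast
          next
            case False
            then have "\<phi> x < a" using x iB by blast
            then show ?thesis using False b elim by (simp add: cells_def J1_def)
          qed
        qed
      qed
      then have "measure M (sym_diff (?pre B) (cells R J)) \<le> measure M (cells R (J1 - J))"
        by (rule finite_measure_mono_AE) (rule cells_sets)
      also have "\<dots> = card (J1 - J) / real R" using R(1) by (intro measure_cells_card) (auto simp: J1_def)
      also have "\<dots> \<le> 1 / real R" using card1 by (intro divide_right_mono) auto
      also have "\<dots> < e" by (rule R)
      finally show "\<exists>R J. 0 < R \<and> J \<subseteq> {..<R} \<and> measure M (sym_diff (?pre B) (cells R J)) < e"
        using R(1) by (intro exI[of _ R] exI[of _ J]) (auto simp: J_def)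
    qed
  next
    case Empty
    have "cells 1 {} = {}" by (simp add: cells_def)
    then show ?case by (intro allI impI exI[of _ 1] exI[of _ "{}"]) simp
  next
    case (Compl B)
    show ?case
    proof (intro allI impI)
      fix e :: real assume "0 < e"
      then obtain R J where J: "0 < R" "J \<subseteq> {..<R}" "measure M (sym_diff (?pre B) (cells R J)) < e"
        using Compl.IH by blast
      have BS: "B \<in> sets unit_interval" "{0..1} - B \<in> sets unit_interval"
        using Compl.hyps sigma_sets.Compl[OF Compl.hyps] by (simp_all add: gen)
      have "AE x in M. x \<in> sym_diff (?pre ({0..1} - B)) (cells R ({..<R} - J)) \<longrightarrow> x \<in> sym_diff (?pre B) (cells R J)"
        using AE_idx_less[OF J(1)] AE_space
      proof eventually_elim
        case (elim x)
        then have "x \<in> ?pre ({0..1} - B) \<longleftrightarrow> x \<notin> ?pre B" using coord_bounds[of x] by auto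
        moreover have "x \<in> cells R ({..<R} - J) \<longleftrightarrow> x \<notin> cells R J" using elim by (simp add: cells_def)
        ultimately show ?case by blast
      qed
      then have "measure M (sym_diff (?pre ({0..1} - B)) (cells R ({..<R} - J))) \<le> measure M (sym_diff (?pre B) (cells R J))"
        using measurable_sets[OF coord BS(1)] cells_sets by (intro finite_measure_mono_AE) auto
      then show "\<exists>R J. 0 < R \<and> J \<subseteq> {..<R} \<and> measure M (sym_diff (?pre ({0..1} - B)) (cells R J)) < e"
        using J by (intro exI[of _ R] exI[of _ "{..<R} - J"]) auto
    qed
  next
    case (Union B)
    show ?case
    proof (intro allI impI)
      fix e :: real assume e: "0 < e"
      have BS: "?pre (B i) \<in> sets M" for i
        using Union.hyps by (intro measurable_sets[OF coord]) (simp add: gen)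
      have US: "(\<Union>i<n. ?pre (B i)) \<in> sets M" for n using BS by (intro sets.finite_UN) auto
      have pU: "?pre (\<Union>i. B i) = (\<Union>n. \<Union>i<n. ?pre (B i))" by blast
      have "incseq (\<lambda>n. \<Union>i<n. ?pre (B i))" by (intro incseq_SucI UN_mono) auto
      then have "(\<lambda>n. measure M (\<Union>i<n. ?pre (B i))) \<longlonglongrightarrow> measure M (?pre (\<Union>i. B i))"
        unfolding pU using US by (intro finite_Lim_measure_incseq) auto
      then have "\<forall>\<^sub>F n in sequentially. dist (measure M (\<Union>i<n. ?pre (B i))) (measure M (?pre (\<Union>i. B i))) < e / 2"
        using e by (intro tendstoD) auto
      then obtain n where n: "dist (measure M (\<Union>i<n. ?pre (B i))) (measure M (?pre (\<Union>i. B i))) < e / 2"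
        by (auto simp: eventually_sequentially)
      define e' where "e' = e / (2 * (real n + 1))"
      have e': "0 < e'" using e by (simp add: e'_def)
      have "\<forall>i. \<exists>R J. 0 < R \<and> J \<subseteq> {..<R} \<and> measure M (sym_diff (?pre (B i)) (cells R J)) < e'"
        using Union.IH e' by blast
      then obtain R J where RJ: "\<And>i. 0 < R i" "\<And>i. J i \<subseteq> {..<R i}"
          "\<And>i. measure M (sym_diff (?pre (B i)) (cells (R i) (J i))) < e'" by metis
      define S where "S = (\<Prod>i<n. R i)"
      have S: "0 < S" unfolding S_def using RJ(1) by (intro prod_pos) auto
      have "\<forall>i<n. \<exists>J'. J' \<subseteq> {..<S} \<and> cells S J' = cells (R i) (J i)"
        using cells_refine[OF _ S RJ(2)] unfolding S_def by (blast intro: dvd_prodI finite_lessThan)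
      then obtain J' where J': "\<And>i. i < n \<Longrightarrow> J' i \<subseteq> {..<S} \<and> cells S (J' i) = cells (R i) (J i)" by metis
      define I where "I = (\<Union>i<n. J' i)"
      have CI: "cells S I = (\<Union>i<n. cells (R i) (J i))"
      proof -
        have "cells S I = (\<Union>i<n. cells S (J' i))" by (auto simp: cells_def I_def)
        also have "\<dots> = (\<Union>i<n. cells (R i) (J i))" using J' by simp
        finally show ?thesis .
      qed
      have m: "sym_diff (?pre (B i)) (cells (R i) (J i)) \<in> sets M" for i using BS cells_sets by (intro sets.Un sets.Diff)
      have "measure M (sym_diff (\<Union>i<n. ?pre (B i)) (cells S I)) \<le> measure M (\<Union>i<n. sym_diff (?pre (B i)) (cells (R i) (J i)))"
        unfolding CI using m by (intro finite_measure_mono sets.finite_UN) auto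
      also have "\<dots> \<le> (\<Sum>i<n. measure M (sym_diff (?pre (B i)) (cells (R i) (J i))))"
        using m by (intro measure_UNION_le) auto
      also have "\<dots> \<le> (\<Sum>i<n. e')" using RJ(3) by (intro sum_mono) (simp add: less_imp_le)
      also have "\<dots> < e / 2" using e by (simp add: e'_def field_simps)
      finally have 1: "measure M (sym_diff (\<Union>i<n. ?pre (B i)) (cells S I)) < e / 2" .
      have PS: "?pre (\<Union>i. B i) \<in> sets M" unfolding pU using US by (intro sets.countable_UN) auto
      have sub: "(\<Union>i<n. ?pre (B i)) \<subseteq> ?pre (\<Union>i. B i)" by blast
      have "sym_diff (?pre (\<Union>i. B i)) (\<Union>i<n. ?pre (B i)) = ?pre (\<Union>i. B i) - (\<Union>i<n. ?pre (B i))" using sub by blast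
      then have "measure M (sym_diff (?pre (\<Union>i. B i)) (\<Union>i<n. ?pre (B i))) = measure M (?pre (\<Union>i. B i)) - measure M (\<Union>i<n. ?pre (B i))"
        using finite_measure_Diff[OF PS US sub] by (simp only:)
      also have "\<dots> < e / 2" using n unfolding dist_real_def by linarith
      finally have "measure M (sym_diff (?pre (\<Union>i. B i)) (cells S I)) < e"
        using 1 measure_sym_diff_triangle[OF PS US[of n] cells_sets[of S I]] by linarith
      moreover have "I \<subseteq> {..<S}" unfolding I_def using J' by blast
      ultimately show "\<exists>R J. 0 < R \<and> J \<subseteq> {..<R} \<and> measure M (sym_diff (?pre (\<Union>i. B i)) (cells R J)) < e"
        using S by blast
    qed
  qed
qed

lemma approx_by_cells:
  assumes A: "A \<in> sets M" and e: "0 < e"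
  shows "\<exists>R J. 0 < R \<and> J \<subseteq> {..<R} \<and> measure M (sym_diff A (cells R J)) < e"
proof -
  obtain B where B: "B \<in> sets unit_interval" "AE x in M. x \<in> A \<longleftrightarrow> \<phi> x \<in> B" using coord_generates[OF A] by blast
  obtain R J where RJ: "0 < R" "J \<subseteq> {..<R}" "measure M (sym_diff (\<phi> -` B \<inter> space M) (cells R J)) < e"
    using approx_unit_interval[OF B(1)] e by blast
  have AE: "AE x in M. x \<in> sym_diff A (cells R J) \<longleftrightarrow> x \<in> sym_diff (\<phi> -` B \<inter> space M) (cells R J)"
    using B(2) AE_space by eventually_elim blast
  have "measure M (sym_diff A (cells R J)) = measure M (sym_diff (\<phi> -` B \<inter> space M) (cells R J))"
    using A cells_sets measurable_sets[OF coord B(1)] by (intro measure_eq_AE[OF AE] sets.Un sets.Diff)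
  then have "measure M (sym_diff A (cells R J)) < e" using RJ(3) by (simp only:)
  then show ?thesis using RJ(1,2) by blast
qed

section \<open>The topology in terms of cells\<close>

text \<open>
  A pseudometric on automorphisms for each rank. It is invariant under composition from the right
  (\<open>mismatch_comp_right\<close>), but for composition from the left only continuous in the sense of
  \<open>near_comp_left\<close>, where the rank changes.
\<close>
definition mismatch :: "nat \<Rightarrow> ('a \<Rightarrow> 'a) \<Rightarrow> ('a \<Rightarrow> 'a) \<Rightarrow> real" where
  "mismatch k s t = measure M {x \<in> space M. idx k (s x) \<noteq> idx k (t x)}"

lemma mismatch_sets:
  assumes "s \<in> measurable M M" "t \<in> measurable M M"
  shows "{x \<in> space M. idx k (s x) \<noteq> idx k (t x)} \<in> sets M"
proof -
  have m: "{x \<in> space M. idx k (r x) = i} \<in> sets M" if "r \<in> measurable M M" for r i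
    using measurable_sets[OF measurable_compose[OF that idx_measurable], of "{i}" k]
    by (simp add: vimage_def Int_def conj_commute)
  have "{x \<in> space M. idx k (s x) \<noteq> idx k (t x)} = (\<Union>i. {x \<in> space M. idx k (s x) = i} - {x \<in> space M. idx k (t x) = i})"
  proof (rule equalityI; rule subsetI)
    fix x assume "x \<in> {x \<in> space M. idx k (s x) \<noteq> idx k (t x)}"
    then show "x \<in> (\<Union>i. {x \<in> space M. idx k (s x) = i} - {x \<in> space M. idx k (t x) = i})"
      by auto
  next
    fix x assume "x \<in> (\<Union>i. {x \<in> space M. idx k (s x) = i} - {x \<in> space M. idx k (t x) = i})"
    then obtain i where "x \<in> {x \<in> space M. idx k (s x) = i} - {x \<in> space M. idx k (t x) = i}" by (rule UN_E)
    then show "x \<in> {x \<in> space M. idx k (s x) \<noteq> idx k (t x)}" by auto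
  qed
  also have "\<dots> \<in> sets M" using m assms by (intro sets.countable_UN) auto
  finally show ?thesis .
qed

lemma mismatch_sets_iso: "mp_iso M M s \<Longrightarrow> mp_iso M M t \<Longrightarrow> {x \<in> space M. idx k (s x) \<noteq> idx k (t x)} \<in> sets M"
  by (rule mismatch_sets[OF mp_iso_measurable mp_iso_measurable])

lemma mismatch_commute: "mismatch k s t = mismatch k t s"
  unfolding mismatch_def by (rule arg_cong[where f = "measure M"]) auto

lemma mismatch_self: "mismatch k s s = 0"
  by (simp add: mismatch_def)

lemma mismatch_triangle:
  assumes "mp_iso M M r" "mp_iso M M s" "mp_iso M M t"
  shows "mismatch k r t \<le> mismatch k r s + mismatch k s t"
proof -
  have "mismatch k r t \<le> measure M ({x \<in> space M. idx k (r x) \<noteq> idx k (s x)} \<union> {x \<in> space M. idx k (s x) \<noteq> idx k (t x)})"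
    unfolding mismatch_def using mismatch_sets_iso assms by (intro finite_measure_mono sets.Un) auto
  also have "\<dots> \<le> mismatch k r s + mismatch k s t"
    unfolding mismatch_def using mismatch_sets_iso assms by (intro measure_Un_le) auto
  finally show ?thesis .
qed

lemma mismatch_cong_AE:
  assumes "mp_iso M M s" "mp_iso M M t" "mp_iso M M s'" "mp_iso M M t'"
    and "AE x in M. s x = s' x" "AE x in M. t x = t' x"
  shows "mismatch k s t = mismatch k s' t'"
  unfolding mismatch_def
proof (rule measure_eq_AE)
  show "AE x in M. (x \<in> {x \<in> space M. idx k (s x) \<noteq> idx k (t x)}) = (x \<in> {x \<in> space M. idx k (s' x) \<noteq> idx k (t' x)})"
    using assms(5,6) by eventually_elim simp
qed (rule mismatch_sets_iso assms)+

lemma mismatch_cong: "(\<And>x. x \<in> space M \<Longrightarrow> s x = s' x) \<Longrightarrow> (\<And>x. x \<in> space M \<Longrightarrow> t x = t' x) \<Longrightarrow>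
    mismatch k s t = mismatch k s' t'"
  unfolding mismatch_def by (rule arg_cong[where f = "measure M"]) auto

lemma mismatch_comp_right:
  assumes r: "mp_iso M M r" and s: "mp_iso M M s" and t: "mp_iso M M t"
  shows "mismatch k (s \<circ> r) (t \<circ> r) = mismatch k s t"
proof -
  have "{x \<in> space M. idx k ((s \<circ> r) x) \<noteq> idx k ((t \<circ> r) x)} = pre M r {x \<in> space M. idx k (s x) \<noteq> idx k (t x)}"
    using mp_iso_space[OF r] by auto
  then show ?thesis unfolding mismatch_def using measure_pre[OF r mismatch_sets_iso[OF s t]] by (simp only:)
qed

lemma mismatch_mono:
  assumes "k dvd l" "0 < l" "mp_iso M M s" "mp_iso M M t"
  shows "mismatch k s t \<le> mismatch l s t"
proof -
  obtain K where K: "l = k * K" using assms(1) by blast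
  then have Kpos: "0 < K" using assms(2) by simp
  show ?thesis unfolding mismatch_def
  proof (rule finite_measure_mono[OF subsetI mismatch_sets_iso[OF assms(3,4)]])
    fix x assume x: "x \<in> {x \<in> space M. idx k (s x) \<noteq> idx k (t x)}"
    have "idx k (s x) = idx l (s x) div K" "idx k (t x) = idx l (t x) div K"
      using idx_div[OF Kpos, of "s x" k] idx_div[OF Kpos, of "t x" k] x
        mp_iso_space[OF assms(3), of x] mp_iso_space[OF assms(4), of x] by (simp_all add: K)
    then show "x \<in> {x \<in> space M. idx l (s x) \<noteq> idx l (t x)}" using x by auto
  qed
qed

text \<open>
  One number serves as rank and as accuracy, so the neighbourhoods \<open>near k\<close> are ordered by divisibility
  of \<open>k\<close> (\<open>near_dvd\<close>) and can be intersected by multiplying the ranks.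
\<close>
definition near :: "nat \<Rightarrow> ('a \<Rightarrow> 'a) \<Rightarrow> ('a \<Rightarrow> 'a) \<Rightarrow> bool" where
  "near k s t \<longleftrightarrow> mismatch k s t < 1 / real k"

lemma near_dvd:
  assumes "near l s t" "k dvd l" "0 < l" "mp_iso M M s" "mp_iso M M t"
  shows "near k s t"
proof -
  have "0 < k" using assms(2,3) by (metis dvd_0_left_iff gr0I less_not_refl)
  moreover have "k \<le> l" using assms by (intro dvd_imp_le)
  ultimately have "1 / real l \<le> 1 / real k" by (intro divide_left_mono) auto
  then show ?thesis using assms(1) mismatch_mono[OF assms(2-5)] by (simp add: near_def)
qed

text \<open>
  The mismatch grows with the rank, while the accuracy \<open>1 / l\<close> that \<open>near l\<close> demands becomes arbitrarily good.
\<close>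
lemma near_fine:
  assumes "0 < k" "0 < (e::real)"
  shows "\<exists>l. k dvd l \<and> 0 < l \<and> (\<forall>s t. mp_iso M M s \<longrightarrow> mp_iso M M t \<longrightarrow> near l s t \<longrightarrow> mismatch k s t < e)"
proof -
  obtain n0 :: nat where n0: "1 / e < real n0" using reals_Archimedean2 by blast
  define l where "l = k * Suc n0"
  have l: "k dvd l" "0 < l" using assms by (simp_all add: l_def)
  have "real n0 \<le> real l"
  proof -
    have "n0 \<le> k * Suc n0" using assms(1) by (cases k) auto
    then show ?thesis unfolding l_def by (simp only: of_nat_le_iff)
  qed
  then have "1 / e < real l" using n0 by linarith
  then have le: "1 / real l < e" using assms(2) l(2) by (simp add: field_simps)
  have "mismatch k s t < e" if "mp_iso M M s" "mp_iso M M t" "near l s t" for s t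
    using mismatch_mono[OF l that(1,2)] that(3) le by (simp add: near_def)
  then show ?thesis using l by blast
qed

text \<open>
  Replace \<open>A\<close> by a union of cells, at the cost of two thirds of \<open>e\<close>.
\<close>
lemma near_pre:
  assumes A: "A \<in> sets M" and e: "0 < e"
  shows "\<exists>l>0. \<forall>s t. mp_iso M M s \<longrightarrow> mp_iso M M t \<longrightarrow> near l s t \<longrightarrow> measure M (sym_diff (pre M s A) (pre M t A)) < e"
proof -
  obtain R J where RJ: "0 < R" "J \<subseteq> {..<R}" "measure M (sym_diff A (cells R J)) < e / 3"
    using approx_by_cells[OF A, of "e / 3"] e by auto
  obtain l where l: "0 < l" "\<And>s t. mp_iso M M s \<Longrightarrow> mp_iso M M t \<Longrightarrow> near l s t \<Longrightarrow> mismatch R s t < e / 3"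
    using near_fine[OF RJ(1), of "e / 3"] e by auto
  have "measure M (sym_diff (pre M s A) (pre M t A)) < e" if s: "mp_iso M M s" and t: "mp_iso M M t" and n: "near l s t" for s t
  proof -
    have p: "measure M (sym_diff (pre M r A) (pre M r (cells R J))) < e / 3" if "mp_iso M M r" for r
    proof -
      have "measure M (sym_diff (pre M r A) (pre M r (cells R J))) = measure M (sym_diff A (cells R J))"
        unfolding sym_diff_pre using A cells_sets by (intro measure_pre[OF that] sets.Un sets.Diff)
      then show ?thesis using RJ(3) by simp
    qed
    have "measure M (sym_diff (pre M s (cells R J)) (pre M t (cells R J))) \<le> mismatch R s t"
      unfolding mismatch_def
      by (rule finite_measure_mono[OF _ mismatch_sets_iso[OF s t]]) (auto simp: cells_def mp_iso_space[OF s] mp_iso_space[OF t])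
    then have q: "measure M (sym_diff (pre M s (cells R J)) (pre M t (cells R J))) < e / 3" using l(2)[OF s t n] by simp
    note S = pre_sets[OF s A] pre_sets[OF s cells_sets[of R J]] pre_sets[OF t A] pre_sets[OF t cells_sets[of R J]]
    have "measure M (sym_diff (pre M s A) (pre M t A)) \<le>
        measure M (sym_diff (pre M s A) (pre M s (cells R J))) + measure M (sym_diff (pre M s (cells R J)) (pre M t A))"
      by (rule measure_sym_diff_triangle[OF S(1,2,3)])
    also have "measure M (sym_diff (pre M s (cells R J)) (pre M t A)) \<le>
        measure M (sym_diff (pre M s (cells R J)) (pre M t (cells R J))) + measure M (sym_diff (pre M t (cells R J)) (pre M t A))"
      by (rule measure_sym_diff_triangle[OF S(2,4,3)])
    also have "sym_diff (pre M t (cells R J)) (pre M t A) = sym_diff (pre M t A) (pre M t (cells R J))" by blast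
    finally show ?thesis using p[OF s] p[OF t] q by simp
  qed
  then show ?thesis using l(1) by blast
qed

lemma near_combine:
  assumes "finite I" "\<And>i. i \<in> I \<Longrightarrow> \<exists>l>0. \<forall>s t. mp_iso M M s \<longrightarrow> mp_iso M M t \<longrightarrow> near l s t \<longrightarrow> P i s t"
  shows "\<exists>l>0. \<forall>s t. mp_iso M M s \<longrightarrow> mp_iso M M t \<longrightarrow> near l s t \<longrightarrow> (\<forall>i\<in>I. P i s t)"
  using assms
proof (induction I rule: finite_induct)
  case empty
  then show ?case by (intro exI[of _ 1]) simp
next
  case (insert i I)
  obtain l1 where l1: "0 < l1" "\<forall>s t. mp_iso M M s \<longrightarrow> mp_iso M M t \<longrightarrow> near l1 s t \<longrightarrow> (\<forall>i\<in>I. P i s t)"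
    using insert.IH insert.prems by blast
  obtain l2 where l2: "0 < l2" "\<forall>s t. mp_iso M M s \<longrightarrow> mp_iso M M t \<longrightarrow> near l2 s t \<longrightarrow> P i s t"
    using insert.prems by blast
  show ?case
  proof (intro exI[of _ "l1 * l2"] conjI allI impI)
    show "0 < l1 * l2" using l1(1) l2(1) by simp
    fix s t assume st: "mp_iso M M s" "mp_iso M M t" "near (l1 * l2) s t"
    have "near l1 s t" "near l2 s t" using near_dvd[OF st(3)] st l1(1) l2(1) by auto
    then show "\<forall>i\<in>insert i I. P i s t" using l1(2) l2(2) st by blast
  qed
qed

text \<open>
  The index \<open>k\<close> is included because the cell of rank \<open>k\<close> with this index is the fibre of the coordinate over \<open>1\<close>.
\<close>
lemma mismatch_le_sum:
  assumes s: "mp_iso M M s" and t: "mp_iso M M t"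
  shows "mismatch k s t \<le> (\<Sum>i\<le>k. measure M (sym_diff (pre M s (cells k {i})) (pre M t (cells k {i}))))"
proof -
  have cl: "idx k x \<le> k" if "x \<in> space M" for x
  proof -
    have "real k * \<phi> x \<le> real k * 1" using coord_bounds[OF that] by (intro mult_left_mono) auto
    then have "\<lfloor>real k * \<phi> x\<rfloor> \<le> int k" by linarith
    then show ?thesis by (simp add: idx_def cell_def)
  qed
  note S = pre_sets[OF s cells_sets] pre_sets[OF t cells_sets]
  have "mismatch k s t \<le> measure M (\<Union>i\<in>{..k}. sym_diff (pre M s (cells k {i})) (pre M t (cells k {i})))"
    unfolding mismatch_def
  proof (rule finite_measure_mono)
    show "{x \<in> space M. idx k (s x) \<noteq> idx k (t x)} \<subseteq> (\<Union>i\<in>{..k}. sym_diff (pre M s (cells k {i})) (pre M t (cells k {i})))"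
    proof
      fix x assume x: "x \<in> {x \<in> space M. idx k (s x) \<noteq> idx k (t x)}"
      then have sx: "s x \<in> space M" "x \<in> space M" using mp_iso_space[OF s] by auto
      have "x \<in> pre M s (cells k {idx k (s x)})" "x \<notin> pre M t (cells k {idx k (s x)})" using x sx by (auto simp: cells_def)
      then show "x \<in> (\<Union>i\<in>{..k}. sym_diff (pre M s (cells k {i})) (pre M t (cells k {i})))"
        using cl[OF sx(1)] by blast
    qed
  qed (use S in \<open>intro sets.finite_UN sets.Un sets.Diff, auto\<close>)
  also have "\<dots> \<le> (\<Sum>i\<le>k. measure M (sym_diff (pre M s (cells k {i})) (pre M t (cells k {i}))))"
    using S by (intro measure_UNION_le sets.Un sets.Diff) auto
  finally show ?thesis .
qed

text \<open>
  Composition with \<open>h\<close> replaces the cells by their preimages under \<open>h\<close>, a finite family of fixed sets to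
  which \<open>near_pre\<close> applies.
\<close>
lemma near_comp_left:
  assumes h: "mp_iso M M h" and e: "0 < e"
  shows "\<exists>l>0. \<forall>s t. mp_iso M M s \<longrightarrow> mp_iso M M t \<longrightarrow> near l s t \<longrightarrow> mismatch k (h \<circ> s) (h \<circ> t) < e"
proof -
  define d where "d = e / (real k + 2)"
  have d: "0 < d" using e by (simp add: d_def)
  have "\<exists>l>0. \<forall>s t. mp_iso M M s \<longrightarrow> mp_iso M M t \<longrightarrow> near l s t \<longrightarrow>
     measure M (sym_diff (pre M s (pre M h (cells k {i}))) (pre M t (pre M h (cells k {i})))) < d" for i
    by (rule near_pre[OF pre_sets[OF h cells_sets] d])
  then obtain l where l: "0 < l" "\<And>s t. mp_iso M M s \<Longrightarrow> mp_iso M M t \<Longrightarrow> near l s t \<Longrightarrow>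
     \<forall>i\<in>{..k}. measure M (sym_diff (pre M s (pre M h (cells k {i}))) (pre M t (pre M h (cells k {i})))) < d"
    using near_combine[of "{..k}" "\<lambda>i s t. measure M (sym_diff (pre M s (pre M h (cells k {i}))) (pre M t (pre M h (cells k {i})))) < d"]
    by auto
  have "mismatch k (h \<circ> s) (h \<circ> t) < e" if st: "mp_iso M M s" "mp_iso M M t" "near l s t" for s t
  proof -
    have pp: "pre M (h \<circ> r) B = pre M r (pre M h B)" if "mp_iso M M r" for r B
      using mp_iso_space[OF that] by auto
    have "mismatch k (h \<circ> s) (h \<circ> t) \<le> (\<Sum>i\<le>k. measure M (sym_diff (pre M (h \<circ> s) (cells k {i})) (pre M (h \<circ> t) (cells k {i}))))"
      by (rule mismatch_le_sum[OF mp_iso_comp[OF st(1) h] mp_iso_comp[OF st(2) h]])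
    also have "\<dots> \<le> (\<Sum>i\<le>k. d)"
      unfolding pp[OF st(1)] pp[OF st(2)] using l(2)[OF st] by (intro sum_mono) (auto simp: less_imp_le)
    also have "\<dots> = real (k + 1) * d" by simp
    also have "\<dots> < real (k + 2) * d" using d by (intro mult_strict_right_mono) auto
    also have "\<dots> = e"
    proof -
      have "real k + 2 \<noteq> 0" by linarith
      then show ?thesis by (simp add: d_def add.commute)
    qed
    finally show ?thesis .
  qed
  then show ?thesis using l(1) by blast
qed

text \<open>
  From left to right, a subbasic condition on \<open>t A\<close> is a condition on the preimages of \<open>B = t A\<close> by
  \<open>measure_sym_diff_images\<close>, and \<open>near_pre\<close> controls these. From right to left, the
  subbasic neighbourhoods for the sets \<open>t\<inverse> C\<close>, where \<open>C\<close> is a cell of rank \<open>k\<close>, control the mismatch.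
\<close>
lemma openin_aut_topology_iff:
  "openin (aut_topology M) V \<longleftrightarrow> V \<subseteq> carrier (Aut M) \<and>
    (\<forall>t. mp_iso M M t \<longrightarrow> aut_class M t \<in> V \<longrightarrow>
      (\<exists>k>0. \<forall>s. mp_iso M M s \<longrightarrow> near k s t \<longrightarrow> aut_class M s \<in> V))"
  (is "?L \<longleftrightarrow> ?R")
proof
  assume V: ?L
  have "V \<subseteq> carrier (Aut M)" using openin_subset[OF V] by (simp add: topspace_aut_topology)
  moreover have "\<forall>t. mp_iso M M t \<longrightarrow> aut_class M t \<in> V \<longrightarrow>
      (\<exists>k>0. \<forall>s. mp_iso M M s \<longrightarrow> near k s t \<longrightarrow> aut_class M s \<in> V)"
    using V unfolding aut_topology_def openin_topology_generated_by_iff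
  proof (induction V rule: generate_topology_on.induct)
    case Empty
    then show ?case by simp
  next
    case (Int a b)
    show ?case
    proof (intro allI impI)
      fix t assume t: "mp_iso M M t" "aut_class M t \<in> a \<inter> b"
      obtain k1 where k1: "0 < k1" "\<forall>s. mp_iso M M s \<longrightarrow> near k1 s t \<longrightarrow> aut_class M s \<in> a" using Int.IH(1) t by blast
      obtain k2 where k2: "0 < k2" "\<forall>s. mp_iso M M s \<longrightarrow> near k2 s t \<longrightarrow> aut_class M s \<in> b" using Int.IH(2) t by blast
      have "aut_class M s \<in> a \<inter> b" if s: "mp_iso M M s" "near (k1 * k2) s t" for s
      proof -
        have "near k1 s t" "near k2 s t" using near_dvd[OF s(2)] s t k1(1) k2(1) by auto
        then show ?thesis using k1(2) k2(2) s by blast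
      qed
      then show "\<exists>k>0. \<forall>s. mp_iso M M s \<longrightarrow> near k s t \<longrightarrow> aut_class M s \<in> a \<inter> b"
        using k1(1) k2(1) by (intro exI[of _ "k1 * k2"]) auto
    qed
  next
    case (UN K)
    show ?case
    proof (intro allI impI)
      fix t assume t: "mp_iso M M t" "aut_class M t \<in> \<Union>K"
      then obtain v where v: "v \<in> K" "aut_class M t \<in> v" by blast
      obtain k where "0 < k" "\<forall>s. mp_iso M M s \<longrightarrow> near k s t \<longrightarrow> aut_class M s \<in> v" using UN.IH[OF v(1)] t(1) v(2) by blast
      then show "\<exists>k>0. \<forall>s. mp_iso M M s \<longrightarrow> near k s t \<longrightarrow> aut_class M s \<in> \<Union>K" using v(1) by blast
    qed
  next
    case (Basis v)
    then obtain S A e where v: "v = S <#\<^bsub>Aut M\<^esub> aut_nbhd M A e" "S \<in> carrier (Aut M)" "A \<in> sets M" by blast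
    then obtain s0 where s0: "mp_iso M M s0" "S = aut_class M s0" by (auto simp: carrier_Aut)
    show ?case
    proof (intro allI impI)
      fix t assume t: "mp_iso M M t" "aut_class M t \<in> v"
      define d where "d = e - measure M (sym_diff (s0 ` A) (t ` A))"
      have d: "0 < d" using t aut_class_in_coset_iff[OF s0(1) t(1) v(3)] by (simp add: v s0 d_def)
      obtain k where k: "0 < k" "\<And>s t'. mp_iso M M s \<Longrightarrow> mp_iso M M t' \<Longrightarrow> near k s t' \<Longrightarrow>
          measure M (sym_diff (pre M s (t ` A)) (pre M t' (t ` A))) < d"
        using near_pre[OF image_sets[OF t(1) v(3)] d] by blast
      have "aut_class M s \<in> v" if s: "mp_iso M M s" "near k s t" for s
      proof -
        have "measure M (sym_diff (t ` A) (s ` A)) < d"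
          unfolding measure_sym_diff_images[OF s(1) t(1) v(3)] using k(2)[OF s(1) t(1) s(2)] .
        moreover have "measure M (sym_diff (s0 ` A) (s ` A)) \<le> measure M (sym_diff (s0 ` A) (t ` A)) + measure M (sym_diff (t ` A) (s ` A))"
          using image_sets[OF _ v(3)] s0 s t by (intro measure_sym_diff_triangle) auto
        ultimately have "measure M (sym_diff (s0 ` A) (s ` A)) < e" by (simp add: d_def)
        then show ?thesis unfolding v(1) s0(2) using aut_class_in_coset_iff[OF s0(1) s(1) v(3)] by simp
      qed
      then show "\<exists>k>0. \<forall>s. mp_iso M M s \<longrightarrow> near k s t \<longrightarrow> aut_class M s \<in> v" using k(1) by blast
    qed
  qed
  ultimately show ?R ..
next
  assume R: ?R
  show ?L
  proof (subst openin_subopen, intro ballI)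
    fix T assume T: "T \<in> V"
    then obtain t where t: "mp_iso M M t" "T = aut_class M t" using R by (auto simp: carrier_Aut)
    obtain k where k: "0 < k" "\<And>s. mp_iso M M s \<Longrightarrow> near k s t \<Longrightarrow> aut_class M s \<in> V" using R t T by blast
    define e where "e = 1 / (real k * (real k + 1))"
    have e: "0 < e" using k(1) by (simp add: e_def)
    define A where "A i = pre M t (cells k {i})" for i
    have A: "A i \<in> sets M" for i unfolding A_def using t(1) cells_sets by (rule pre_sets)
    have tA: "t ` A i = cells k {i}" for i unfolding A_def using t(1) cells_sets by (rule image_pre)
    define N where "N = (\<Inter>i\<in>{..k}. T <#\<^bsub>Aut M\<^esub> aut_nbhd M (A i) e)"
    have "openin (aut_topology M) N" unfolding N_def
    proof (intro openin_INT2)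
      fix i assume "i \<in> {..k}"
      have "T \<in> carrier (Aut M)" using t by (simp add: carrier_Aut)
      then show "openin (aut_topology M) (T <#\<^bsub>Aut M\<^esub> aut_nbhd M (A i) e)"
        unfolding aut_topology_def using A e by (intro topology_generated_by_Basis) blast
    qed auto
    moreover have "T \<in> N"
      unfolding N_def t(2) using aut_class_in_coset_iff[OF t(1) t(1) A] e by simp
    moreover have "N \<subseteq> V"
    proof
      fix S assume S: "S \<in> N"
      interpret G: group "Aut M" by (rule group_Aut)
      have "T \<in> carrier (Aut M)" using t by (simp add: carrier_Aut)
      moreover have "aut_nbhd M (A 0) e \<subseteq> carrier (Aut M)" by (auto simp: aut_nbhd_def)
      ultimately have "T <#\<^bsub>Aut M\<^esub> aut_nbhd M (A 0) e \<subseteq> carrier (Aut M)" by (intro G.l_coset_subset_G)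
      then have "S \<in> carrier (Aut M)" using S unfolding N_def by blast
      then obtain s where s: "mp_iso M M s" "S = aut_class M s" by (auto simp: carrier_Aut)
      have "measure M (sym_diff (pre M s (cells k {i})) (pre M t (cells k {i}))) < e" if "i \<le> k" for i
      proof -
        have "aut_class M s \<in> aut_class M t <#\<^bsub>Aut M\<^esub> aut_nbhd M (A i) e"
          using S that unfolding N_def s t by blast
        then have "measure M (sym_diff (t ` A i) (s ` A i)) < e"
          using aut_class_in_coset_iff[OF t(1) s(1) A] by blast
        then show ?thesis using measure_sym_diff_images[OF s(1) t(1) A, of i] by (simp only: tA)
      qed
      then have "(\<Sum>i\<le>k. measure M (sym_diff (pre M s (cells k {i})) (pre M t (cells k {i})))) < (\<Sum>i\<le>k. e)"
        by (intro sum_strict_mono) auto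
      also have "\<dots> = 1 / real k"
      proof -
        have "real k + 1 \<noteq> 0" by linarith
        then show ?thesis by (simp add: e_def add.commute)
      qed
      finally have "near k s t" unfolding near_def using mismatch_le_sum[OF s(1) t(1), of k] by linarith
      then show "S \<in> V" using k(2) s by simp
    qed
    ultimately show "\<exists>N. openin (aut_topology M) N \<and> T \<in> N \<and> N \<subseteq> V" by blast
  qed
qed

end

section \<open>Powers and whirliness of representatives\<close>

text \<open>
  The integer power of a representative; \<open>aut_class_int_pow\<close> relates it to the power in the group.
\<close>
definition zpow :: "'a measure \<Rightarrow> ('a \<Rightarrow> 'a) \<Rightarrow> int \<Rightarrow> 'a \<Rightarrow> 'a" where
  "zpow M t n = (if n < 0 then inv_into (space M) t ^^ nat (- n) else t ^^ nat n)"

lemma mp_iso_funpow: "mp_iso M M t \<Longrightarrow> mp_iso M M (t ^^ n)"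
proof (induction n)
  case 0
  then show ?case using mp_iso_id[of M] by (simp add: id_def)
next
  case (Suc n)
  then show ?case using mp_iso_comp[of M M "t ^^ n" M t] by (simp only: funpow.simps)
qed

lemma mp_iso_zpow: "mp_iso M M t \<Longrightarrow> mp_iso M M (zpow M t n)"
  by (simp add: zpow_def mp_iso_funpow mp_iso_inv)

lemma aut_class_nat_pow:
  assumes t: "mp_iso M M t"
  shows "aut_class M t [^]\<^bsub>Aut M\<^esub> (n::nat) = aut_class M (t ^^ n)"
proof (induction n)
  case 0
  then show ?case by (simp add: nat_pow_def one_Aut id_def)
next
  case (Suc n)
  interpret group "Aut M" by (rule group_Aut)
  have "aut_class M t [^]\<^bsub>Aut M\<^esub> Suc n = aut_class M t [^]\<^bsub>Aut M\<^esub> n \<otimes>\<^bsub>Aut M\<^esub> aut_class M t"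
    by (rule nat_pow_Suc)
  also have "\<dots> = aut_class M (t ^^ n \<circ> t)" unfolding Suc by (rule Aut_mult[OF mp_iso_funpow[OF t] t])
  finally show ?case by (simp only: funpow_Suc_right)
qed

lemma aut_class_inv:
  assumes t: "mp_iso M M t"
  shows "m_inv (Aut M) (aut_class M t) = aut_class M (inv_into (space M) t)"
proof -
  interpret group "Aut M" by (rule group_Aut)
  have "aut_class M (inv_into (space M) t) \<otimes>\<^bsub>Aut M\<^esub> aut_class M t = \<one>\<^bsub>Aut M\<^esub>"
  proof -
    have "AE x in M. (inv_into (space M) t \<circ> t) x = id x"
      using AE_space by eventually_elim (simp add: mp_iso_inv_into[OF t])
    then show ?thesis unfolding Aut_mult[OF mp_iso_inv[OF t] t] one_Aut by (rule aut_class_eqI)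
  qed
  then show ?thesis using t mp_iso_inv[OF t] by (intro inv_equality) (auto simp: carrier_Aut)
qed

lemma aut_class_int_pow:
  assumes t: "mp_iso M M t"
  shows "aut_class M t [^]\<^bsub>Aut M\<^esub> (n::int) = aut_class M (zpow M t n)"
proof -
  interpret group "Aut M" by (rule group_Aut)
  show ?thesis
  proof (cases "n < 0")
    case True
    have "aut_class M t [^]\<^bsub>Aut M\<^esub> n = m_inv (Aut M) (aut_class M t [^]\<^bsub>Aut M\<^esub> nat (- n))"
      unfolding int_pow_def2 using True by (rule if_P)
    also have "\<dots> = m_inv (Aut M) (aut_class M t) [^]\<^bsub>Aut M\<^esub> nat (- n)"
      by (rule nat_pow_inv[symmetric]) (simp add: carrier_Aut t)
    also have "\<dots> = aut_class M (zpow M t n)"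
      unfolding aut_class_inv[OF t] aut_class_nat_pow[OF mp_iso_inv[OF t]] using True by (simp only: zpow_def if_True)
    finally show ?thesis .
  next
    case False
    then have "aut_class M t [^]\<^bsub>Aut M\<^esub> n = aut_class M t [^]\<^bsub>Aut M\<^esub> nat n"
      unfolding int_pow_def2 by (rule if_not_P)
    then show ?thesis unfolding aut_class_nat_pow[OF t] using False by (simp add: zpow_def)
  qed
qed

context lebesgue_coordinate
begin

lemma near_self: "0 < k \<Longrightarrow> near k s s"
  by (simp add: near_def mismatch_self)

text \<open>
  Split \<open>s\<^sup>n s\<close> against \<open>t\<^sup>n t\<close> at \<open>t\<^sup>n s\<close>: right invariance reduces one part to the induction hypothesis,
  and the other part is \<open>near_comp_left\<close> for the fixed map \<open>t\<^sup>n\<close>.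
\<close>
lemma near_funpow:
  assumes t: "mp_iso M M t"
  shows "0 < e \<Longrightarrow> 0 < k \<Longrightarrow> \<exists>l>0. \<forall>s. mp_iso M M s \<longrightarrow> near l s t \<longrightarrow> mismatch k (s ^^ n) (t ^^ n) < e"
proof (induction n arbitrary: e)
  case 0
  then show ?case by (intro exI[of _ 1]) (simp add: mismatch_self)
next
  case (Suc n)
  have "0 < e / 2" using Suc.prems by simp
  then obtain l1 where l1: "0 < l1" "\<forall>s. mp_iso M M s \<longrightarrow> near l1 s t \<longrightarrow> mismatch k (s ^^ n) (t ^^ n) < e / 2"
    using Suc.IH Suc.prems(2) by blast
  obtain l2 where l2: "0 < l2" "\<forall>s t'. mp_iso M M s \<longrightarrow> mp_iso M M t' \<longrightarrow> near l2 s t' \<longrightarrow> mismatch k (t ^^ n \<circ> s) (t ^^ n \<circ> t') < e / 2"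
    using near_comp_left[OF mp_iso_funpow[OF t] \<open>0 < e / 2\<close>] by blast
  have main: "mismatch k (s ^^ Suc n) (t ^^ Suc n) < e" if s: "mp_iso M M s" "near (l1 * l2) s t" for s
  proof -
    have nn: "near l1 s t" "near l2 s t" using near_dvd[OF s(2)] s t l1(1) l2(1) by auto
    note iso = mp_iso_comp[OF s(1) mp_iso_funpow[OF s(1)]] mp_iso_comp[OF s(1) mp_iso_funpow[OF t]] mp_iso_comp[OF t mp_iso_funpow[OF t]]
    have "mismatch k (s ^^ n \<circ> s) (t ^^ n \<circ> t) \<le> mismatch k (s ^^ n \<circ> s) (t ^^ n \<circ> s) + mismatch k (t ^^ n \<circ> s) (t ^^ n \<circ> t)"
      by (rule mismatch_triangle[OF iso])
    moreover have "mismatch k (s ^^ n \<circ> s) (t ^^ n \<circ> s) = mismatch k (s ^^ n) (t ^^ n)"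
      by (rule mismatch_comp_right[OF s(1) mp_iso_funpow[OF s(1)] mp_iso_funpow[OF t]])
    moreover have "mismatch k (s ^^ n) (t ^^ n) < e / 2" using l1(2) s(1) nn by blast
    moreover have "mismatch k (t ^^ n \<circ> s) (t ^^ n \<circ> t) < e / 2" using l2(2) s(1) t nn by blast
    ultimately show ?thesis unfolding funpow_Suc_right by linarith
  qed
  show ?case
  proof (intro exI conjI allI impI)
    show "0 < l1 * l2" using l1(1) l2(1) by simp
  qed (rule main)
qed

text \<open>
  After composition with \<open>s\<close> from the right, \<open>s\<inverse>\<close> and \<open>t\<inverse>\<close> become \<open>t\<inverse> t\<close> and \<open>t\<inverse> s\<close>.
\<close>
lemma near_inv:
  assumes t: "mp_iso M M t" and e: "0 < e"
  shows "\<exists>l>0. \<forall>s. mp_iso M M s \<longrightarrow> near l s t \<longrightarrow> mismatch k (inv_into (space M) s) (inv_into (space M) t) < e"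
proof -
  let ?i = "inv_into (space M)"
  obtain l where l: "0 < l" "\<forall>s t'. mp_iso M M s \<longrightarrow> mp_iso M M t' \<longrightarrow> near l s t' \<longrightarrow> mismatch k (?i t \<circ> s) (?i t \<circ> t') < e"
    using near_comp_left[OF mp_iso_inv[OF t] e] by blast
  have "mismatch k (?i s) (?i t) < e" if s: "mp_iso M M s" "near l s t" for s
  proof -
    have "mismatch k (?i s) (?i t) = mismatch k (?i s \<circ> s) (?i t \<circ> s)"
      by (rule mismatch_comp_right[OF s(1) mp_iso_inv[OF s(1)] mp_iso_inv[OF t], symmetric])
    also have "\<dots> = mismatch k (?i t \<circ> t) (?i t \<circ> s)"
      by (rule mismatch_cong) (simp_all add: mp_iso_inv_into[OF s(1)] mp_iso_inv_into[OF t])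
    also have "\<dots> = mismatch k (?i t \<circ> s) (?i t \<circ> t)" by (rule mismatch_commute)
    also have "\<dots> < e" using l(2) s t by blast
    finally show ?thesis .
  qed
  then show ?thesis using l(1) by blast
qed

lemma near_zpow:
  assumes t: "mp_iso M M t" and e: "0 < e" and k: "0 < k"
  shows "\<exists>l>0. \<forall>s. mp_iso M M s \<longrightarrow> near l s t \<longrightarrow> mismatch k (zpow M s n) (zpow M t n) < e"
proof (cases "n < 0")
  case True
  let ?i = "inv_into (space M)"
  obtain l1 where l1: "0 < l1" "\<forall>s. mp_iso M M s \<longrightarrow> near l1 s (?i t) \<longrightarrow> mismatch k (s ^^ nat (- n)) (?i t ^^ nat (- n)) < e"
    using near_funpow[OF mp_iso_inv[OF t] e k] by blast
  have "0 < 1 / real l1" using l1(1) by simp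
  from near_inv[OF t this] obtain l where l: "0 < l" "\<forall>s. mp_iso M M s \<longrightarrow> near l s t \<longrightarrow> near l1 (?i s) (?i t)"
    unfolding near_def by blast
  have "mismatch k (zpow M s n) (zpow M t n) < e" if s: "mp_iso M M s" "near l s t" for s
    using l1(2) mp_iso_inv[OF s(1)] l(2) s True by (simp add: zpow_def)
  then show ?thesis using l(1) by blast
next
  case False
  then show ?thesis using near_funpow[OF t e k, of "nat n"] by (simp add: zpow_def)
qed

lemma near_zpow_near:
  assumes t: "mp_iso M M t" and k: "0 < k"
  shows "\<exists>l>0. \<forall>s. mp_iso M M s \<longrightarrow> near l s t \<longrightarrow> near k (zpow M s n) (zpow M t n)"
  unfolding near_def[of k] using k by (intro near_zpow[OF t]) auto

lemma measure_image_Int: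
  assumes t: "mp_iso M M t" and A: "A \<in> sets M" and B: "B \<in> sets M"
  shows "measure M (t ` A \<inter> B) = measure M (A \<inter> pre M t B)"
proof -
  have "pre M t (t ` A \<inter> B) = pre M t (t ` A) \<inter> pre M t B" by blast
  also have "\<dots> = A \<inter> pre M t B" by (simp only: pre_image[OF t A])
  finally have "pre M t (t ` A \<inter> B) = A \<inter> pre M t B" .
  then show ?thesis using measure_pre[OF t sets.Int[OF image_sets[OF t A] B]] by (simp only:)
qed

text \<open>
  Whirliness of the class of \<open>t\<close>, with the neighbourhoods of the identity given by cells.
\<close>
definition whirls :: "('a \<Rightarrow> 'a) \<Rightarrow> bool" where
  "whirls t \<longleftrightarrow> (\<forall>k>0. \<forall>A\<in>sets M. \<forall>B\<in>sets M. 0 < measure M A \<longrightarrow> 0 < measure M B \<longrightarrow>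
      (\<exists>n. near k (zpow M t n) id \<and> 0 < measure M (A \<inter> pre M (zpow M t n) B)))"

lemma whirly_iff_whirls:
  assumes t: "mp_iso M M t"
  shows "whirly M (aut_class M t) \<longleftrightarrow> whirls t"
proof
  assume w: "whirly M (aut_class M t)"
  show "whirls t" unfolding whirls_def
  proof (intro allI impI ballI)
    fix k :: nat and A B assume k: "0 < k" and AB: "A \<in> sets M" "B \<in> sets M" "0 < measure M A" "0 < measure M B"
    define U where "U = {aut_class M s | s. mp_iso M M s \<and> near k s id}"
    have mem: "near k s id" if sU: "mp_iso M M s" "aut_class M s \<in> U" for s
    proof -
      obtain s' where s': "mp_iso M M s'" "near k s' id" "aut_class M s = aut_class M s'" using sU(2) unfolding U_def by blast
      have "mismatch k s id = mismatch k s' id"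
        by (rule mismatch_cong_AE[OF sU(1) mp_iso_id s'(1) mp_iso_id aut_class_eq_iff[OF sU(1) s'(3)]]) simp
      then show ?thesis using s'(2) by (simp add: near_def)
    qed
    have "openin (aut_topology M) U" unfolding openin_aut_topology_iff
    proof (intro conjI allI impI)
      show "U \<subseteq> carrier (Aut M)" by (auto simp: U_def carrier_Aut)
      fix r assume r: "mp_iso M M r" "aut_class M r \<in> U"
      define e where "e = 1 / real k - mismatch k r id"
      have e: "0 < e" using mem[OF r] by (simp add: near_def e_def)
      obtain l where l: "0 < l" "\<forall>s t. mp_iso M M s \<longrightarrow> mp_iso M M t \<longrightarrow> near l s t \<longrightarrow> mismatch k s t < e"
        using near_fine[OF k e] by (elim exE conjE) (rule that)
      have "aut_class M s \<in> U" if s: "mp_iso M M s" "near l s r" for s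
      proof -
        have "mismatch k s id \<le> mismatch k s r + mismatch k r id" by (rule mismatch_triangle[OF s(1) r(1) mp_iso_id])
        also have "mismatch k s r < e" using l(2) s r(1) by blast
        also have "e + mismatch k r id = 1 / real k" by (simp add: e_def)
        finally have "near k s id" by (simp add: near_def)
        then show ?thesis using s(1) unfolding U_def by blast
      qed
      then show "\<exists>l>0. \<forall>s. mp_iso M M s \<longrightarrow> near l s r \<longrightarrow> aut_class M s \<in> U" using l(1) by blast
    qed
    moreover have "\<one>\<^bsub>Aut M\<^esub> \<in> U" unfolding one_Aut U_def using mp_iso_id near_self[OF k] by blast
    moreover have "U \<subseteq> carrier (Aut M)" by (auto simp: U_def carrier_Aut)
    ultimately have nbhd: "identity_nbhd M U" unfolding identity_nbhd_def by blast
    then obtain n :: int where n: "aut_class M t [^]\<^bsub>Aut M\<^esub> n \<in> U"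
       "\<forall>r \<in> aut_class M t [^]\<^bsub>Aut M\<^esub> n. 0 < measure M (r ` A \<inter> B)"
      using w[unfolded whirly_def, THEN conjunct2, rule_format, OF nbhd AB] by blast
    note z = mp_iso_zpow[OF t, of n]
    have "near k (zpow M t n) id" using n(1) unfolding aut_class_int_pow[OF t] by (rule mem[OF z])
    moreover have "0 < measure M (zpow M t n ` A \<inter> B)"
      using n(2) aut_class_self[OF z] unfolding aut_class_int_pow[OF t] by (rule bspec)
    ultimately show "\<exists>n. near k (zpow M t n) id \<and> 0 < measure M (A \<inter> pre M (zpow M t n) B)"
      unfolding measure_image_Int[OF z AB(1,2)] by blast
  qed
next
  assume w: "whirls t"
  show "whirly M (aut_class M t)" unfolding whirly_def
  proof (intro conjI allI impI)
    show "aut_class M t \<in> carrier (Aut M)" using t by (simp add: carrier_Aut)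
    fix U A B assume U: "identity_nbhd M U" and AB: "A \<in> sets M" "B \<in> sets M" "0 < measure M A" "0 < measure M B"
    obtain V where V: "openin (aut_topology M) V" "aut_class M id \<in> V" "V \<subseteq> U"
      using U unfolding identity_nbhd_def one_Aut by blast
    obtain k where k: "0 < k" "\<forall>s. mp_iso M M s \<longrightarrow> near k s id \<longrightarrow> aut_class M s \<in> V"
      using V(1,2) mp_iso_id unfolding openin_aut_topology_iff by blast
    obtain n where n: "near k (zpow M t n) id" "0 < measure M (A \<inter> pre M (zpow M t n) B)"
      using w[unfolded whirls_def, rule_format, OF k(1) AB] by blast
    note z = mp_iso_zpow[OF t, of n]
    have "aut_class M (zpow M t n) \<in> U" using k(2) z n(1) V(3) by blast
    moreover have "0 < measure M (r ` A \<inter> B)" if r: "r \<in> aut_class M (zpow M t n)" for r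
    proof -
      have r': "mp_iso M M r" "AE x in M. r x = zpow M t n x" using r unfolding aut_class_def by blast+
      show ?thesis using n(2) measure_image_cong_AE(2)[OF r'(1) z r'(2) AB(1,2)] measure_image_Int[OF z AB(1,2)] by simp
    qed
    ultimately show "\<exists>n::int. aut_class M t [^]\<^bsub>Aut M\<^esub> n \<in> U \<and>
        (\<forall>r \<in> aut_class M t [^]\<^bsub>Aut M\<^esub> n. 0 < measure M (r ` A \<inter> B))"
      unfolding aut_class_int_pow[OF t] by blast
  qed
qed

section \<open>Whirliness as a countable family of open conditions\<close>

text \<open>
  For each \<open>r\<close> in \<open>I\<close>, a power of \<open>t\<close> moves a part of the piece \<open>D r\<close> of cell \<open>i\<close> into the piece \<open>E r\<close>
  of cell \<open>j\<close>. The pieces are independent of how \<open>t\<close> acts on them, rather than images of each other, so that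
  the total mass that is moved depends continuously on \<open>t\<close> while the pieces remain the same.
\<close>
definition carrying :: "nat \<Rightarrow> nat \<Rightarrow> nat \<Rightarrow> ('a \<Rightarrow> 'a) \<Rightarrow> nat set \<Rightarrow> (nat \<Rightarrow> int) \<Rightarrow> (nat \<Rightarrow> 'a set) \<Rightarrow> (nat \<Rightarrow> 'a set) \<Rightarrow> bool" where
  "carrying k i j t I n D E \<longleftrightarrow> finite I \<and> disjoint_family_on D I \<and> disjoint_family_on E I \<and>
     (\<forall>r\<in>I. D r \<in> sets M \<and> E r \<in> sets M \<and> D r \<subseteq> cells k {i} \<and> E r \<subseteq> cells k {j} \<and> near k (zpow M t (n r)) id) \<and>
     3 / (4 * real k) < (\<Sum>r\<in>I. measure M (D r \<inter> pre M (zpow M t (n r)) (E r)))"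

definition carries :: "nat \<Rightarrow> nat \<Rightarrow> nat \<Rightarrow> ('a \<Rightarrow> 'a) \<Rightarrow> bool" where
  "carries k i j t \<longleftrightarrow> (\<exists>I n D E. carrying k i j t I n D E)"

lemma carryingD:
  assumes "carrying k i j t I n D E"
  shows "finite I" "disjoint_family_on D I" "disjoint_family_on E I"
    "\<And>r. r \<in> I \<Longrightarrow> D r \<in> sets M \<and> E r \<in> sets M \<and> D r \<subseteq> cells k {i} \<and> E r \<subseteq> cells k {j} \<and> near k (zpow M t (n r)) id"
    "3 / (4 * real k) < (\<Sum>r\<in>I. measure M (D r \<inter> pre M (zpow M t (n r)) (E r)))"
  using assms unfolding carrying_def by blast+

definition transports :: "nat \<Rightarrow> ('a \<Rightarrow> 'a) \<Rightarrow> bool" where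
  "transports k t \<longleftrightarrow> (\<forall>i<k. \<forall>j<k. carries k i j t)"

lemma measure_cells_single: "0 < k \<Longrightarrow> i < k \<Longrightarrow> measure M (cells k {i}) = 1 / real k"
  using measure_cells_card[of k "{i}"] by simp

text \<open>
  If every cell in a good approximation of \<open>A\<close> missed a quarter of its points, the approximation would
  differ from \<open>A\<close> by a quarter of its measure. The conclusion for all multiples of \<open>R\<close> allows to treat
  two sets at a common rank.
\<close>
lemma ex_mostly_filled_cell:
  assumes A: "A \<in> sets M" "0 < measure M A"
  shows "\<exists>R>0. \<forall>k. 0 < k \<longrightarrow> R dvd k \<longrightarrow> (\<exists>i<k. measure M (cells k {i} - A) \<le> 1 / (4 * real k))"
proof -
  (* An eighth suffices: a quarter of the approximating cells has measure at least 7 / 32 of that of A. *)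
  have "0 < measure M A / 8" using A(2) by simp
  then obtain R J where RJ: "0 < R" "J \<subseteq> {..<R}" "measure M (sym_diff A (cells R J)) < measure M A / 8"
    using approx_by_cells[OF A(1)] by blast
  have "\<exists>i<k. measure M (cells k {i} - A) \<le> 1 / (4 * real k)" if k: "0 < k" "R dvd k" for k
  proof (rule ccontr)
    assume neg: "\<not> (\<exists>i<k. measure M (cells k {i} - A) \<le> 1 / (4 * real k))"
    obtain J' where J': "J' \<subseteq> {..<k}" "cells k J' = cells R J" using cells_refine[OF k(2,1) RJ(2)] by blast
    have fin: "finite J'" using J'(1) by (rule finite_subset) simp
    have CS: "cells k J' \<in> sets M" by (rule cells_sets)
    have sd: "sym_diff A (cells k J') \<in> sets M" using A(1) CS by (intro sets.Un sets.Diff)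
    have small: "measure M (sym_diff A (cells k J')) < measure M A / 8" using RJ(3) by (simp only: J'(2))
    have "cells k J' - A = (\<Union>i\<in>J'. cells k {i} - A)" by (auto simp: cells_def)
    then have "measure M (cells k J' - A) = measure M (\<Union>i\<in>J'. cells k {i} - A)" by (simp only:)
    also have "\<dots> = (\<Sum>i\<in>J'. measure M (cells k {i} - A))"
    proof (rule finite_measure_finite_Union[OF fin])
      show "(\<lambda>i. cells k {i} - A) ` J' \<subseteq> sets M" using A(1) cells_sets by blast
      show "disjoint_family_on (\<lambda>i. cells k {i} - A) J'" by (auto simp: disjoint_family_on_def cells_def)
    qed
    also have "\<dots> \<ge> (\<Sum>i\<in>J'. 1 / (4 * real k))"
    proof (rule sum_mono)
      fix i assume "i \<in> J'"
      then have "i < k" using J'(1) by blast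
      then show "1 / (4 * real k) \<le> measure M (cells k {i} - A)" using neg by (meson linear)
    qed
    finally have "real (card J') / (4 * real k) \<le> measure M (cells k J' - A)" by simp
    moreover have "measure M (cells k J') = real (card J') / real k" by (rule measure_cells_card[OF k(1) J'(1)])
    moreover have "real (card J') / (4 * real k) = (real (card J') / real k) / 4" by simp
    ultimately have 1: "measure M (cells k J') / 4 \<le> measure M (cells k J' - A)" by argo
    have 2: "measure M (cells k J' - A) \<le> measure M (sym_diff A (cells k J'))"
      by (rule finite_measure_mono[OF _ sd]) blast
    have "measure M A \<le> measure M (cells k J' \<union> sym_diff A (cells k J'))"
      by (rule finite_measure_mono[OF _ sets.Un[OF CS sd]]) blast
    also have "\<dots> \<le> measure M (cells k J') + measure M (sym_diff A (cells k J'))"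
      by (rule measure_Un_le[OF CS sd])
    finally show False using 1 2 small A(2) by linarith
  qed
  then show ?thesis using RJ(1) by blast
qed

text \<open>
  If no power moved a part of \<open>A\<close> into \<open>B\<close>, all the mass that is moved would start outside of \<open>A\<close> or end
  outside of \<open>B\<close>. But there is at most \<open>1 / (4 * k)\<close> of each kind, less than \<open>3 / (4 * k)\<close> together.
\<close>
lemma carries_meets:
  assumes t: "mp_iso M M t" and c: "carries k i j t" and k: "0 < k"
    and A: "A \<in> sets M" "measure M (cells k {i} - A) \<le> 1 / (4 * real k)"
    and B: "B \<in> sets M" "measure M (cells k {j} - B) \<le> 1 / (4 * real k)"
  shows "\<exists>n. near k (zpow M t n) id \<and> 0 < measure M (A \<inter> pre M (zpow M t n) B)"
proof (rule ccontr)
  assume neg: "\<not> ?thesis"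
  obtain I n D E where car: "carrying k i j t I n D E" using c unfolding carries_def by (elim exE) (rule that)
  note I = carryingD(1-3)[OF car] and DE = carryingD(4)[OF car] and big = carryingD(5)[OF car]
  have disj: "(\<Sum>r\<in>I. measure M (F r - A)) \<le> measure M (cells k {i} - A)"
    if F: "disjoint_family_on F I" "\<And>r. r \<in> I \<Longrightarrow> F r \<in> sets M \<and> F r \<subseteq> cells k {i}" and AS: "A \<in> sets M" for F A i
  proof -
    have "(\<Sum>r\<in>I. measure M (F r - A)) = measure M (\<Union>r\<in>I. F r - A)"
    proof (rule finite_measure_finite_Union[OF I(1), symmetric])
      show "(\<lambda>r. F r - A) ` I \<subseteq> sets M" using F(2) AS by blast
      show "disjoint_family_on (\<lambda>r. F r - A) I" using F(1) unfolding disjoint_family_on_def by blast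
    qed
    also have "\<dots> \<le> measure M (cells k {i} - A)"
    proof (rule finite_measure_mono)
      show "(\<Union>r\<in>I. F r - A) \<subseteq> cells k {i} - A" using F(2) by blast
      show "cells k {i} - A \<in> sets M" using cells_sets AS by (rule sets.Diff)
    qed
    finally show ?thesis .
  qed
  have each: "measure M (D r \<inter> pre M (zpow M t (n r)) (E r)) \<le> measure M (D r - A) + measure M (E r - B)"
    if r: "r \<in> I" for r
  proof -
    let ?f = "zpow M t (n r)"
    note z = mp_iso_zpow[OF t, of "n r"]
    have DS: "D r \<in> sets M" "E r \<in> sets M" and nr: "near k ?f id" using DE[OF r] by blast+
    have S: "A \<inter> pre M ?f B \<in> sets M" "D r - A \<in> sets M" "pre M ?f (E r - B) \<in> sets M"
      using sets.Int[OF A(1) pre_sets[OF z B(1)]] sets.Diff[OF DS(1) A(1)] pre_sets[OF z sets.Diff[OF DS(2) B(1)]] .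
    have zero: "measure M (A \<inter> pre M ?f B) = 0"
      using neg nr measure_nonneg[of M "A \<inter> pre M ?f B"] by (metis less_eq_real_def)
    have "measure M (D r \<inter> pre M ?f (E r)) \<le> measure M ((A \<inter> pre M ?f B) \<union> ((D r - A) \<union> pre M ?f (E r - B)))"
      using S by (intro finite_measure_mono sets.Un) blast
    also have "\<dots> \<le> measure M (A \<inter> pre M ?f B) + measure M ((D r - A) \<union> pre M ?f (E r - B))"
      using S by (intro measure_Un_le sets.Un)
    also have "measure M ((D r - A) \<union> pre M ?f (E r - B)) \<le> measure M (D r - A) + measure M (pre M ?f (E r - B))"
      using S by (intro measure_Un_le)
    also have "measure M (pre M ?f (E r - B)) = measure M (E r - B)" using z sets.Diff[OF DS(2) B(1)] by (rule measure_pre)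
    finally show ?thesis using zero by simp
  qed
  have "(\<Sum>r\<in>I. measure M (D r \<inter> pre M (zpow M t (n r)) (E r))) \<le> (\<Sum>r\<in>I. measure M (D r - A) + measure M (E r - B))"
    using each by (rule sum_mono)
  also have "\<dots> = (\<Sum>r\<in>I. measure M (D r - A)) + (\<Sum>r\<in>I. measure M (E r - B))" by (rule sum.distrib)
  also have "\<dots> \<le> measure M (cells k {i} - A) + measure M (cells k {j} - B)"
    using DE by (intro add_mono disj[OF I(2) _ A(1)] disj[OF I(3) _ B(1)]) blast+
  also have "\<dots> \<le> 1 / (4 * real k) + 1 / (4 * real k)" using A(2) B(2) by (rule add_mono)
  also have "\<dots> \<le> 3 / (4 * real k)" using k by (simp add: field_simps)
  finally show False using big by simp
qed

lemma whirls_if_transports: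
  assumes t: "mp_iso M M t" and tr: "\<And>k. 0 < k \<Longrightarrow> transports k t"
  shows "whirls t"
  unfolding whirls_def
proof (intro allI impI ballI)
  fix k0 :: nat and A B assume k0: "0 < k0" and AB: "A \<in> sets M" "B \<in> sets M" "0 < measure M A" "0 < measure M B"
  obtain R1 where R1: "0 < R1" "\<forall>k. 0 < k \<longrightarrow> R1 dvd k \<longrightarrow> (\<exists>i<k. measure M (cells k {i} - A) \<le> 1 / (4 * real k))"
    using ex_mostly_filled_cell[OF AB(1,3)] by (elim exE conjE) (rule that)
  obtain R2 where R2: "0 < R2" "\<forall>k. 0 < k \<longrightarrow> R2 dvd k \<longrightarrow> (\<exists>i<k. measure M (cells k {i} - B) \<le> 1 / (4 * real k))"
    using ex_mostly_filled_cell[OF AB(2,4)] by (elim exE conjE) (rule that)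
  define k where "k = k0 * R1 * R2"
  have k: "0 < k" "k0 dvd k" "R1 dvd k" "R2 dvd k" using k0 R1(1) R2(1) by (simp_all add: k_def)
  obtain i where i: "i < k" "measure M (cells k {i} - A) \<le> 1 / (4 * real k)" using R1(2) k(1,3) by blast
  obtain j where j: "j < k" "measure M (cells k {j} - B) \<le> 1 / (4 * real k)" using R2(2) k(1,4) by blast
  have "carries k i j t" using tr[OF k(1)] i(1) j(1) unfolding transports_def by blast
  from carries_meets[OF t this k(1) AB(1) i(2) AB(2) j(2)]
  obtain n where n: "near k (zpow M t n) id" "0 < measure M (A \<inter> pre M (zpow M t n) B)" by blast
  have "near k0 (zpow M t n) id" by (rule near_dvd[OF n(1) k(2,1) mp_iso_zpow[OF t] mp_iso_id])
  then show "\<exists>n. near k0 (zpow M t n) id \<and> 0 < measure M (A \<inter> pre M (zpow M t n) B)" using n(2) by blast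
qed

text \<open>
  Go through all integers \<open>n\<close> for which the \<open>n\<close>-th power is near the identity, and each time move everything that
  this power takes from the rest of cell \<open>i\<close> to the rest of cell \<open>j\<close>. Both rests have the same measure
  at all times. If it did not tend to zero, whirliness would provide an \<open>n\<close> that still moves
  a part of the final rest, but that part was removed when it was the turn of this \<open>n\<close>.
\<close>
lemma carries_if_whirls:
  assumes t: "mp_iso M M t" and w: "whirls t" and k: "0 < k" and i: "i < k" and j: "j < k"
  shows "carries k i j t"
proof -
  define f where "f s = zpow M t (int_decode s)" for s
  define good where "good s \<longleftrightarrow> near k (f s) id" for s
  (* A and B are what is left of the cells i and j before step s. *)
  define step where "step s AB = (if good s then (fst AB - pre M (f s) (snd AB), snd AB - f s ` fst AB) else AB)" for s and AB :: "'a set \<times> 'a set"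
  define AB where "AB = rec_nat (cells k {i}, cells k {j}) step"
  define A where "A s = fst (AB s)" for s
  define B where "B s = snd (AB s)" for s
  have A0: "A 0 = cells k {i}" "B 0 = cells k {j}" by (simp_all add: A_def B_def AB_def)
  have Sgood: "A (Suc s) = A s - pre M (f s) (B s)" "B (Suc s) = B s - f s ` A s" if "good s" for s
    using that by (simp_all add: A_def B_def AB_def step_def)
  have Sbad: "A (Suc s) = A s" "B (Suc s) = B s" if "\<not> good s" for s
    using that by (simp_all add: A_def B_def AB_def step_def)
  have fi: "mp_iso M M (f s)" for s unfolding f_def using t by (rule mp_iso_zpow)
  have ABS: "A s \<in> sets M \<and> B s \<in> sets M" for s
  proof (induction s)
    case 0
    then show ?case by (simp add: A0 cells_sets)
  next
    case (Suc s)
    then show ?case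
      using Sgood[of s] Sbad[of s] pre_sets[OF fi, of "B s" s] image_sets[OF fi, of "A s" s] by (cases "good s") (simp_all add: sets.Diff)
  qed
  have AS: "A s \<in> sets M" and BS: "B s \<in> sets M" for s using ABS by blast+
  have decr: "A (Suc s) \<subseteq> A s" "B (Suc s) \<subseteq> B s" for s
    using Sgood[of s] Sbad[of s] by (cases "good s"; simp)+
  have dA: "decseq A" and dB: "decseq B" using decr by (simp_all add: decseq_Suc_iff)
  define D where "D s = A s - A (Suc s)" for s
  define E where "E s = B s - B (Suc s)" for s
  have DEgood: "D s = A s \<inter> pre M (f s) (B s)" "E s = f s ` A s \<inter> B s" if "good s" for s
    using Sgood[OF that] by (auto simp: D_def E_def)
  have DEbad: "D s = {}" "E s = {}" if "\<not> good s" for s using Sbad[OF that] by (simp_all add: D_def E_def)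
  have DS: "D s \<in> sets M" and ES: "E s \<in> sets M" for s
    unfolding D_def E_def by (rule sets.Diff[OF AS AS], rule sets.Diff[OF BS BS])
  have mDE: "measure M (D s) = measure M (E s)" for s
  proof (cases "good s")
    case True
    show ?thesis unfolding DEgood[OF True] using measure_image_Int[OF fi AS BS] by (rule sym)
  qed (simp add: DEbad)
  have mA: "measure M (A (Suc s)) = measure M (A s) - measure M (D s)" for s
    using finite_measure_Diff[OF AS AS decr(1), of s] by (simp add: D_def)
  have mB: "measure M (B (Suc s)) = measure M (B s) - measure M (E s)" for s
    using finite_measure_Diff[OF BS BS decr(2), of s] by (simp add: E_def)
  have mAB: "measure M (A s) = measure M (B s)" for s
  proof (induction s)
    case 0
    then show ?case unfolding A0 using measure_cells_single[OF k] i j by simp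
  next
    case (Suc s)
    then show ?case by (simp add: mA mB mDE)
  qed
  have msum: "(\<Sum>s<r. measure M (D s)) = 1 / real k - measure M (A r)" for r
  proof (induction r)
    case 0
    then show ?case unfolding A0 using measure_cells_single[OF k i] by simp
  next
    case (Suc r)
    then show ?case by (simp add: mA)
  qed
  have "\<exists>r. measure M (A r) < 1 / (4 * real k)"
  proof (rule ccontr)
    assume "\<not> ?thesis"
    then have ge: "1 / (4 * real k) \<le> measure M (A r)" for r by (meson not_le)
    have pos: "0 < 1 / (4 * real k)" using k by simp
    define A' where "A' = (\<Inter>r. A r)"
    define B' where "B' = (\<Inter>r. B r)"
    have S': "A' \<in> sets M" "B' \<in> sets M" unfolding A'_def B'_def using AS BS by (intro sets.countable_INT; blast)+
    have "(\<lambda>r. measure M (A r)) \<longlonglongrightarrow> measure M A'" unfolding A'_def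
      using AS dA by (intro finite_Lim_measure_decseq) auto
    then have 1: "1 / (4 * real k) \<le> measure M A'" using ge by (intro LIMSEQ_le_const) auto
    have "(\<lambda>r. measure M (B r)) \<longlonglongrightarrow> measure M B'" unfolding B'_def
      using BS dB by (intro finite_Lim_measure_decseq) auto
    then have 2: "1 / (4 * real k) \<le> measure M B'" using ge by (intro LIMSEQ_le_const) (auto simp: mAB)
    have "0 < measure M A'" "0 < measure M B'" using pos 1 2 by linarith+
    then obtain n where n: "near k (zpow M t n) id" "0 < measure M (A' \<inter> pre M (zpow M t n) B')"
      using w[unfolded whirls_def, rule_format, OF k S'] by blast
    define s where "s = int_encode n"
    have fs: "f s = zpow M t n" by (simp add: f_def s_def)
    then have "good s" using n(1) by (simp add: good_def)
    have "A' \<inter> pre M (f s) B' \<subseteq> A (Suc s) \<inter> (A s \<inter> pre M (f s) (B s))"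
      unfolding A'_def B'_def by blast
    also have "\<dots> = {}" unfolding Sgood(1)[OF \<open>good s\<close>] by blast
    finally have e: "A' \<inter> pre M (f s) B' = {}" by (simp only: subset_empty)
    then show False using n(2) unfolding fs[symmetric] e by simp
  qed
  then obtain r where r: "measure M (A r) < 1 / (4 * real k)" ..
  define I where "I = {s \<in> {..<r}. good s}"
  have sub: "D s \<subseteq> cells k {i}" "E s \<subseteq> cells k {j}" for s
  proof -
    have "A s \<subseteq> A 0" "B s \<subseteq> B 0" using dA dB unfolding decseq_def by blast+
    then show "D s \<subseteq> cells k {i}" "E s \<subseteq> cells k {j}" unfolding D_def E_def A0 by blast+
  qed
  have disjA: "D s \<inter> D s' = {}" "E s \<inter> E s' = {}" if "s < s'" for s s'
  proof -
    have "A s' \<subseteq> A (Suc s)" "B s' \<subseteq> B (Suc s)" using that dA dB unfolding decseq_def by (meson Suc_leI)+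
    then show "D s \<inter> D s' = {}" "E s \<inter> E s' = {}" unfolding D_def E_def by blast+
  qed
  have disj: "disjoint_family_on D I" "disjoint_family_on E I"
    unfolding disjoint_family_on_def using disjA by (metis Int_commute nat_neq_iff)+
  have "(\<Sum>s\<in>I. measure M (D s \<inter> pre M (f s) (E s))) = (\<Sum>s\<in>I. measure M (D s))"
  proof (rule sum.cong[OF refl])
    fix s assume "s \<in> I"
    then have g: "good s" by (simp add: I_def)
    have "D s \<inter> pre M (f s) (E s) = D s" unfolding DEgood[OF g] by blast
    then show "measure M (D s \<inter> pre M (f s) (E s)) = measure M (D s)" by (simp only:)
  qed
  also have "\<dots> = (\<Sum>s<r. measure M (D s))"
    by (rule sum.mono_neutral_left) (auto simp: I_def DEbad)
  also have "\<dots> > 3 / (4 * real k)"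
  proof -
    have "1 / real k = 4 / (4 * real k)" by simp
    then have "1 / real k - 1 / (4 * real k) = 3 / (4 * real k)" by (simp add: diff_divide_distrib[symmetric])
    then show ?thesis unfolding msum using r by linarith
  qed
  finally have "3 / (4 * real k) < (\<Sum>s\<in>I. measure M (D s \<inter> pre M (zpow M t (int_decode s)) (E s)))" by (simp only: f_def)
  moreover have "\<forall>s\<in>I. D s \<in> sets M \<and> E s \<in> sets M \<and> D s \<subseteq> cells k {i} \<and> E s \<subseteq> cells k {j} \<and> near k (zpow M t (int_decode s)) id"
    using DS ES sub by (auto simp: I_def good_def f_def)
  moreover have "finite I" by (simp add: I_def)
  ultimately have "carrying k i j t I int_decode D E" unfolding carrying_def using disj by blast
  then show ?thesis unfolding carries_def by (intro exI)
qed

text \<open>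
  The same powers and pieces work for all \<open>s\<close> near \<open>t\<close>. The surplus of the total mass over
  \<open>3 / (4 * k)\<close> is distributed over the finitely many pieces.
\<close>
lemma carries_open:
  assumes t: "mp_iso M M t" and c: "carries k i j t" and k: "0 < k"
  shows "\<exists>l>0. \<forall>s. mp_iso M M s \<longrightarrow> near l s t \<longrightarrow> carries k i j s"
proof -
  obtain I n D E where car: "carrying k i j t I n D E" using c unfolding carries_def by (elim exE) (rule that)
  note I = carryingD(1-3)[OF car] and DE = carryingD(4)[OF car] and big = carryingD(5)[OF car]
  define \<Sigma> where "\<Sigma> s = (\<Sum>r\<in>I. measure M (D r \<inter> pre M (zpow M s (n r)) (E r)))" for s
  define \<eta> where "\<eta> = (\<Sigma> t - 3 / (4 * real k)) / (real (card I) + 1)"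
  have \<eta>: "0 < \<eta>" using big unfolding \<eta>_def \<Sigma>_def by (intro divide_pos_pos) linarith+
  have one: "\<exists>l>0. \<forall>s t'. mp_iso M M s \<longrightarrow> mp_iso M M t' \<longrightarrow> near l s t' \<longrightarrow> (t' = t \<longrightarrow>
      near k (zpow M s (n r)) id \<and>
      measure M (D r \<inter> pre M (zpow M t (n r)) (E r)) \<le> measure M (D r \<inter> pre M (zpow M s (n r)) (E r)) + \<eta>)"
    if r: "r \<in> I" for r
  proof -
    let ?p = "\<lambda>s. zpow M s (n r)"
    have DS: "D r \<in> sets M" "E r \<in> sets M" and nr: "near k (?p t) id" using DE[OF r] by blast+
    define g where "g = 1 / real k - mismatch k (?p t) id"
    have g: "0 < g" using nr by (simp add: near_def g_def)
    obtain l1 where l1: "0 < l1" "\<forall>s. mp_iso M M s \<longrightarrow> near l1 s t \<longrightarrow> mismatch k (?p s) (?p t) < g"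
      using near_zpow[OF t g k, of "n r"] by (elim exE conjE) (rule that)
    obtain l2 where l2: "0 < l2" "\<forall>s t. mp_iso M M s \<longrightarrow> mp_iso M M t \<longrightarrow> near l2 s t \<longrightarrow>
        measure M (sym_diff (pre M s (E r)) (pre M t (E r))) < \<eta>"
      using near_pre[OF DS(2) \<eta>] by (elim exE conjE) (rule that)
    obtain l3 where l3: "0 < l3" "\<forall>s. mp_iso M M s \<longrightarrow> near l3 s t \<longrightarrow> near l2 (?p s) (?p t)"
      using near_zpow_near[OF t l2(1), of "n r"] by (elim exE conjE) (rule that)
    show ?thesis
    proof (intro exI[of _ "l1 * l3"] conjI allI impI)
      show "0 < l1 * l3" using l1(1) l3(1) by simp
      fix s t' assume s: "mp_iso M M s" "mp_iso M M t'" "near (l1 * l3) s t'" "t' = t"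
      have ns: "near l1 s t" "near l3 s t"
        using near_dvd[OF s(3) _ _ s(1,2), of l1] near_dvd[OF s(3) _ _ s(1,2), of l3] l1(1) l3(1) s(4) by simp_all
      note z = mp_iso_zpow[OF s(1), of "n r"] mp_iso_zpow[OF t, of "n r"]
      have "mismatch k (?p s) id \<le> mismatch k (?p s) (?p t) + mismatch k (?p t) id"
        by (rule mismatch_triangle[OF z mp_iso_id])
      moreover have "mismatch k (?p s) (?p t) < g" using l1(2) s(1) ns(1) by blast
      ultimately show "near k (?p s) id" by (simp add: near_def g_def)
      have "near l2 (?p s) (?p t)" using l3(2) s(1) ns(2) by blast
      then have sm: "measure M (sym_diff (pre M (?p s) (E r)) (pre M (?p t) (E r))) < \<eta>" using l2(2) z by blast
      note S = pre_sets[OF z(1) DS(2)] pre_sets[OF z(2) DS(2)]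
      have SD: "sym_diff (pre M (?p s) (E r)) (pre M (?p t) (E r)) \<in> sets M" using S by (intro sets.Un sets.Diff)
      have "measure M (D r \<inter> pre M (?p t) (E r)) \<le> measure M ((D r \<inter> pre M (?p s) (E r)) \<union> sym_diff (pre M (?p s) (E r)) (pre M (?p t) (E r)))"
        by (rule finite_measure_mono[OF _ sets.Un[OF sets.Int[OF DS(1) S(1)] SD]]) blast
      also have "\<dots> \<le> measure M (D r \<inter> pre M (?p s) (E r)) + measure M (sym_diff (pre M (?p s) (E r)) (pre M (?p t) (E r)))"
        by (rule measure_Un_le[OF sets.Int[OF DS(1) S(1)] SD])
      finally show "measure M (D r \<inter> pre M (?p t) (E r)) \<le> measure M (D r \<inter> pre M (?p s) (E r)) + \<eta>" using sm by linarith
    qed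
  qed
  have "\<exists>l>0. \<forall>s t'. mp_iso M M s \<longrightarrow> mp_iso M M t' \<longrightarrow> near l s t' \<longrightarrow> (\<forall>r\<in>I. t' = t \<longrightarrow>
      near k (zpow M s (n r)) id \<and>
      measure M (D r \<inter> pre M (zpow M t (n r)) (E r)) \<le> measure M (D r \<inter> pre M (zpow M s (n r)) (E r)) + \<eta>)"
    by (rule near_combine[OF I(1)], rule one)
  then obtain l where l: "0 < l" "\<forall>s t'. mp_iso M M s \<longrightarrow> mp_iso M M t' \<longrightarrow> near l s t' \<longrightarrow> (\<forall>r\<in>I. t' = t \<longrightarrow>
      near k (zpow M s (n r)) id \<and>
      measure M (D r \<inter> pre M (zpow M t (n r)) (E r)) \<le> measure M (D r \<inter> pre M (zpow M s (n r)) (E r)) + \<eta>)"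
    by (elim exE conjE) (rule that)
  have "carries k i j s" if s: "mp_iso M M s" "near l s t" for s
  proof -
    have ls: "\<forall>r\<in>I. near k (zpow M s (n r)) id \<and>
      measure M (D r \<inter> pre M (zpow M t (n r)) (E r)) \<le> measure M (D r \<inter> pre M (zpow M s (n r)) (E r)) + \<eta>"
      using l(2) s t by blast
    have "\<Sigma> t \<le> (\<Sum>r\<in>I. measure M (D r \<inter> pre M (zpow M s (n r)) (E r)) + \<eta>)"
      unfolding \<Sigma>_def using ls by (intro sum_mono) blast
    also have "\<dots> = \<Sigma> s + real (card I) * \<eta>" by (simp add: \<Sigma>_def sum.distrib)
    finally have "\<Sigma> t \<le> \<Sigma> s + real (card I) * \<eta>" .
    moreover have "\<Sigma> t - 3 / (4 * real k) = (real (card I) + 1) * \<eta>"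
    proof -
      have "real (card I) + 1 \<noteq> 0" by linarith
      then show ?thesis by (simp add: \<eta>_def)
    qed
    moreover have "(real (card I) + 1) * \<eta> = real (card I) * \<eta> + \<eta>" by (simp add: distrib_right)
    ultimately have "3 / (4 * real k) < \<Sigma> s" using \<eta> by linarith
    moreover have "\<forall>r\<in>I. D r \<in> sets M \<and> E r \<in> sets M \<and> D r \<subseteq> cells k {i} \<and> E r \<subseteq> cells k {j} \<and> near k (zpow M s (n r)) id"
      using DE ls by blast
    ultimately have "carrying k i j s I n D E" unfolding carrying_def \<Sigma>_def using I by blast
    then show ?thesis unfolding carries_def by (intro exI)
  qed
  then show ?thesis using l(1) by blast
qed

lemma openin_transports:
  assumes k: "0 < k"
  shows "openin (aut_topology M) {aut_class M t | t. mp_iso M M t \<and> transports k t}" (is "openin _ ?O")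
proof -
  have op: "\<exists>l>0. \<forall>s. mp_iso M M s \<longrightarrow> near l s t \<longrightarrow> transports k s" if t: "mp_iso M M t" "transports k t" for t
  proof -
    have one: "\<exists>l>0. \<forall>s t'. mp_iso M M s \<longrightarrow> mp_iso M M t' \<longrightarrow> near l s t' \<longrightarrow> (t' = t \<longrightarrow> carries k (fst p) (snd p) s)"
      if p: "p \<in> {..<k} \<times> {..<k}" for p
    proof -
      have "carries k (fst p) (snd p) t" using t(2) p unfolding transports_def by (auto simp: mem_Times_iff)
      from carries_open[OF t(1) this k] show ?thesis by (elim exE conjE) (intro exI conjI allI impI, assumption, blast)
    qed
    have "finite ({..<k} \<times> {..<k})" by simp
    then have "\<exists>l>0. \<forall>s t'. mp_iso M M s \<longrightarrow> mp_iso M M t' \<longrightarrow> near l s t' \<longrightarrow>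
      (\<forall>p\<in>{..<k} \<times> {..<k}. t' = t \<longrightarrow> carries k (fst p) (snd p) s)"
      by (rule near_combine) (rule one)
    then obtain l where l: "0 < l" "\<forall>s t'. mp_iso M M s \<longrightarrow> mp_iso M M t' \<longrightarrow> near l s t' \<longrightarrow>
      (\<forall>p\<in>{..<k} \<times> {..<k}. t' = t \<longrightarrow> carries k (fst p) (snd p) s)"
      by (elim exE conjE) (rule that)
    have "transports k s" if s: "mp_iso M M s" "near l s t" for s
      unfolding transports_def
    proof (intro allI impI)
      fix i j assume "i < k" "j < k"
      then have "(i, j) \<in> {..<k} \<times> {..<k}" by simp
      then have "carries k (fst (i, j)) (snd (i, j)) s" using l(2) s t(1) by blast
      then show "carries k i j s" by simp
    qed
    then show ?thesis using l(1) by blast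
  qed
  show ?thesis unfolding openin_aut_topology_iff
  proof (intro conjI allI impI)
    show "?O \<subseteq> carrier (Aut M)" by (auto simp: carrier_Aut)
    fix t assume t: "mp_iso M M t" "aut_class M t \<in> ?O"
    obtain t' where t': "mp_iso M M t'" "transports k t'" "aut_class M t = aut_class M t'" using t(2) by blast
    obtain l where l: "0 < l" "\<forall>s. mp_iso M M s \<longrightarrow> near l s t' \<longrightarrow> transports k s"
      using op[OF t'(1,2)] by (elim exE conjE) (rule that)
    have "aut_class M s \<in> ?O" if s: "mp_iso M M s" "near l s t" for s
    proof -
      have "mismatch l s t = mismatch l s t'"
        by (rule mismatch_cong_AE[OF s(1) t(1) s(1) t'(1) _ aut_class_eq_iff[OF t(1) t'(3)]]) simp
      then have "near l s t'" using s(2) by (simp add: near_def)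
      then show ?thesis using l(2) s(1) by blast
    qed
    then show "\<exists>l>0. \<forall>s. mp_iso M M s \<longrightarrow> near l s t \<longrightarrow> aut_class M s \<in> ?O" using l(1) by blast
  qed
qed

lemma whirly_set_eq:
  "{T \<in> carrier (Aut M). whirly M T} = (\<Inter>k\<in>{0<..}. {aut_class M t | t. mp_iso M M t \<and> transports k t})"
proof (rule equalityI; rule subsetI)
  fix T assume "T \<in> {T \<in> carrier (Aut M). whirly M T}"
  then obtain t where t: "mp_iso M M t" "T = aut_class M t" "whirly M T" by (auto simp: carrier_Aut)
  then have w: "whirls t" using whirly_iff_whirls[OF t(1)] by simp
  have "transports k t" if "0 < k" for k unfolding transports_def using carries_if_whirls[OF t(1) w that] by blast
  then show "T \<in> (\<Inter>k\<in>{0<..}. {aut_class M t | t. mp_iso M M t \<and> transports k t})" using t(1,2) by blast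
next
  fix T assume T: "T \<in> (\<Inter>k\<in>{0<..}. {aut_class M t | t. mp_iso M M t \<and> transports k t})"
  then have "T \<in> {aut_class M t | t. mp_iso M M t \<and> transports 1 t}" by (rule INT_D) simp
  then obtain t where t: "mp_iso M M t" "T = aut_class M t" by blast
  have nr: "near k t s" if "mp_iso M M s" "aut_class M t = aut_class M s" "0 < k" for k s
  proof -
    have "mismatch k t s = mismatch k s s"
      by (rule mismatch_cong_AE[OF t(1) that(1) that(1) that(1) aut_class_eq_iff[OF t(1) that(2)]]) simp
    then show ?thesis using that(3) by (simp add: near_def mismatch_self)
  qed
  have "transports k t" if k: "0 < k" for k
  proof -
    have "T \<in> {aut_class M t | t. mp_iso M M t \<and> transports k t}" using T by (rule INT_D) (simp add: k)
    then obtain s where s: "mp_iso M M s" "transports k s" "aut_class M t = aut_class M s" using t(2) by blast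
    show ?thesis unfolding transports_def
    proof (intro allI impI)
      fix i j assume ij: "i < k" "j < k"
      then have "carries k i j s" using s(2) unfolding transports_def by blast
      from carries_open[OF s(1) this k] show "carries k i j t"
        using nr[OF s(1,3)] t(1) by blast
    qed
  qed
  then have "whirls t" by (rule whirls_if_transports[OF t(1)])
  then have "whirly M T" using whirly_iff_whirls[OF t(1)] t(2) by simp
  then show "T \<in> {T \<in> carrier (Aut M). whirly M T}" using t by (simp add: carrier_Aut)
qed

end

section \<open>Approximation by permutations of cells\<close>

text \<open>
  If every label were used \<open>n\<close> times, \<open>ex_bij_betw_equal_fibres\<close> would give a bijection that
  takes each point into the block of its label. In general only the points in excess of \<open>n\<close> must be
  misplaced.
\<close>
lemma ex_permutation_with_labels:
  fixes f :: "nat \<Rightarrow> nat"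
  assumes f: "\<And>a. a < k * n \<Longrightarrow> f a < k" and n: "0 < n"
  shows "\<exists>\<pi>. \<pi> permutes {..<k * n} \<and>
    card {a \<in> {..<k * n}. \<pi> a div n \<noteq> f a} \<le> (\<Sum>j<k. card {a \<in> {..<k * n}. f a = j} - n)"
proof -
  let ?X = "{..<k * n}"
  define F where "F j = {a \<in> ?X. f a = j}" for j
  define B where "B j = {b \<in> ?X. b div n = j}" for j
  have finF: "finite (F j)" and finB: "finite (B j)" for j by (simp_all add: F_def B_def)
  have cardB: "card (B j) = n" if "j < k" for j
  proof -
    have "B j = {j * n..<j * n + n}"
    proof (rule equalityI; rule subsetI)
      fix b assume "b \<in> B j"
      then have "b div n = j" by (simp add: B_def)
      then show "b \<in> {j * n..<j * n + n}" using div_eq_last_iff[OF n, of b j] by simp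
    next
      fix b assume b: "b \<in> {j * n..<j * n + n}"
      then have "b div n = j" by (intro div_nat_eqI) (auto simp: mult.commute)
      moreover have "(j + 1) * n \<le> k * n" using that by (intro mult_le_mono1) simp
      then have "b < k * n" using b by simp
      ultimately show "b \<in> B j" by (simp add: B_def)
    qed
    then show ?thesis by simp
  qed
  have "\<exists>F' g. F' \<subseteq> F j \<and> card (F j - F') = card (F j) - n \<and> inj_on g F' \<and> g ` F' \<subseteq> B j" if j: "j < k" for j
  proof -
    define m where "m = min (card (F j)) n"
    have mm: "m \<le> card (F j)" "m \<le> card (B j)" by (simp_all add: m_def cardB[OF j])
    then obtain F' B' where F': "F' \<subseteq> F j" "card F' = m" and B': "B' \<subseteq> B j" "card B' = m"
      by (meson obtain_subset_with_card_n)
    have "finite F'" "finite B'" using finite_subset[OF F'(1) finF] finite_subset[OF B'(1) finB] .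
    then obtain g where g: "bij_betw g F' B'" using finite_same_card_bij[of F' B'] F'(2) B'(2) by auto
    have "card (F j - F') = card (F j) - m" using F' \<open>finite F'\<close> by (simp add: card_Diff_subset)
    also have "\<dots> = card (F j) - n" by (simp add: m_def)
    finally show ?thesis using F'(1) B'(1) g by (intro exI[of _ F'] exI[of _ g]) (auto simp: bij_betw_def)
  qed
  then obtain F' g where Fg: "\<And>j. j < k \<Longrightarrow> F' j \<subseteq> F j \<and> card (F j - F' j) = card (F j) - n \<and> inj_on (g j) (F' j) \<and> g j ` F' j \<subseteq> B j"
    by metis
  define G where "G = (\<Union>j\<in>{..<k}. F' j)"
  define h where "h a = g (f a) a" for a
  have GX: "a \<in> ?X \<and> f a < k \<and> a \<in> F' (f a)" if aG: "a \<in> G" for a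
  proof -
    obtain j where j: "j < k" "a \<in> F' j" using aG unfolding G_def by blast
    then have "a \<in> F j" using Fg by blast
    then have "a \<in> ?X" "f a = j" by (simp_all add: F_def)
    then show ?thesis using j by simp
  qed
  have hB: "h a \<in> B (f a)" if "a \<in> G" for a
  proof -
    have "f a < k" "a \<in> F' (f a)" using GX[OF that] by blast+
    then show ?thesis using Fg[of "f a"] unfolding h_def by blast
  qed
  have injh: "inj_on h G"
  proof (rule inj_onI)
    fix a b assume ab: "a \<in> G" "b \<in> G" "h a = h b"
    have "f a = f b" using hB[OF ab(1)] hB[OF ab(2)] ab(3) by (simp add: B_def)
    moreover have "inj_on (g (f a)) (F' (f a))" using Fg[of "f a"] GX[OF ab(1)] by blast
    ultimately show "a = b" using GX[OF ab(1)] GX[OF ab(2)] ab(3) unfolding h_def by (metis inj_onD)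
  qed
  have GXs: "G \<subseteq> ?X" using GX by blast
  have hGX: "h ` G \<subseteq> ?X" using hB by (auto simp: B_def)
  have finG: "finite G" using GXs by (rule finite_subset) simp
  have bij: "bij_betw h G (h ` G)" using injh by (rule inj_on_imp_bij_betw)
  have "card (?X - G) = card (?X - h ` G)"
    using GXs hGX finG by (simp add: card_Diff_subset card_image[OF injh])
  then obtain h' where h': "bij_betw h' (?X - G) (?X - h ` G)" using finite_same_card_bij[of "?X - G" "?X - h ` G"] by auto
  define \<pi> where "\<pi> a = (if a < k * n then if a \<in> G then h a else h' a else a)" for a
  have b1: "bij_betw \<pi> G (h ` G)"
    using bij by (rule bij_betw_cong[THEN iffD1, rotated]) (use GXs in \<open>auto simp: \<pi>_def\<close>)
  have b2: "bij_betw \<pi> (?X - G) (?X - h ` G)"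
    using h' by (rule bij_betw_cong[THEN iffD1, rotated]) (auto simp: \<pi>_def)
  have "bij_betw \<pi> (G \<union> (?X - G)) (h ` G \<union> (?X - h ` G))"
    using b1 b2 by (rule bij_betw_combine) blast
  moreover have "G \<union> (?X - G) = ?X" "h ` G \<union> (?X - h ` G) = ?X" using GXs hGX by blast+
  ultimately have "bij_betw \<pi> ?X ?X" by (simp only:)
  then have perm: "\<pi> permutes ?X" by (rule bij_imp_permutes) (simp add: \<pi>_def)
  have "{a \<in> ?X. \<pi> a div n \<noteq> f a} \<subseteq> (\<Union>j\<in>{..<k}. F j - F' j)"
  proof
    fix a assume a: "a \<in> {a \<in> ?X. \<pi> a div n \<noteq> f a}"
    have "a \<notin> G"
    proof
      assume G: "a \<in> G"
      then have "\<pi> a = h a" using GX[OF G] by (simp add: \<pi>_def)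
      then show False using hB[OF G] a by (simp add: B_def)
    qed
    moreover have "f a < k" "a \<in> F (f a)" using a f by (auto simp: F_def)
    ultimately show "a \<in> (\<Union>j\<in>{..<k}. F j - F' j)" unfolding G_def by blast
  qed
  then have "card {a \<in> ?X. \<pi> a div n \<noteq> f a} \<le> card (\<Union>j\<in>{..<k}. F j - F' j)"
    using finF by (intro card_mono finite_UN_I) auto
  also have "\<dots> \<le> (\<Sum>j<k. card (F j - F' j))" by (rule card_UN_le) simp
  also have "\<dots> = (\<Sum>j<k. card (F j) - n)" using Fg by (intro sum.cong) auto
  finally show ?thesis using perm unfolding F_def by blast
qed

context lebesgue_coordinate
begin

lemma idx_pre_sets: "mp_iso M M t \<Longrightarrow> {x \<in> space M. idx R (t x) = i} \<in> sets M"
  using measurable_sets[OF measurable_compose[OF mp_iso_measurable idx_measurable], of t "{i}" R]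
  by (simp add: vimage_def Int_def conj_commute)

text \<open>
  Label the fine cells by the coarse cells into which \<open>t\<close> maps them, up to small errors, and turn the
  labels into a permutation. As
  \<open>t\<close> preserves the measure, a label is used too often only on account of wrongly labelled points, so the
  permutation is wrong on at most as much mass as the labelling.
\<close>
lemma ex_permutation_near:
  assumes t: "mp_iso M M t" and k: "0 < k" and e: "0 < e"
  shows "\<exists>R \<pi>. 0 < R \<and> k dvd R \<and> \<pi> permutes {..<R} \<and>
    measure M {x \<in> space M. idx k (t x) \<noteq> \<pi> (idx R x) div (R div k)} < e"
proof -
  define d where "d = e / (2 * (real k + 1))"
  have d: "0 < d" using e by (simp add: d_def)
  define A where "A j = {x \<in> space M. idx k (t x) = j}" for j
  have AS: "A j \<in> sets M" for j unfolding A_def by (rule idx_pre_sets[OF t])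
  have "\<exists>R J. 0 < R \<and> J \<subseteq> {..<R} \<and> measure M (sym_diff (A j) (cells R J)) < d" for j
    by (rule approx_by_cells[OF AS d])
  then obtain R0 J0 where RJ0: "\<And>j. 0 < R0 j" "\<And>j. J0 j \<subseteq> {..<R0 j}" "\<And>j. measure M (sym_diff (A j) (cells (R0 j) (J0 j))) < d"
    by metis
  define n where "n = (\<Prod>j<k. R0 j)"
  have n: "0 < n" unfolding n_def using RJ0(1) by (intro prod_pos) auto
  define R where "R = k * n"
  have R: "0 < R" "k dvd R" "R div k = n" using k n by (simp_all add: R_def)
  have "\<exists>J. J \<subseteq> {..<R} \<and> cells R J = cells (R0 j) (J0 j)" if "j < k" for j
  proof (rule cells_refine[OF _ R(1) RJ0(2)])
    have "R0 j dvd n" unfolding n_def using that by (intro dvd_prodI) auto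
    then show "R0 j dvd R" unfolding R_def by (rule dvd_mult)
  qed
  then obtain J where J: "\<And>j. j < k \<Longrightarrow> J j \<subseteq> {..<R} \<and> cells R (J j) = cells (R0 j) (J0 j)" by metis
  define f where "f a = (if \<exists>j<k. a \<in> J j then LEAST j. j < k \<and> a \<in> J j else 0)" for a
  have f: "f a < k" for a
  proof (cases "\<exists>j<k. a \<in> J j")
    case True
    then have "(LEAST j. j < k \<and> a \<in> J j) < k \<and> a \<in> J (LEAST j. j < k \<and> a \<in> J j)" by (rule LeastI_ex)
    moreover have "f a = (LEAST j. j < k \<and> a \<in> J j)" unfolding f_def using True by (rule if_P)
    ultimately show ?thesis by simp
  next
    case False
    then have "f a = 0" unfolding f_def by (rule if_not_P)
    then show ?thesis using k by simp
  qed
  (* W is the set of wrongly labelled points. *)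
  define W where "W = {x \<in> space M. idx k (t x) \<noteq> f (idx R x)}"
  have WS: "W \<in> sets M"
  proof -
    have "W = space M - (\<Union>j. A j \<inter> cells R {a. f a = j})" by (auto simp: W_def A_def cells_def)
    also have "\<dots> \<in> sets M" using AS cells_sets by (intro sets.Diff sets.countable_UN) auto
    finally show ?thesis .
  qed
  have "AE x in M. idx k (t x) < k" using AE_mp_iso[OF t AE_idx_less[OF k]] .
  then have "AE x in M. x \<in> W \<longrightarrow> x \<in> (\<Union>j\<in>{..<k}. sym_diff (A j) (cells R (J j)))"
    using AE_space
  proof eventually_elim
    case (elim x)
    define j where "j = idx k (t x)"
    have j: "j < k" "x \<in> A j" using elim by (simp_all add: j_def A_def)
    show ?case
    proof (rule impI, rule ccontr)
      assume W: "x \<in> W" and nx: "x \<notin> (\<Union>j\<in>{..<k}. sym_diff (A j) (cells R (J j)))"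
      have iff: "x \<in> A i \<longleftrightarrow> idx R x \<in> J i" if "i < k" for i using nx that elim by (auto simp: cells_def)
      have mem: "idx R x \<in> J j" using iff[OF j(1)] j(2) by blast
      have uniq: "i = j" if "i < k" "idx R x \<in> J i" for i
        using iff[OF that(1)] that(2) by (simp add: A_def j_def)
      have "(LEAST i. i < k \<and> idx R x \<in> J i) = j"
      proof (rule Least_equality)
        show "j < k \<and> idx R x \<in> J j" using j(1) mem by blast
        fix i assume "i < k \<and> idx R x \<in> J i"
        then have "i = j" using uniq by blast
        then show "j \<le> i" by simp
      qed
      moreover have "\<exists>i<k. idx R x \<in> J i" using j(1) mem by blast
      then have "f (idx R x) = (LEAST i. i < k \<and> idx R x \<in> J i)" unfolding f_def by (rule if_P)
      ultimately have "f (idx R x) = j" by simp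
      then show False using W by (simp add: W_def j_def)
    qed
  qed
  then have "measure M W \<le> measure M (\<Union>j\<in>{..<k}. sym_diff (A j) (cells R (J j)))"
    by (rule finite_measure_mono_AE) (intro sets.finite_UN finite_lessThan sets.Un sets.Diff AS cells_sets)
  also have "\<dots> \<le> (\<Sum>j<k. measure M (sym_diff (A j) (cells R (J j))))"
    by (intro measure_UNION_le finite_lessThan sets.Un sets.Diff AS cells_sets)
  also have "\<dots> \<le> (\<Sum>j<k. d)" using RJ0(3) J by (intro sum_mono) (auto simp: less_imp_le)
  also have "\<dots> = real k * d" by simp
  finally have mW: "measure M W \<le> real k * d" .
  have excess: "real (card {a \<in> {..<R}. f a = j} - n) / real R \<le> measure M (W \<inter> cells R {a \<in> {..<R}. f a = j})" if j: "j < k" for j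
  proof -
    define P where "P = {a \<in> {..<R}. f a = j}"
    have CP: "measure M (cells R P) = real (card P) / real R" using R(1) by (intro measure_cells_card) (auto simp: P_def)
    have mAj: "measure M (A j) = 1 / real k"
    proof -
      have "A j = pre M t (cells k {j})" using mp_iso_space[OF t] by (auto simp: A_def cells_def)
      then show ?thesis using measure_pre[OF t cells_sets] measure_cells_single[OF k j] by simp
    qed
    have "measure M (cells R P) \<le> measure M (A j \<union> (W \<inter> cells R P))"
    proof (rule finite_measure_mono[OF subsetI sets.Un[OF AS sets.Int[OF WS cells_sets]]])
      fix x assume x: "x \<in> cells R P"
      then have "x \<in> space M" "f (idx R x) = j" by (simp_all add: cells_def P_def)
      then show "x \<in> A j \<union> (W \<inter> cells R P)" using x by (cases "idx k (t x) = j") (simp_all add: A_def W_def)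
    qed
    also have "\<dots> \<le> measure M (A j) + measure M (W \<inter> cells R P)" by (rule measure_Un_le[OF AS sets.Int[OF WS cells_sets]])
    finally have le: "real (card P) / real R \<le> 1 / real k + measure M (W \<inter> cells R P)" unfolding CP mAj .
    have nk: "1 / real k = real n / real R" using k n by (simp add: R_def)
    have "real (card P - n) / real R \<le> measure M (W \<inter> cells R P)"
    proof (cases "n \<le> card P")
      case True
      then show ?thesis using le unfolding nk by (simp add: of_nat_diff diff_divide_distrib)
    qed simp
    then show ?thesis unfolding P_def .
  qed
  have sumW: "(\<Sum>j<k. measure M (W \<inter> cells R {a \<in> {..<R}. f a = j})) \<le> measure M W"
  proof -
    have "(\<Sum>j<k. measure M (W \<inter> cells R {a \<in> {..<R}. f a = j})) = measure M (\<Union>j\<in>{..<k}. W \<inter> cells R {a \<in> {..<R}. f a = j})"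
    proof (rule finite_measure_finite_Union[symmetric])
      show "(\<lambda>j. W \<inter> cells R {a \<in> {..<R}. f a = j}) ` {..<k} \<subseteq> sets M" using WS cells_sets by blast
      show "disjoint_family_on (\<lambda>j. W \<inter> cells R {a \<in> {..<R}. f a = j}) {..<k}"
        by (auto simp: disjoint_family_on_def cells_def)
    qed simp
    also have "\<dots> \<le> measure M W" by (rule finite_measure_mono[OF _ WS]) blast
    finally show ?thesis .
  qed
  obtain \<pi> where \<pi>: "\<pi> permutes {..<R}" "card {a \<in> {..<R}. \<pi> a div n \<noteq> f a} \<le> (\<Sum>j<k. card {a \<in> {..<R}. f a = j} - n)"
    using ex_permutation_with_labels[of k n f] f n unfolding R_def by blast
  define Y where "Y = {a \<in> {..<R}. \<pi> a div n \<noteq> f a}"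
  have "measure M (cells R Y) = real (card Y) / real R" using R(1) by (intro measure_cells_card) (auto simp: Y_def)
  also have "\<dots> \<le> real (\<Sum>j<k. card {a \<in> {..<R}. f a = j} - n) / real R"
    using \<pi>(2) unfolding Y_def by (intro divide_right_mono of_nat_mono) auto
  also have "\<dots> = (\<Sum>j<k. real (card {a \<in> {..<R}. f a = j} - n) / real R)"
    by (simp add: sum_divide_distrib)
  also have "\<dots> \<le> (\<Sum>j<k. measure M (W \<inter> cells R {a \<in> {..<R}. f a = j}))"
    using excess by (intro sum_mono) auto
  finally have mY: "measure M (cells R Y) \<le> real k * d" using sumW mW by linarith
  have "AE x in M. x \<in> {x \<in> space M. idx k (t x) \<noteq> \<pi> (idx R x) div (R div k)} \<longrightarrow> x \<in> W \<union> cells R Y"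
    using AE_idx_less[OF R(1)]
  proof eventually_elim
    case (elim x)
    then show ?case unfolding R(3) by (auto simp: W_def cells_def Y_def)
  qed
  then have "measure M {x \<in> space M. idx k (t x) \<noteq> \<pi> (idx R x) div (R div k)} \<le> measure M (W \<union> cells R Y)"
    by (rule finite_measure_mono_AE) (rule sets.Un[OF WS cells_sets])
  also have "\<dots> \<le> measure M W + measure M (cells R Y)" by (rule measure_Un_le[OF WS cells_sets])
  also have "\<dots> \<le> 2 * (real k * d)" using mW mY by linarith
  also have "\<dots> < 2 * ((real k + 1) * d)" using d by (simp add: distrib_right)
  also have "\<dots> = e"
  proof -
    have "q * (e / q) = e" if "q \<noteq> 0" for q :: real using that by simp
    moreover have "0 < 2 * (real k + 1)" by simp
    then have "2 * (real k + 1) \<noteq> 0" by (rule less_imp_neq[THEN not_sym])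
    ultimately have "2 * (real k + 1) * (e / (2 * (real k + 1))) = e" by blast
    then show ?thesis by (simp only: d_def mult.assoc)
  qed
  finally show ?thesis using R(1,2) \<pi>(1) by blast
qed

end

section \<open>Density of the whirly automorphisms\<close>

text \<open>
  Subdivide each cell into \<open>k\<close> parts, permuted along, to make the rank divisible by \<open>k\<close>; then
  apply \<open>ex_shuffling_extension\<close>.
\<close>
lemma ex_shuffling_refinement:
  assumes \<pi>: "\<pi> permutes {..<R}" and R: "0 < R" and k: "0 < k" and \<epsilon>: "0 < (\<epsilon>::real)"
  shows "\<exists>D \<sigma>. 2 \<le> D \<and> k dvd R * D \<and> \<sigma> permutes {..<R * D} \<and>
     real (card {a \<in> {..<R * D}. \<sigma> a div D \<noteq> \<pi> (a div D)}) / real (R * D) \<le> \<epsilon> \<and>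
     shuffles k {..<R * D} (\<lambda>a. a div (R * D div k)) \<sigma>"
proof -
  define \<rho> where "\<rho> a = \<pi> (a div k) * k + a mod k" for a
  have \<rho>_div: "\<rho> a div k = \<pi> (a div k)" "\<rho> a mod k = a mod k" for a using k by (simp_all add: \<rho>_def)
  have less: "a div k < R \<longleftrightarrow> a < R * k" for a using k by (simp add: div_less_iff_less_mult)
  have \<rho>: "\<rho> permutes {..<R * k}"
  proof (rule bij_imp_permutes)
    have inj: "inj_on \<rho> {..<R * k}"
    proof (rule inj_onI)
      fix a b assume "\<rho> a = \<rho> b"
      then have "\<pi> (a div k) = \<pi> (b div k)" "a mod k = b mod k" using \<rho>_div by metis+
      then have "a div k = b div k" "a mod k = b mod k" using permutes_inj[OF \<pi>] by (simp_all add: inj_eq)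
      then show "a = b" by (metis div_mult_mod_eq)
    qed
    have "\<rho> ` {..<R * k} \<subseteq> {..<R * k}"
    proof
      fix b assume "b \<in> \<rho> ` {..<R * k}"
      then obtain a where a: "a < R * k" "b = \<rho> a" by blast
      have "\<pi> (a div k) < R" using permutes_in_image[OF \<pi>, of "a div k"] less a(1) by simp
      then show "b \<in> {..<R * k}" using less[of b] \<rho>_div(1)[of a] a(2) by simp
    qed
    then show "bij_betw \<rho> {..<R * k} {..<R * k}" using inj by (simp add: bij_betw_def endo_inj_surj)
    fix a assume a: "a \<notin> {..<R * k}"
    then have "a div k \<notin> {..<R}" using less by simp
    then have "\<pi> (a div k) = a div k" by (rule permutes_not_in[OF \<pi>])
    then show "\<rho> a = a" by (simp add: \<rho>_def)
  qed
  have "0 < R * k" "k dvd R * k" using R k by simp_all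
  from ex_shuffling_extension[OF \<rho> this(2,1) k \<epsilon>]
  obtain D \<sigma> where D: "2 \<le> D" "\<sigma> permutes {..<R * k * D}"
      "real (card {a \<in> {..<R * k * D}. \<sigma> a div D \<noteq> \<rho> (a div D)}) \<le> \<epsilon> * real (R * k * D)"
      "shuffles k {..<R * k * D} (\<lambda>a. a div (R * k * D div k)) \<sigma>"
    by (elim exE conjE) (rule that)
  have eq: "R * (k * D) = R * k * D" by (simp only: mult.assoc)
  have pos: "0 < R * k * D" using R k D(1) by simp
  have "{a \<in> {..<R * k * D}. \<sigma> a div (k * D) \<noteq> \<pi> (a div (k * D))} \<subseteq> {a \<in> {..<R * k * D}. \<sigma> a div D \<noteq> \<rho> (a div D)}"
  proof (rule subsetI, rule ccontr)
    fix a assume a: "a \<in> {a \<in> {..<R * k * D}. \<sigma> a div (k * D) \<noteq> \<pi> (a div (k * D))}"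
      "a \<notin> {a \<in> {..<R * k * D}. \<sigma> a div D \<noteq> \<rho> (a div D)}"
    then have "\<sigma> a div D = \<rho> (a div D)" by simp
    then have "\<sigma> a div D div k = \<pi> (a div D div k)" using \<rho>_div(1) by simp
    then have "\<sigma> a div (D * k) = \<pi> (a div (D * k))" by (simp only: div_mult2_eq)
    then show False using a(1) by (simp only: mult.commute[of D k]) simp
  qed
  then have "card {a \<in> {..<R * k * D}. \<sigma> a div (k * D) \<noteq> \<pi> (a div (k * D))} \<le> card {a \<in> {..<R * k * D}. \<sigma> a div D \<noteq> \<rho> (a div D)}"
    by (rule card_mono[rotated]) simp
  then have "real (card {a \<in> {..<R * k * D}. \<sigma> a div (k * D) \<noteq> \<pi> (a div (k * D))}) \<le> \<epsilon> * real (R * k * D)"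
    using D(3) by linarith
  then have err: "real (card {a \<in> {..<R * k * D}. \<sigma> a div (k * D) \<noteq> \<pi> (a div (k * D))}) / real (R * k * D) \<le> \<epsilon>"
    using pos by (simp only: pos_divide_le_eq of_nat_0_less_iff)
  show ?thesis
  proof (intro exI[of _ "k * D"] exI[of _ \<sigma>] conjI)
    have "1 * 2 \<le> k * D" using k D(1) by (intro mult_le_mono) auto
    then show "2 \<le> k * D" by simp
    show "k dvd R * (k * D)" by simp
  qed (unfold eq, (rule D err)+)
qed

text \<open>
  The exponents in \<open>shuffles\<close> are finitely many, and their bound \<open>N\<close> determines how precisely an automorphism
  has to follow \<open>\<sigma>\<close> in order to shuffle as well.
\<close>
definition shuffles_within :: "nat \<Rightarrow> nat \<Rightarrow> 'b set \<Rightarrow> ('b \<Rightarrow> nat) \<Rightarrow> ('b \<Rightarrow> 'b) \<Rightarrow> bool" where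
  "shuffles_within N k \<Omega> \<beta> \<sigma> \<longleftrightarrow> (\<forall>i<k. \<forall>j<k. \<exists>Z n.
     Z \<subseteq> {a \<in> \<Omega>. \<beta> a = i} \<and> 7 * card \<Omega> \<le> 8 * k * card Z \<and>
     inj_on (\<lambda>a. (\<sigma> ^^ n a) a) Z \<and>
     (\<forall>a\<in>Z. n a \<le> N \<and> (\<sigma> ^^ n a) a \<in> \<Omega> \<and> \<beta> ((\<sigma> ^^ n a) a) = j \<and>
        4 * k * card {b \<in> \<Omega>. (\<sigma> ^^ n a) b \<noteq> b} \<le> card \<Omega>))"

lemma shuffles_imp_within:
  fixes \<sigma> :: "'b \<Rightarrow> 'b" and \<beta> :: "'b \<Rightarrow> nat"
  assumes sh: "shuffles k \<Omega> \<beta> \<sigma>" and fin: "finite \<Omega>"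
  shows "\<exists>N. shuffles_within N k \<Omega> \<beta> \<sigma>"
proof -
  define P where "P i j Z n \<longleftrightarrow> Z \<subseteq> {a \<in> \<Omega>. \<beta> a = i} \<and> 7 * card \<Omega> \<le> 8 * k * card Z \<and>
     inj_on (\<lambda>a. (\<sigma> ^^ n a) a) Z \<and>
     (\<forall>a\<in>Z. (\<sigma> ^^ n a) a \<in> \<Omega> \<and> \<beta> ((\<sigma> ^^ n a) a) = j \<and>
        4 * k * card {b \<in> \<Omega>. (\<sigma> ^^ n a) b \<noteq> b} \<le> card \<Omega>)" for i j Z and n :: "'b \<Rightarrow> nat"
  have "\<exists>Z n. P i j Z n" if "i < k" "j < k" for i j
    unfolding P_def by (rule sh[unfolded shuffles_def, rule_format, OF that])
  then have "\<forall>i j. \<exists>Z n. i < k \<longrightarrow> j < k \<longrightarrow> P i j Z n" by blast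
  then obtain Z n where Zn: "\<And>i j. i < k \<Longrightarrow> j < k \<Longrightarrow> P i j (Z i j) (n i j)" by metis
  define N where "N = (\<Sum>i<k. \<Sum>j<k. \<Sum>a\<in>\<Omega>. n i j a)"
  have N: "n i j a \<le> N" if "i < k" "j < k" "a \<in> Z i j" for i j a
  proof -
    have "a \<in> \<Omega>" using Zn[OF that(1,2)] that(3) unfolding P_def by blast
    then have "n i j a \<le> (\<Sum>a\<in>\<Omega>. n i j a)" using fin by (intro member_le_sum) auto
    also have "\<dots> \<le> (\<Sum>j<k. \<Sum>a\<in>\<Omega>. n i j a)" using that(2) by (intro member_le_sum) auto
    also have "\<dots> \<le> N" unfolding N_def using that(1) by (intro member_le_sum) auto
    finally show ?thesis .
  qed
  have "shuffles_within N k \<Omega> \<beta> \<sigma>" unfolding shuffles_within_def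
  proof (intro allI impI)
    fix i j assume ij: "i < k" "j < k"
    show "\<exists>Z n. Z \<subseteq> {a \<in> \<Omega>. \<beta> a = i} \<and> 7 * card \<Omega> \<le> 8 * k * card Z \<and>
     inj_on (\<lambda>a. (\<sigma> ^^ n a) a) Z \<and>
     (\<forall>a\<in>Z. n a \<le> N \<and> (\<sigma> ^^ n a) a \<in> \<Omega> \<and> \<beta> ((\<sigma> ^^ n a) a) = j \<and>
        4 * k * card {b \<in> \<Omega>. (\<sigma> ^^ n a) b \<noteq> b} \<le> card \<Omega>)"
      using Zn[OF ij] N[OF ij] unfolding P_def by (intro exI[of _ "Z i j"] exI[of _ "n i j"]) blast
  qed
  then show ?thesis ..
qed

text \<open>
  The exponents are at most \<open>N\<close>, and an error of measure \<open>\<delta>\<close> is still harmless when it accumulates \<open>N\<close> times.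
\<close>
definition good_stage :: "nat \<Rightarrow> nat \<Rightarrow> (nat \<Rightarrow> nat) \<Rightarrow> real \<Rightarrow> bool" where
  "good_stage k R \<pi> \<delta> \<longleftrightarrow> k dvd R \<and> (\<exists>N. shuffles_within N k {..<R} (\<lambda>a. a div (R div k)) \<pi> \<and> real N * \<delta> \<le> 1 / (16 * real k))"

text \<open>
  The tolerance of a stage is chosen after its permutation, hence after the exponents that it uses. Halving
  the tolerances ensures that the errors of all later stages together stay below it.
\<close>
lemma ex_stage_sequence:
  assumes "\<pi>0 permutes {..<R0}" "0 < R0" "0 < (\<delta>0::real)"
  shows "\<exists>R D \<pi> \<delta>. R 0 = R0 \<and> \<pi> 0 = \<pi>0 \<and> \<delta> 0 = \<delta>0 \<and>
    (\<forall>m. 0 < R m \<and> \<pi> m permutes {..<R m} \<and> 0 < \<delta> m) \<and>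
    (\<forall>m. R (Suc m) = R m * D m \<and> 2 \<le> D m \<and> \<delta> (Suc m) \<le> \<delta> m / 2 \<and>
       real (card {a \<in> {..<R (Suc m)}. \<pi> (Suc m) a div D m \<noteq> \<pi> m (a div D m)}) / real (R (Suc m)) \<le> \<delta> m / 2 \<and>
       good_stage (Suc m) (R (Suc m)) (\<pi> (Suc m)) (\<delta> (Suc m)))"
proof -
  define P where "P m s = (case s of (R, \<pi>, \<delta>) \<Rightarrow> (m = 0 \<longrightarrow> R = R0 \<and> \<pi> = \<pi>0 \<and> \<delta> = \<delta>0) \<and>
      0 < R \<and> \<pi> permutes {..<R} \<and> 0 < \<delta>)" for m :: nat and s :: "nat \<times> (nat \<Rightarrow> nat) \<times> real"
  define Q where "Q m s s' = (case s of (R, \<pi>, \<delta>) \<Rightarrow> case s' of (R', \<pi>', \<delta>') \<Rightarrow>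
      \<exists>D. R' = R * D \<and> 2 \<le> D \<and> \<delta>' \<le> \<delta> / 2 \<and>
       real (card {a \<in> {..<R'}. \<pi>' a div D \<noteq> \<pi> (a div D)}) / real R' \<le> \<delta> / 2 \<and>
       good_stage (Suc m) R' \<pi>' \<delta>')" for m :: nat and s s' :: "nat \<times> (nat \<Rightarrow> nat) \<times> real"
  have "\<exists>f. \<forall>m. P m (f m) \<and> Q m (f m) (f (Suc m))"
  proof (rule dependent_nat_choice)
    show "\<exists>s. P 0 s" using assms by (intro exI[of _ "(R0, \<pi>0, \<delta>0)"]) (simp add: P_def)
    fix s m assume Ps: "P m s"
    obtain R \<pi> \<delta> where s: "s = (R, \<pi>, \<delta>)" by (cases s) auto
    have R: "0 < R" "\<pi> permutes {..<R}" "0 < \<delta>" using Ps by (simp_all add: P_def s)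
    have "0 < \<delta> / 2" using R(3) by simp
    from ex_shuffling_refinement[OF R(2,1) zero_less_Suc this, of m]
    obtain D \<sigma> where D: "2 \<le> D" "Suc m dvd R * D" "\<sigma> permutes {..<R * D}"
      "real (card {a \<in> {..<R * D}. \<sigma> a div D \<noteq> \<pi> (a div D)}) / real (R * D) \<le> \<delta> / 2"
      "shuffles (Suc m) {..<R * D} (\<lambda>a. a div (R * D div Suc m)) \<sigma>"
      by (elim exE conjE) (rule that)
    obtain N where N: "shuffles_within N (Suc m) {..<R * D} (\<lambda>a. a div (R * D div Suc m)) \<sigma>"
      using shuffles_imp_within[OF D(5)] by auto
    (* The second bound makes the next stage good, whatever happens later. *)
    define \<delta>' where "\<delta>' = min (\<delta> / 2) (1 / (16 * real (Suc m) * (real N + 1)))"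
    have d': "0 < \<delta>'" "\<delta>' \<le> \<delta> / 2" using R(3) by (simp_all add: \<delta>'_def)
    have "real N * \<delta>' \<le> (real N + 1) * (1 / (16 * real (Suc m) * (real N + 1)))"
    proof (rule mult_mono)
      show "\<delta>' \<le> 1 / (16 * real (Suc m) * (real N + 1))" unfolding \<delta>'_def by (rule min.cobounded2)
      show "0 \<le> \<delta>'" using d'(1) by (rule less_imp_le)
    qed simp_all
    also have "\<dots> = 1 / (16 * real (Suc m))"
    proof -
      have "q * (1 / (r * q)) = 1 / r" if "q \<noteq> 0" for q r :: real using that by simp
      moreover have "real N + 1 \<noteq> 0" by linarith
      ultimately show ?thesis by blast
    qed
    finally have "good_stage (Suc m) (R * D) \<sigma> \<delta>'" unfolding good_stage_def using D(2) N by blast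
    then have "Q m s (R * D, \<sigma>, \<delta>')" unfolding Q_def s using D(1,4) d'(2) by auto
    moreover have "P (Suc m) (R * D, \<sigma>, \<delta>')" unfolding P_def using R(1) D(1,3) d'(1) by simp
    ultimately show "\<exists>s'. P (Suc m) s' \<and> Q m s s'" by blast
  qed
  then obtain f where f: "\<And>m. P m (f m)" "\<And>m. Q m (f m) (f (Suc m))" by blast
  define R where "R m = fst (f m)" for m
  define \<pi> where "\<pi> m = fst (snd (f m))" for m
  define \<delta> where "\<delta> m = snd (snd (f m))" for m
  have fm: "f m = (R m, \<pi> m, \<delta> m)" for m by (simp add: R_def \<pi>_def \<delta>_def)
  have "\<forall>m. \<exists>D. R (Suc m) = R m * D \<and> 2 \<le> D \<and> \<delta> (Suc m) \<le> \<delta> m / 2 \<and>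
       real (card {a \<in> {..<R (Suc m)}. \<pi> (Suc m) a div D \<noteq> \<pi> m (a div D)}) / real (R (Suc m)) \<le> \<delta> m / 2 \<and>
       good_stage (Suc m) (R (Suc m)) (\<pi> (Suc m)) (\<delta> (Suc m))"
    using f(2) unfolding fm Q_def prod.case by (rule allI)
  from choice[OF this] obtain D where D: "\<forall>m. R (Suc m) = R m * D m \<and> 2 \<le> D m \<and> \<delta> (Suc m) \<le> \<delta> m / 2 \<and>
       real (card {a \<in> {..<R (Suc m)}. \<pi> (Suc m) a div D m \<noteq> \<pi> m (a div D m)}) / real (R (Suc m)) \<le> \<delta> m / 2 \<and>
       good_stage (Suc m) (R (Suc m)) (\<pi> (Suc m)) (\<delta> (Suc m))"
    by (elim exE) (rule that)
  have P: "(m = 0 \<longrightarrow> R m = R0 \<and> \<pi> m = \<pi>0 \<and> \<delta> m = \<delta>0) \<and> 0 < R m \<and> \<pi> m permutes {..<R m} \<and> 0 < \<delta> m" for m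
    using f(1)[of m] unfolding fm P_def prod.case .
  show ?thesis
  proof (rule exI[of _ R], rule exI[of _ D], rule exI[of _ \<pi>], rule exI[of _ \<delta>], intro conjI)
    show "R 0 = R0" "\<pi> 0 = \<pi>0" "\<delta> 0 = \<delta>0" using P[of 0] by simp_all
    show "\<forall>m. 0 < R m \<and> \<pi> m permutes {..<R m} \<and> 0 < \<delta> m" using P by blast
  qed (rule D)
qed

context lebesgue_coordinate
begin

lemma zpow_nat: "zpow M s (int q) = s ^^ q"
  by (simp add: zpow_def)

lemma idx_coarser:
  assumes "0 < R" "m dvd R" "x \<in> space M"
  shows "idx R x div (R div m) = idx m x"
proof -
  obtain q where q: "R = m * q" using assms(2) by blast
  then have "0 < m" "0 < q" using assms(1) by simp_all
  then show ?thesis using idx_div[of q x m] assms(3) by (simp add: q)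
qed

text \<open>
  Where \<open>s\<close> has followed \<open>\<pi>\<close> for \<open>N\<close> steps, its powers up to \<open>N\<close> act on cells like those of \<open>\<pi>\<close>. The other points
  have measure at most \<open>N * \<delta>\<close>. So the single cells in \<open>Z\<close> serve as pieces, and their images under the
  powers of \<open>\<pi>\<close> as the target pieces.
\<close>
lemma transports_of_stage:
  assumes s: "mp_iso M M s" and m: "0 < m" and R: "0 < R" and \<pi>: "\<pi> permutes {..<R}"
    and good: "good_stage m R \<pi> \<delta>"
    and near: "measure M {x \<in> space M. idx R (s x) \<noteq> \<pi> (idx R x)} \<le> \<delta>"
  shows "transports m s"
proof -
  obtain N where N: "shuffles_within N m {..<R} (\<lambda>a. a div (R div m)) \<pi>" "real N * \<delta> \<le> 1 / (16 * real m)"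
    and mR: "m dvd R" using good unfolding good_stage_def by (elim exE conjE) (rule that)
  define Bad where "Bad = {x \<in> space M. idx R (s x) \<noteq> \<pi> (idx R x)}"
  have BadS: "Bad \<in> sets M"
  proof -
    have "Bad = space M - (\<Union>a. cells R {a} \<inter> {x \<in> space M. idx R (s x) = \<pi> a})"
      by (auto simp: Bad_def cells_def)
    also have "\<dots> \<in> sets M" using cells_sets idx_pre_sets[OF s] by (intro sets.Diff sets.countable_UN) auto
    finally show ?thesis .
  qed
  (* the points that leave the trajectory prescribed by the permutation within N steps *)
  define BadN where "BadN = (\<Union>j\<in>{..<N}. pre M (s ^^ j) Bad)"
  have pS: "pre M (s ^^ j) Bad \<in> sets M" for j by (rule pre_sets[OF mp_iso_funpow[OF s] BadS])
  have BNS: "BadN \<in> sets M" unfolding BadN_def by (intro sets.finite_UN finite_lessThan pS)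
  have "measure M BadN \<le> (\<Sum>j<N. measure M (pre M (s ^^ j) Bad))"
    unfolding BadN_def by (intro measure_UNION_le finite_lessThan pS)
  also have "\<dots> = real N * measure M Bad" using measure_pre[OF mp_iso_funpow[OF s] BadS] by simp
  also have "\<dots> \<le> real N * \<delta>" using near unfolding Bad_def by (rule mult_left_mono) simp
  also note N(2)
  finally have mBN: "measure M BadN \<le> 1 / (16 * real m)" .
  have traj: "idx R ((s ^^ n) x) = (\<pi> ^^ n) (idx R x)" if x: "x \<in> space M" "x \<notin> BadN" and n: "n \<le> N" for n x
    using n
  proof (induction n)
    case (Suc n)
    have "(s ^^ n) x \<in> space M" using mp_iso_space[OF mp_iso_funpow[OF s] x(1)] .
    moreover have "(s ^^ n) x \<notin> Bad" using x Suc.prems unfolding BadN_def by auto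
    ultimately have "idx R (s ((s ^^ n) x)) = \<pi> (idx R ((s ^^ n) x))" by (simp add: Bad_def)
    then show ?case using Suc by simp
  qed simp
  show ?thesis unfolding transports_def
  proof (intro allI impI)
    fix i j assume ij: "i < m" "j < m"
    obtain Z n where Zi: "Z \<subseteq> {a \<in> {..<R}. a div (R div m) = i}" and Zc: "7 * card {..<R} \<le> 8 * m * card Z"
      and Zinj: "inj_on (\<lambda>a. (\<pi> ^^ n a) a) Z"
      and Zn: "\<forall>a\<in>Z. n a \<le> N \<and> (\<pi> ^^ n a) a \<in> {..<R} \<and> (\<pi> ^^ n a) a div (R div m) = j \<and>
        4 * m * card {b \<in> {..<R}. (\<pi> ^^ n a) b \<noteq> b} \<le> card {..<R}"
      using N(1)[unfolded shuffles_within_def, rule_format, OF ij] by (elim exE conjE) (rule that)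
    have ZR: "Z \<subseteq> {..<R}" using Zi by blast
    have finZ: "finite Z" using ZR by (rule finite_subset) simp
    have sub: "cells R {a} \<subseteq> cells m {l}" if "a div (R div m) = l" for a l
    proof
      fix x assume "x \<in> cells R {a}"
      then have "x \<in> space M" "idx R x = a" by (simp_all add: cells_def)
      then show "x \<in> cells m {l}" using idx_coarser[OF R mR, of x] that by (simp add: cells_def)
    qed
    have nearid: "near m (s ^^ n a) id" if a: "a \<in> Z" for a
    proof -
      define Y where "Y = {b \<in> {..<R}. (\<pi> ^^ n a) b \<noteq> b}"
      have na: "n a \<le> N" and cY: "4 * m * card Y \<le> R" using Zn a unfolding Y_def by auto
      have "mismatch m (s ^^ n a) id \<le> measure M (BadN \<union> cells R Y)"
        unfolding mismatch_def
      proof (rule finite_measure_mono[OF subsetI sets.Un[OF BNS cells_sets]], rule ccontr)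
        fix x assume x: "x \<in> {x \<in> space M. idx m ((s ^^ n a) x) \<noteq> idx m (id x)}" "x \<notin> BadN \<union> cells R Y"
        have xs: "x \<in> space M" using x by simp
        have sx: "(s ^^ n a) x \<in> space M" using mp_iso_space[OF mp_iso_funpow[OF s] xs] .
        have tr: "idx R ((s ^^ n a) x) = (\<pi> ^^ n a) (idx R x)" using x(2) by (intro traj[OF xs _ na]) simp
        have "idx R x \<notin> Y" using x(2) xs by (simp add: cells_def)
        then have "(\<pi> ^^ n a) (idx R x) = idx R x"
          using permutes_not_in[OF permutes_funpow[OF \<pi>], of "idx R x" "n a"] unfolding Y_def by blast
        then have "idx m ((s ^^ n a) x) = idx m x"
          using idx_coarser[OF R mR sx] idx_coarser[OF R mR xs] tr by simp
        then show False using x(1) by simp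
      qed
      also have "\<dots> \<le> measure M BadN + measure M (cells R Y)" by (rule measure_Un_le[OF BNS cells_sets])
      also have "measure M (cells R Y) = real (card Y) / real R" using R by (intro measure_cells_card) (auto simp: Y_def)
      also have "\<dots> \<le> 1 / (4 * real m)"
      proof -
        have "real (4 * m * card Y) \<le> real R" using cY by (simp only: of_nat_le_iff)
        then show ?thesis using R m by (simp add: field_simps)
      qed
      finally have "mismatch m (s ^^ n a) id \<le> 1 / (16 * real m) + 1 / (4 * real m)" using mBN by linarith
      also have "\<dots> < 1 / real m" using m by (simp add: field_simps)
      finally show ?thesis by (simp add: near_def)
    qed
    define D where "D a = cells R {a}" for a
    define E where "E a = cells R {(\<pi> ^^ n a) a}" for a
    have each: "measure M (D a - BadN) \<le> measure M (D a \<inter> pre M (s ^^ n a) (E a))" if a: "a \<in> Z" for a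
    proof (rule finite_measure_mono[OF subsetI])
      show "D a \<inter> pre M (s ^^ n a) (E a) \<in> sets M"
        unfolding D_def E_def by (intro sets.Int cells_sets pre_sets[OF mp_iso_funpow[OF s]])
      fix x assume "x \<in> D a - BadN"
      then have x: "x \<in> space M" "idx R x = a" "x \<notin> BadN" by (simp_all add: D_def cells_def)
      have "idx R ((s ^^ n a) x) = (\<pi> ^^ n a) a" using traj[OF x(1,3)] Zn a x(2) by simp
      then show "x \<in> D a \<inter> pre M (s ^^ n a) (E a)"
        using x mp_iso_space[OF mp_iso_funpow[OF s] x(1)] by (simp add: D_def E_def cells_def)
    qed
    have "measure M (cells R Z) \<le> measure M ((cells R Z - BadN) \<union> BadN)"
      by (rule finite_measure_mono[OF _ sets.Un[OF sets.Diff[OF cells_sets BNS] BNS]]) blast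
    also have "\<dots> \<le> measure M (cells R Z - BadN) + measure M BadN"
      by (rule measure_Un_le[OF sets.Diff[OF cells_sets BNS] BNS])
    finally have 1: "measure M (cells R Z) - 1 / (16 * real m) \<le> measure M (cells R Z - BadN)" using mBN by linarith
    have "cells R Z - BadN = (\<Union>a\<in>Z. D a - BadN)" by (auto simp: cells_def D_def)
    then have "measure M (cells R Z - BadN) = measure M (\<Union>a\<in>Z. D a - BadN)" by (simp only:)
    also have "\<dots> \<le> (\<Sum>a\<in>Z. measure M (D a - BadN))"
      unfolding D_def by (intro measure_UNION_le finZ sets.Diff cells_sets BNS)
    also have "\<dots> \<le> (\<Sum>a\<in>Z. measure M (D a \<inter> pre M (s ^^ n a) (E a)))" using each by (rule sum_mono)
    finally have 2: "measure M (cells R Z) - 1 / (16 * real m) \<le> (\<Sum>a\<in>Z. measure M (D a \<inter> pre M (s ^^ n a) (E a)))"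
      using 1 by linarith
    have "7 / (8 * real m) \<le> measure M (cells R Z)"
    proof -
      have "real (7 * R) \<le> real (8 * m * card Z)" using Zc by (simp only: card_lessThan of_nat_le_iff)
      then have "7 / (8 * real m) \<le> real (card Z) / real R" using R m by (simp add: field_simps)
      then show ?thesis by (simp only: measure_cells_card[OF R ZR])
    qed
    moreover have "3 / (4 * real m) < 7 / (8 * real m) - 1 / (16 * real m)" using m by (simp add: field_simps)
    ultimately have big: "3 / (4 * real m) < (\<Sum>a\<in>Z. measure M (D a \<inter> pre M (s ^^ n a) (E a)))" using 2 by linarith
    have dD: "disjoint_family_on D Z" unfolding disjoint_family_on_def D_def cells_def by blast
    have dE: "disjoint_family_on E Z" unfolding disjoint_family_on_def
    proof (intro ballI impI)
      fix a b assume "a \<in> Z" "b \<in> Z" "a \<noteq> b"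
      then have "(\<pi> ^^ n a) a \<noteq> (\<pi> ^^ n b) b" using Zinj by (meson inj_onD)
      then show "E a \<inter> E b = {}" by (auto simp: E_def cells_def)
    qed
    have "\<forall>a\<in>Z. D a \<in> sets M \<and> E a \<in> sets M \<and> D a \<subseteq> cells m {i} \<and> E a \<subseteq> cells m {j} \<and> near m (s ^^ n a) id"
    proof
      fix a assume a: "a \<in> Z"
      have "a div (R div m) = i" using Zi a by blast
      then have "D a \<subseteq> cells m {i}" unfolding D_def by (rule sub)
      moreover have "(\<pi> ^^ n a) a div (R div m) = j" using Zn a by blast
      then have "E a \<subseteq> cells m {j}" unfolding E_def by (rule sub)
      moreover have "D a \<in> sets M" "E a \<in> sets M" unfolding D_def E_def by (rule cells_sets)+
      ultimately show "D a \<in> sets M \<and> E a \<in> sets M \<and> D a \<subseteq> cells m {i} \<and> E a \<subseteq> cells m {j} \<and> near m (s ^^ n a) id"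
        using nearid[OF a] by blast
    qed
    then have "carrying m i j s Z (\<lambda>a. int (n a)) D E"
      unfolding carrying_def zpow_nat using finZ dD dE big by blast
    then show "carries m i j s" unfolding carries_def by (intro exI)
  qed
qed

text \<open>
  Start a sequence of stages with a permutation close to \<open>t\<close>. Its limit follows every stage up to the tolerance
  of this stage: so it is close to \<open>t\<close> because of the first stage, and transports cells of rank \<open>m\<close>
  because of stage \<open>m\<close>.
\<close>
lemma ex_transporting_near:
  assumes t: "mp_iso M M t" and k: "0 < k"
  shows "\<exists>s. mp_iso M M s \<and> near k s t \<and> (\<forall>m>0. transports m s)"
proof -
  have "0 < 1 / (2 * real k)" "0 < 1 / (4 * real k)" using k by simp_all
  (* The permutation costs 1 / (2 * k), and the passage to the limit another 1 / (4 * k). *)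
  from ex_permutation_near[OF t k this(1)]
  obtain R0 \<pi>0 where R0: "0 < R0" "k dvd R0" "\<pi>0 permutes {..<R0}"
     "measure M {x \<in> space M. idx k (t x) \<noteq> \<pi>0 (idx R0 x) div (R0 div k)} < 1 / (2 * real k)"
    by (elim exE conjE) (rule that)
  from ex_stage_sequence[OF R0(3,1) \<open>0 < 1 / (4 * real k)\<close>]
  obtain R D \<pi> \<delta> where z: "R 0 = R0" "\<pi> 0 = \<pi>0" "\<delta> 0 = 1 / (4 * real k)"
    and pos: "\<forall>m. 0 < R m \<and> \<pi> m permutes {..<R m} \<and> 0 < \<delta> m"
    and stage: "\<forall>m. R (Suc m) = R m * D m \<and> 2 \<le> D m \<and> \<delta> (Suc m) \<le> \<delta> m / 2 \<and>
       real (card {a \<in> {..<R (Suc m)}. \<pi> (Suc m) a div D m \<noteq> \<pi> m (a div D m)}) / real (R (Suc m)) \<le> \<delta> m / 2 \<and>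
       good_stage (Suc m) (R (Suc m)) (\<pi> (Suc m)) (\<delta> (Suc m))"
    by (elim exE conjE) (rule that)
  have \<delta>pos: "0 < \<delta> m" for m using pos by blast
  have \<delta>half: "\<delta> (Suc m) \<le> \<delta> m / 2" for m using stage by blast
  have errle: "real (card {a \<in> {..<R (Suc m)}. \<pi> (Suc m) a div D m \<noteq> \<pi> m (a div D m)}) / real (R (Suc m)) \<le> \<delta> m / 2" for m
    using stage by blast
  have geo: "\<delta> (m + i) \<le> \<delta> m * (1 / 2) ^ i" for m i
  proof (induction i)
    case (Suc i)
    then show ?case using \<delta>half[of "m + i"] by simp
  qed simp
  have sumgeo: "(\<lambda>i. \<delta> m * (1 / 2) ^ i / 2) sums \<delta> m" for m
  proof -
    have "(\<lambda>i. (1 / 2 :: real) ^ i) sums (1 / (1 - 1 / 2))" by (rule geometric_sums) simp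
    then have "(\<lambda>i. (\<delta> m / 2) * (1 / 2 :: real) ^ i) sums ((\<delta> m / 2) * (1 / (1 - 1 / 2)))" by (rule sums_mult)
    then show ?thesis by (simp add: mult_ac)
  qed
  have summ: "summable (\<lambda>i. \<delta> (m + i) / 2)" for m
  proof (rule summable_comparison_test[OF _ sums_summable[OF sumgeo[of m]]], intro exI allI impI)
    fix i show "norm (\<delta> (m + i) / 2) \<le> \<delta> m * (1 / 2) ^ i / 2"
      using geo[of m i] \<delta>pos[of "m + i"] by simp
  qed
  interpret tw: permutation_tower R D \<pi>
  proof
    fix m show "0 < R m" "R (Suc m) = R m * D m" "2 \<le> D m" "\<pi> m permutes {..<R m}" using pos stage by blast+
  next
    show "summable (\<lambda>m. real (card {a \<in> {..<R (Suc m)}. \<pi> (Suc m) a div D m \<noteq> \<pi> m (a div D m)}) / real (R (Suc m)))"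
    proof (rule summable_comparison_test[OF _ summ[of 0]], intro exI allI impI)
      fix m
      show "norm (real (card {a \<in> {..<R (Suc m)}. \<pi> (Suc m) a div D m \<noteq> \<pi> m (a div D m)}) / real (R (Suc m))) \<le> \<delta> (0 + m) / 2"
        using errle[of m] by simp
    qed
  qed
  obtain u u' where u: "u \<in> measurable unit_interval unit_interval" "u' \<in> measurable unit_interval unit_interval"
    "distr unit_interval unit_interval u = unit_interval" "distr unit_interval unit_interval u' = unit_interval"
    "AE x in unit_interval. u' (u x) = x" "AE x in unit_interval. u (u' x) = x"
    and uc: "AE x in unit_interval. \<forall>m. tw.consistent m x \<longrightarrow> cell (R m) (u x) = \<pi> m (cell (R m) x)"
    using tw.ex_limit_automorphism by (elim exE conjE) (rule that)
  from coord_lift[OF u] obtain s where s: "mp_iso M M s" "AE x in M. \<phi> (s x) = u (\<phi> x)" by (elim exE conjE) (rule that)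
  have bad: "measure M {x \<in> space M. idx (R m) (s x) \<noteq> \<pi> m (idx (R m) x)} \<le> \<delta> m" for m
  proof -
    let ?I = "{x \<in> space unit_interval. \<not> tw.consistent m x}"
    have IS: "?I \<in> sets unit_interval" by (rule tw.inconsistent_sets)
    have mI: "measure unit_interval ?I \<le> (\<Sum>i. \<delta> (m + i) / 2)"
      by (rule tw.measure_inconsistent_le(2)) (use errle summ[of m] in \<open>simp_all add: tw.err_def\<close>)
    also have "\<dots> \<le> (\<Sum>i. \<delta> m * (1 / 2) ^ i / 2)"
      using geo by (intro suminf_le summ sums_summable[OF sumgeo]) simp
    also have "\<dots> = \<delta> m" using sumgeo[of m] by (rule sums_unique[symmetric])
    finally have mI: "measure unit_interval ?I \<le> \<delta> m" .
    have "AE x in M. \<forall>m. tw.consistent m (\<phi> x) \<longrightarrow> cell (R m) (u (\<phi> x)) = \<pi> m (cell (R m) (\<phi> x))"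
      by (rule AE_coord[OF uc])
    then have "AE x in M. x \<in> {x \<in> space M. idx (R m) (s x) \<noteq> \<pi> m (idx (R m) x)} \<longrightarrow> x \<in> \<phi> -` ?I \<inter> space M"
      using s(2)
    proof eventually_elim
      case (elim x)
      show ?case
      proof
        assume x: "x \<in> {x \<in> space M. idx (R m) (s x) \<noteq> \<pi> m (idx (R m) x)}"
        then have "\<not> tw.consistent m (\<phi> x)" using elim unfolding idx_def by auto
        then show "x \<in> \<phi> -` ?I \<inter> space M" using x measurable_space[OF coord, of x] by simp
      qed
    qed
    then have "measure M {x \<in> space M. idx (R m) (s x) \<noteq> \<pi> m (idx (R m) x)} \<le> measure M (\<phi> -` ?I \<inter> space M)"
      by (rule finite_measure_mono_AE[OF _ measurable_sets[OF coord IS]])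
    also have "\<dots> = measure (distr M unit_interval \<phi>) ?I" by (rule measure_distr[OF coord IS, symmetric])
    finally show ?thesis using mI unfolding distr_coord by linarith
  qed
  have tr: "\<forall>m>0. transports m s"
  proof (intro allI impI)
    fix m :: nat assume "0 < m"
    then obtain l where l: "m = Suc l" by (cases m) auto
    have "good_stage (Suc l) (R (Suc l)) (\<pi> (Suc l)) (\<delta> (Suc l))" using stage by blast
    then show "transports m s" unfolding l
      using pos by (intro transports_of_stage[OF s(1) zero_less_Suc _ _ _ bad]) blast+
  qed
  have "near k s t"
  proof -
    let ?B1 = "{x \<in> space M. idx R0 (s x) \<noteq> \<pi>0 (idx R0 x)}"
    let ?B2 = "{x \<in> space M. idx k (t x) \<noteq> \<pi>0 (idx R0 x) div (R0 div k)}"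
    have cS: "{x \<in> space M. idx r (f x) \<noteq> g (idx R0 x)} \<in> sets M" if f: "mp_iso M M f" for f r and g :: "nat \<Rightarrow> nat"
    proof -
      have "{x \<in> space M. idx r (f x) \<noteq> g (idx R0 x)} = space M - (\<Union>a. cells R0 {a} \<inter> {x \<in> space M. idx r (f x) = g a})"
        by (auto simp: cells_def)
      also have "\<dots> \<in> sets M" using cells_sets idx_pre_sets[OF f] by (intro sets.Diff sets.countable_UN) auto
      finally show ?thesis .
    qed
    have S: "?B1 \<in> sets M" "?B2 \<in> sets M" using cS[OF s(1), of R0 \<pi>0] cS[OF t, of k "\<lambda>a. \<pi>0 a div (R0 div k)"] by blast+
    have "mismatch k s t \<le> measure M (?B1 \<union> ?B2)" unfolding mismatch_def
    proof (rule finite_measure_mono[OF subsetI sets.Un[OF S]], rule ccontr)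
      fix x assume x: "x \<in> {x \<in> space M. idx k (s x) \<noteq> idx k (t x)}" "x \<notin> ?B1 \<union> ?B2"
      then have xs: "x \<in> space M" "s x \<in> space M" using mp_iso_space[OF s(1)] by auto
      have "idx k (s x) = idx R0 (s x) div (R0 div k)" using idx_coarser[OF R0(1,2) xs(2)] by simp
      then show False using x xs by simp
    qed
    also have "\<dots> \<le> measure M ?B1 + measure M ?B2" by (rule measure_Un_le[OF S])
    also have "measure M ?B1 \<le> 1 / (4 * real k)" using bad[of 0] by (simp only: z)
    finally have "mismatch k s t < 1 / (4 * real k) + 1 / (2 * real k)" using R0(4) by linarith
    also have "\<dots> \<le> 1 / real k" using k by (simp add: field_simps)
    finally show ?thesis by (simp add: near_def)
  qed
  then show ?thesis using s(1) tr by blast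
qed

theorem whirly_dense_gdelta:
  "gdelta_in (aut_topology M) {T \<in> carrier (Aut M). whirly M T} \<and>
   aut_topology M closure_of {T \<in> carrier (Aut M). whirly M T} = carrier (Aut M)"
proof
  show "gdelta_in (aut_topology M) {T \<in> carrier (Aut M). whirly M T}"
    unfolding whirly_set_eq
  proof (rule gdelta_in_Inter)
    show "countable ((\<lambda>k. {aut_class M t | t. mp_iso M M t \<and> transports k t}) ` {0<..})" by simp
    show "(\<lambda>k. {aut_class M t | t. mp_iso M M t \<and> transports k t}) ` {0::nat<..} \<noteq> {}" by blast
    fix S assume "S \<in> (\<lambda>k. {aut_class M t | t. mp_iso M M t \<and> transports k t}) ` {0::nat<..}"
    then obtain k where "0 < k" "S = {aut_class M t | t. mp_iso M M t \<and> transports k t}" by auto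
    then show "gdelta_in (aut_topology M) S" using open_imp_gdelta_in[OF openin_transports] by simp
  qed
  show "aut_topology M closure_of {T \<in> carrier (Aut M). whirly M T} = carrier (Aut M)"
  proof (rule equalityI)
    show "aut_topology M closure_of {T \<in> carrier (Aut M). whirly M T} \<subseteq> carrier (Aut M)"
      using closure_of_subset_topspace[of "aut_topology M"] unfolding topspace_aut_topology .
    show "carrier (Aut M) \<subseteq> aut_topology M closure_of {T \<in> carrier (Aut M). whirly M T}"
    proof
      fix T assume T: "T \<in> carrier (Aut M)"
      then obtain t where t: "mp_iso M M t" "T = aut_class M t" by (auto simp: carrier_Aut)
      have "\<exists>S. S \<in> {T \<in> carrier (Aut M). whirly M T} \<and> S \<in> V" if V: "T \<in> V" "openin (aut_topology M) V" for V
      proof -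
        obtain k where k: "0 < k" "\<forall>s. mp_iso M M s \<longrightarrow> near k s t \<longrightarrow> aut_class M s \<in> V"
          using V t unfolding openin_aut_topology_iff by blast
        obtain s where s: "mp_iso M M s" "near k s t" "\<forall>m>0. transports m s"
          using ex_transporting_near[OF t(1) k(1)] by (elim exE conjE) (rule that)
        have "whirls s" using s(3) by (intro whirls_if_transports[OF s(1)]) blast
        then have "whirly M (aut_class M s)" using whirly_iff_whirls[OF s(1)] by simp
        moreover have "aut_class M s \<in> carrier (Aut M)" using s(1) by (simp add: carrier_Aut)
        moreover have "aut_class M s \<in> V" using k(2) s(1,2) by blast
        ultimately show ?thesis by blast
      qed
      then show "T \<in> aut_topology M closure_of {T \<in> carrier (Aut M). whirly M T}"
        unfolding in_closure_of topspace_aut_topology using T by blast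
    qed
  qed
qed

end

section \<open>Coordinates on standard Lebesgue spaces\<close>

text \<open>
  On the set of points whose whole forward and backward orbits avoid the exceptional null set, \<open>t\<close> is a
  bijection; outside it is replaced by the identity.
\<close>
lemma ex_mp_iso_of_AE_inverse:
  assumes t: "t \<in> measurable M M" "distr M M t = M" and t': "t' \<in> measurable M M" "distr M M t' = M"
    and inv: "AE x in M. t' (t x) = x" "AE x in M. t (t' x) = x"
  shows "\<exists>s. mp_iso M M s \<and> (AE x in M. s x = t x)"
proof -
  have "AE x in M. t' (t x) = x \<and> t (t' x) = x" using inv by eventually_elim blast
  then obtain N where N: "{x \<in> space M. \<not> (t' (t x) = x \<and> t (t' x) = x)} \<subseteq> N" "emeasure M N = 0" "N \<in> sets M"
    by (rule AE_E)
  define G where "G = space M - N"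
  have GS: "G \<in> sets M" unfolding G_def using N(3) by (rule sets.compl_sets)
  have G: "t' (t x) = x" "t (t' x) = x" if "x \<in> G" for x using that N(1) unfolding G_def by blast+
  have AEG: "AE x in M. x \<in> G"
  proof -
    have "N \<in> null_sets M" using N by (simp add: null_sets_def)
    then have "AE x in M. x \<notin> N" by (rule AE_not_in)
    with AE_space show ?thesis by eventually_elim (simp add: G_def)
  qed
  have pm: "r ^^ n \<in> measurable M M" if r: "r \<in> measurable M M" for r n
  proof (induction n)
    case 0
    show ?case by (simp add: id_def)
  next
    case (Suc n)
    show ?case unfolding funpow.simps by (rule measurable_comp[OF Suc r])
  qed
  have pd: "AE x in M. (r ^^ n) x \<in> G" if r: "r \<in> measurable M M" "distr M M r = M" for r n
  proof (induction n)
    case 0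
    show ?case using AEG by simp
  next
    case (Suc n)
    have "AE x in distr M M r. (r ^^ n) x \<in> G" unfolding r(2) by (rule Suc)
    then have "AE x in M. (r ^^ n) (r x) \<in> G" by (rule AE_distrD[OF r(1)])
    then show ?case unfolding funpow_Suc_right by (simp only: o_apply)
  qed
  define X where "X = (\<Inter>n. ((t ^^ n) -` G \<inter> space M) \<inter> ((t' ^^ n) -` G \<inter> space M))"
  have XS: "X \<in> sets M" unfolding X_def
    using measurable_sets[OF pm[OF t(1)] GS] measurable_sets[OF pm[OF t'(1)] GS]
    by (intro sets.countable_INT) (blast intro: sets.Int)+
  have AEX: "AE x in M. x \<in> X"
  proof -
    have "AE x in M. \<forall>n. (t ^^ n) x \<in> G" unfolding AE_all_countable using pd[OF t] by blast
    moreover have "AE x in M. \<forall>n. (t' ^^ n) x \<in> G" unfolding AE_all_countable using pd[OF t'] by blast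
    ultimately show ?thesis using AE_space by eventually_elim (auto simp: X_def)
  qed
  have XD: "(t ^^ n) x \<in> G" "(t' ^^ n) x \<in> G" "x \<in> space M" if "x \<in> X" for x n
    using that unfolding X_def by auto
  have XG: "x \<in> G" if "x \<in> X" for x using XD(1)[OF that, of 0] by simp
  have step: "r x \<in> X" if x: "x \<in> X" and r: "r \<in> measurable M M" "\<And>n. (r ^^ n) x \<in> G" "\<And>n. (r' ^^ n) x \<in> G" "r' (r x) = x"
      and rr: "{r, r'} = {t, t'}" for r r' x
  proof -
    have sp: "r x \<in> space M" by (rule measurable_space[OF r(1) XD(3)[OF x]])
    have 1: "(r ^^ n) (r x) \<in> G" for n using r(2)[of "Suc n"] unfolding funpow_Suc_right by simp
    have 2: "(r' ^^ n) (r x) \<in> G" for n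
    proof (cases n)
      case 0
      then show ?thesis using r(2)[of 1] by simp
    next
      case (Suc l)
      then show ?thesis using r(3)[of l] r(4) unfolding Suc funpow_Suc_right by simp
    qed
    have "(t ^^ n) (r x) \<in> G \<and> (t' ^^ n) (r x) \<in> G" for n
      using 1[of n] 2[of n] rr by (metis doubleton_eq_iff)
    then show ?thesis using sp unfolding X_def by blast
  qed
  have tX: "t x \<in> X" if x: "x \<in> X" for x
    by (rule step[OF x t(1) XD(1)[OF x] XD(2)[OF x] G(1)[OF XG[OF x]] refl])
  have t'X: "t' x \<in> X" if x: "x \<in> X" for x
    by (rule step[OF x t'(1) XD(2)[OF x] XD(1)[OF x] G(2)[OF XG[OF x]] insert_commute])
  define s where "s x = (if x \<in> X then t x else x)" for x
  define s' where "s' x = (if x \<in> X then t' x else x)" for x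
  have ss: "s' (s x) = x" "s (s' x) = x" for x
    using tX t'X G XG by (auto simp: s_def s'_def)
  have sm: "s \<in> measurable M M" "s' \<in> measurable M M"
    unfolding s_def s'_def using XS t(1) t'(1) by (intro measurable_If_set; simp add: sets.Int)+
  have sAE: "AE x in M. s x = t x" using AEX by eventually_elim (simp add: s_def)
  have bij: "bij_betw s (space M) (space M)"
    by (rule bij_betw_byWitness[where f' = s']) (use ss measurable_space[OF sm(1)] measurable_space[OF sm(2)] in auto)
  have "inv_into (space M) s \<in> measurable M M"
  proof (subst measurable_cong)
    fix w assume w: "w \<in> space M"
    have "inv_into (space M) s (s (s' w)) = s' w"
      using bij measurable_space[OF sm(2) w] by (intro inv_into_f_f) (auto simp: bij_betw_def)
    then show "inv_into (space M) s w = s' w" by (simp only: ss(2))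
  qed (rule sm(2))
  moreover have "distr M M s = M"
  proof -
    have "distr M M s = distr M M t" by (rule distr_cong_AE[OF refl refl sAE sm(1) t(1)])
    then show ?thesis using t(2) by simp
  qed
  ultimately have "mp_iso M M s" using sm(1) bij by (simp add: mp_iso_def)
  then show ?thesis using sAE by blast
qed

lemma extend_mp_iso:
  assumes f: "mp_iso (restrict_space M X) (restrict_space N Y) f" and X: "X \<in> sets M" and Y: "Y \<in> sets N"
    and n0: "n0 \<in> space N" and null: "emeasure M (space M - X) = 0" "emeasure N (space N - Y) = 0"
  shows "(\<lambda>x. if x \<in> X then f x else n0) \<in> measurable M N"
    and "distr M N (\<lambda>x. if x \<in> X then f x else n0) = N"
proof -
  let ?g = "\<lambda>x. if x \<in> X then f x else n0"
  have fm: "f \<in> measurable (restrict_space M X) (restrict_space N Y)" using f by (simp add: mp_iso_def)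
  have fd: "distr (restrict_space M X) (restrict_space N Y) f = restrict_space N Y" using f by (simp add: mp_iso_def)
  have Xs: "X \<inter> space M \<in> sets M" "Y \<inter> space N \<in> sets N" using X Y by (auto intro: sets.Int)
  have XX: "X \<inter> space M = X" "Y \<inter> space N = Y" using sets.sets_into_space[OF X] sets.sets_into_space[OF Y] by blast+
  have "f \<in> measurable (restrict_space M X) N" using fm by (simp add: measurable_restrict_space2_iff)
  then show gm: "?g \<in> measurable M N" using measurable_restrict_space_iff[OF Xs(1) n0] by blast
  have AX: "AE x in M. x \<in> X"
    using null(1) X by (intro AE_I[of _ _ "space M - X"]) auto
  have AY: "AE x in N. x \<in> Y"
    using null(2) Y by (intro AE_I[of _ _ "space N - Y"]) auto
  show "distr M N ?g = N"
  proof (rule measure_eqI)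
    fix B assume "B \<in> sets (distr M N ?g)"
    then have B: "B \<in> sets N" by simp
    have BY: "B \<inter> Y \<in> sets (restrict_space N Y)" using B by (auto simp: sets_restrict_space)
    let ?F = "f -` (B \<inter> Y) \<inter> space (restrict_space M X)"
    have FS: "?F \<in> sets (restrict_space M X)" by (rule measurable_sets[OF fm BY])
    have FX: "?F \<subseteq> X" by (auto simp: space_restrict_space)
    have FM: "?F \<in> sets M" using FS Xs(1) by (simp add: sets_restrict_space_iff)
    have fY: "f x \<in> Y" if "x \<in> X" for x
      using measurable_space[OF fm, of x] that XX by (simp add: space_restrict_space)
    have "emeasure (distr M N ?g) B = emeasure M (?g -` B \<inter> space M)" by (rule emeasure_distr[OF gm B])
    also have "\<dots> = emeasure M ?F"
    proof (rule emeasure_eq_AE)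
      show "AE x in M. (x \<in> ?g -` B \<inter> space M) = (x \<in> ?F)"
        using AX AE_space by eventually_elim (use fY in \<open>simp add: space_restrict_space\<close>)
    qed (rule measurable_sets[OF gm B], rule FM)
    also have "\<dots> = emeasure (restrict_space M X) ?F" using FX Xs(1) by (simp add: emeasure_restrict_space)
    also have "\<dots> = emeasure (distr (restrict_space M X) (restrict_space N Y) f) (B \<inter> Y)"
      by (rule emeasure_distr[OF fm BY, symmetric])
    also have "\<dots> = emeasure N (B \<inter> Y)" unfolding fd using Xs(2) by (simp add: emeasure_restrict_space)
    also have "\<dots> = emeasure N B"
      using AY B Y by (intro emeasure_eq_AE) auto
    finally show "emeasure (distr M N ?g) B = emeasure N B" .
  qed simp
qed

text \<open>
  Constant values on the exceptional null sets make the isomorphism and its inverse total without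
  affecting the distributions.
\<close>
lemma iso_mod_null_maps:
  assumes iso: "iso_mod_null M N" and M: "space M \<noteq> {}" and N: "space N \<noteq> {}"
  shows "\<exists>\<phi> \<psi>. \<phi> \<in> measurable M N \<and> distr M N \<phi> = N \<and> \<psi> \<in> measurable N M \<and> distr N M \<psi> = M \<and>
     (AE x in M. \<psi> (\<phi> x) = x) \<and> (AE y in N. \<phi> (\<psi> y) = y)"
proof -
  obtain X Y f where XY: "X \<in> sets M" "Y \<in> sets N" "emeasure M (space M - X) = 0" "emeasure N (space N - Y) = 0"
    and f: "mp_iso (restrict_space M X) (restrict_space N Y) f"
    using iso unfolding iso_mod_null_def by blast
  obtain m0 n0 where mn: "m0 \<in> space M" "n0 \<in> space N" using M N by blast
  define g where "g = inv_into (space (restrict_space M X)) f"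
  have g: "mp_iso (restrict_space N Y) (restrict_space M X) g" unfolding g_def using f by (rule mp_iso_inv)
  define \<phi> where "\<phi> x = (if x \<in> X then f x else n0)" for x
  define \<psi> where "\<psi> y = (if y \<in> Y then g y else m0)" for y
  have sp: "space (restrict_space M X) = X" "space (restrict_space N Y) = Y"
    using sets.sets_into_space[OF XY(1)] sets.sets_into_space[OF XY(2)] by (auto simp: space_restrict_space)
  have bij: "bij_betw f X Y" using f unfolding mp_iso_def sp by blast
  have g': "g = inv_into X f" by (simp only: g_def sp)
  have AX: "AE x in M. x \<in> X"
    using XY by (intro AE_I[of _ _ "space M - X"]) auto
  have AY: "AE x in N. x \<in> Y"
    using XY by (intro AE_I[of _ _ "space N - Y"]) auto
  have l1: "\<psi> (\<phi> x) = x" if "x \<in> X" for x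
    using that bij bij_betwE[OF bij] by (simp add: \<phi>_def \<psi>_def g' bij_betw_inv_into_left)
  have 1: "AE x in M. \<psi> (\<phi> x) = x" using AX by eventually_elim (rule l1)
  have l2: "\<phi> (\<psi> y) = y" if "y \<in> Y" for y
    using that bij bij_betwE[OF bij_betw_inv_into[OF bij]] by (simp add: \<phi>_def \<psi>_def g' bij_betw_inv_into_right)
  have 2: "AE y in N. \<phi> (\<psi> y) = y" using AY by eventually_elim (rule l2)
  have 3: "\<phi> \<in> measurable M N" "distr M N \<phi> = N"
    unfolding \<phi>_def by (rule extend_mp_iso[OF f XY(1,2) mn(2) XY(3,4)])+
  have 4: "\<psi> \<in> measurable N M" "distr N M \<psi> = M"
    unfolding \<psi>_def by (rule extend_mp_iso[OF g XY(2,1) mn(1) XY(4,3)])+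
  show ?thesis using 1 2 3 4 by (intro exI[of _ \<phi>] exI[of _ \<psi>] conjI)
qed

text \<open>
  With this identity, Borel maps of the interval that preserve the measure extend to the Lebesgue measurable sets by
  \<open>completion_map\<close>, and both cases in the definition of standard Lebesgue spaces have the same form.
\<close>
lemma lebesgue_on_unit_interval: "lebesgue_on {0..1} = completion unit_interval"
proof (rule measure_eqI)
  let ?S = "{0..1::real}"
  have S: "?S \<inter> space lborel \<in> sets lborel" "?S \<in> sets lborel" "?S \<inter> space (completion lborel) \<in> sets (completion lborel)" by simp_all
  have split: "\<exists>A1 A2 N. A = A1 \<union> A2 \<and> A1 \<in> sets lborel \<and> A1 \<subseteq> ?S \<and> A2 \<subseteq> N \<and> N \<in> null_sets lborel \<and> N \<subseteq> ?S"
    if A: "A \<in> sets (completion lborel)" "A \<subseteq> ?S" for A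
  proof -
    obtain A1 A2 N where N: "A = A1 \<union> A2" "A2 \<subseteq> N" "N \<in> null_sets lborel" "A1 \<in> sets lborel"
      using A(1) by (rule sets_completionE)
    have "N \<inter> ?S \<in> null_sets lborel" using N(3) by (rule null_set_Int2) simp
    then show ?thesis using N A(2) by (intro exI[of _ A1] exI[of _ A2] exI[of _ "N \<inter> ?S"]) auto
  qed
  have nullP: "N \<in> null_sets unit_interval \<longleftrightarrow> N \<subseteq> ?S \<and> N \<in> null_sets lborel" for N
    by (rule null_sets_restrict_space) simp
  have setsP: "A \<in> sets unit_interval \<longleftrightarrow> A \<subseteq> ?S \<and> A \<in> sets lborel" for A
    by (rule sets_restrict_space_iff) simp
  have setsL: "A \<in> sets (lebesgue_on ?S) \<longleftrightarrow> A \<subseteq> ?S \<and> A \<in> sets (completion lborel)" for A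
    by (rule sets_restrict_space_iff) simp
  show "sets (lebesgue_on ?S) = sets (completion unit_interval)"
  proof (rule equalityI; rule subsetI)
    fix A assume "A \<in> sets (lebesgue_on ?S)"
    then have "A \<subseteq> ?S" "A \<in> sets (completion lborel)" by (simp_all add: setsL)
    from split[OF this(2,1)] obtain A1 A2 N where N: "A = A1 \<union> A2" "A1 \<in> sets lborel" "A1 \<subseteq> ?S" "A2 \<subseteq> N" "N \<in> null_sets lborel" "N \<subseteq> ?S"
      by (elim exE conjE) (rule that)
    show "A \<in> sets (completion unit_interval)"
      by (rule sets_completionI[OF N(1,4)]) (use N nullP setsP in auto)
  next
    fix A assume A: "A \<in> sets (completion unit_interval)"
    obtain A1 A2 N where N: "A = A1 \<union> A2" "A2 \<subseteq> N" "N \<in> null_sets unit_interval" "A1 \<in> sets unit_interval"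
      using A by (rule sets_completionE)
    have "A \<in> sets (completion lborel)" by (rule sets_completionI[OF N(1,2)]) (use N nullP setsP in auto)
    moreover have "A \<subseteq> ?S" using N nullP setsP by blast
    ultimately show "A \<in> sets (lebesgue_on ?S)" by (simp add: setsL)
  qed
  fix A assume "A \<in> sets (lebesgue_on ?S)"
  then have A: "A \<subseteq> ?S" "A \<in> sets (completion lborel)" by (simp_all add: setsL)
  from split[OF this(2,1)] obtain A1 A2 N where N: "A = A1 \<union> A2" "A1 \<in> sets lborel" "A1 \<subseteq> ?S" "A2 \<subseteq> N" "N \<in> null_sets lborel" "N \<subseteq> ?S"
    by (elim exE conjE) (rule that)
  have A2L: "A2 \<in> null_sets (completion lborel)" using N(4,5) null_sets_completion_iff2 by blast
  have A2P: "A2 \<in> null_sets (completion unit_interval)" using N(4-6) nullP null_sets_completion_iff2 by blast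
  have "emeasure (lebesgue_on ?S) A = emeasure (completion lborel) A"
    using A by (intro emeasure_restrict_space) auto
  also have "\<dots> = emeasure (completion lborel) A1"
    unfolding N(1) using N(2) A2L by (intro emeasure_Un_null_set) auto
  also have "\<dots> = emeasure lborel A1" using N(2) by simp
  also have "\<dots> = emeasure unit_interval A1" using N(2,3) by (simp add: emeasure_restrict_space)
  also have "\<dots> = emeasure (completion unit_interval) A1" using N(2,3) setsP by simp
  also have "\<dots> = emeasure (completion unit_interval) A"
    unfolding N(1) using N(2,3) A2P setsP by (intro emeasure_Un_null_set[symmetric]) auto
  finally show "emeasure (lebesgue_on ?S) A = emeasure (completion unit_interval) A" .
qed

lemma completion_map:
  assumes u: "u \<in> measurable M M" "distr M M u = M"
  shows "u \<in> measurable (completion M) (completion M)" "distr (completion M) (completion M) u = completion M"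
proof -
  have um: "u \<in> measurable (completion M) M" using u(1) by (rule measurable_completion)
  have ud: "distr (completion M) M u = M" using distr_completion[OF u(1)] u(2) by simp
  show "u \<in> measurable (completion M) (completion M)"
    by (rule completion.measurable_completion2[OF um]) (simp only: ud order_refl)
  show "distr (completion M) (completion M) u = completion M"
    using completion.completion_distr_eq[OF um] ud by simp
qed

text \<open>
  A map \<open>u\<close> of the interval lifts to \<open>\<psi> \<circ> u \<circ> \<phi>\<close>, which has an inverse almost everywhere.
\<close>
lemma lebesgue_coordinate_if:
  assumes M: "prob_space M" and \<phi>: "\<phi> \<in> measurable M N" "distr M N \<phi> = N" and \<psi>: "\<psi> \<in> measurable N M" "distr N M \<psi> = M"
    and inv: "AE x in M. \<psi> (\<phi> x) = x" "AE y in N. \<phi> (\<psi> y) = y"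
    and N: "N = unit_interval \<or> N = completion unit_interval"
  shows "lebesgue_coordinate M \<phi>"
proof -
  have idm: "(\<lambda>x. x) \<in> measurable N unit_interval" using N by (auto intro: measurable_completion)
  have idd: "distr N unit_interval (\<lambda>x. x) = unit_interval"
  proof -
    have "distr (completion unit_interval) unit_interval (\<lambda>x. x) = distr unit_interval unit_interval (\<lambda>x. x)"
      by (rule distr_completion) simp
    then show ?thesis using N by (auto simp: distr_id2)
  qed
  have AEN: "AE x in N. P x" if "AE x in unit_interval. P x" for P
    using N that AE_completion by blast
  have un: "u \<in> measurable N N" "distr N N u = N" if "u \<in> measurable unit_interval unit_interval" "distr unit_interval unit_interval u = unit_interval" for u
    using N that completion_map[OF that] by auto
  interpret prob_space M by (rule M)
  show ?thesis
  proof
    show pm: "\<phi> \<in> measurable M unit_interval" using measurable_compose[OF \<phi>(1) idm] by simp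
    have "distr M unit_interval \<phi> = distr (distr M N \<phi>) unit_interval (\<lambda>x. x)"
      using distr_distr[OF idm \<phi>(1)] by (simp add: comp_def)
    then show "distr M unit_interval \<phi> = unit_interval" unfolding \<phi>(2) idd .
    fix A assume A: "A \<in> sets M"
    have PA: "\<psi> -` A \<inter> space N \<in> sets N" using \<psi>(1) A by (rule measurable_sets)
    have "\<exists>B\<in>sets unit_interval. AE y in N. y \<in> \<psi> -` A \<inter> space N \<longleftrightarrow> y \<in> B"
    proof (cases "N = unit_interval")
      case True
      then show ?thesis using PA by (intro bexI[of _ "\<psi> -` A \<inter> space N"]) auto
    next
      case False
      then have Nc: "N = completion unit_interval" using N by blast
      let ?P = "\<psi> -` A \<inter> space N"
      obtain A1 A2 N0 where d: "?P = A1 \<union> A2" "A2 \<subseteq> N0" "N0 \<in> null_sets unit_interval" "A1 \<in> sets unit_interval"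
        using PA unfolding Nc by (rule sets_completionE)
      have "AE y in N. y \<notin> N0" by (rule AEN[OF AE_not_in[OF d(3)]])
      then have "AE y in N. y \<in> ?P \<longleftrightarrow> y \<in> A1" unfolding d(1) by eventually_elim (use d(2) in blast)
      then show ?thesis using d(4) by blast
    qed
    then obtain B where B: "B \<in> sets unit_interval" "AE y in N. y \<in> \<psi> -` A \<inter> space N \<longleftrightarrow> y \<in> B" by blast
    have "AE y in distr M N \<phi>. y \<in> \<psi> -` A \<inter> space N \<longleftrightarrow> y \<in> B" unfolding \<phi>(2) by (rule B(2))
    then have "AE x in M. \<phi> x \<in> \<psi> -` A \<inter> space N \<longleftrightarrow> \<phi> x \<in> B" by (rule AE_distrD[OF \<phi>(1)])
    then have "AE x in M. x \<in> A \<longleftrightarrow> \<phi> x \<in> B"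
      using inv(1) AE_space by eventually_elim (use measurable_space[OF \<phi>(1)] in simp)
    then show "\<exists>B\<in>sets unit_interval. AE x in M. x \<in> A \<longleftrightarrow> \<phi> x \<in> B" using B(1) by blast
  next
    fix u u' :: "real \<Rightarrow> real"
    assume u: "u \<in> measurable unit_interval unit_interval" "u' \<in> measurable unit_interval unit_interval"
      "distr unit_interval unit_interval u = unit_interval" "distr unit_interval unit_interval u' = unit_interval"
      "AE x in unit_interval. u' (u x) = x" "AE x in unit_interval. u (u' x) = x"
    have lift: "(\<lambda>x. \<psi> (v (\<phi> x))) \<in> measurable M M" "distr M M (\<lambda>x. \<psi> (v (\<phi> x))) = M"
       "AE x in M. \<phi> (\<psi> (v (\<phi> x))) = v (\<phi> x)"
      if v: "v \<in> measurable N N" "distr N N v = N" for v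
    proof -
      have vm: "(\<lambda>x. v (\<phi> x)) \<in> measurable M N" using \<phi>(1) v(1) by (rule measurable_compose)
      have vd: "distr M N (\<lambda>x. v (\<phi> x)) = N"
        using distr_distr[OF v(1) \<phi>(1)] unfolding \<phi>(2) v(2) by (simp add: comp_def)
      show "(\<lambda>x. \<psi> (v (\<phi> x))) \<in> measurable M M" using vm \<psi>(1) by (rule measurable_compose)
      show "distr M M (\<lambda>x. \<psi> (v (\<phi> x))) = M"
        using distr_distr[OF \<psi>(1) vm] unfolding vd \<psi>(2) by (simp add: comp_def)
      have "AE y in distr M N (\<lambda>x. v (\<phi> x)). \<phi> (\<psi> y) = y" unfolding vd by (rule inv(2))
      then show "AE x in M. \<phi> (\<psi> (v (\<phi> x))) = v (\<phi> x)" by (rule AE_distrD[OF vm])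
    qed
    have undo: "AE x in M. \<psi> (w (\<phi> (\<psi> (v (\<phi> x))))) = x"
      if v: "v \<in> measurable N N" "distr N N v = N" and wv: "AE x in unit_interval. w (v x) = x" for v w
    proof -
      have "AE x in distr M N \<phi>. w (v x) = x" unfolding \<phi>(2) by (rule AEN[OF wv])
      then have "AE x in M. w (v (\<phi> x)) = \<phi> x" by (rule AE_distrD[OF \<phi>(1)])
      then show ?thesis using lift(3)[OF v] inv(1) by eventually_elim simp
    qed
    note U = un[OF u(1,3)] and U' = un[OF u(2,4)]
    obtain s where s: "mp_iso M M s" "AE x in M. s x = \<psi> (u (\<phi> x))"
      using ex_mp_iso_of_AE_inverse[OF lift(1,2)[OF U] lift(1,2)[OF U'] undo[OF U u(5)] undo[OF U' u(6)]]
      by (elim exE conjE) (rule that)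
    have "AE x in M. \<phi> (s x) = u (\<phi> x)" using s(2) lift(3)[OF U] by eventually_elim simp
    then show "\<exists>s. mp_iso M M s \<and> (AE x in M. \<phi> (s x) = u (\<phi> x))" using s(1) by blast
  qed
qed

lemma ex_lebesgue_coordinate:
  assumes "standard_Lebesgue_space M"
  shows "\<exists>\<phi>. lebesgue_coordinate M \<phi>"
proof -
  have M: "prob_space M" using assms by (simp add: standard_Lebesgue_space_def)
  obtain N where N: "iso_mod_null M N" "N = unit_interval \<or> N = completion unit_interval"
    using assms unfolding standard_Lebesgue_space_def lebesgue_on_unit_interval by blast
  have M0: "space M \<noteq> {}" using M by (rule prob_space.not_empty)
  have N0: "space N \<noteq> {}" using N(2) by auto
  from iso_mod_null_maps[OF N(1) M0 N0]
  obtain \<phi> \<psi> where maps: "\<phi> \<in> measurable M N" "distr M N \<phi> = N" "\<psi> \<in> measurable N M" "distr N M \<psi> = M"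
     "AE x in M. \<psi> (\<phi> x) = x" "AE y in N. \<phi> (\<psi> y) = y"
    by (elim exE conjE) (rule that)
  have "lebesgue_coordinate M \<phi>" by (rule lebesgue_coordinate_if[OF M maps N(2)])
  then show "\<exists>\<phi>. lebesgue_coordinate M \<phi>" by blast
qed

theorem theorem5p2:
  fixes M :: "'a measure"
  assumes "standard_Lebesgue_space M"
  shows "gdelta_in (aut_topology M) {T \<in> carrier (Aut M). whirly M T} \<and>
         aut_topology M closure_of {T \<in> carrier (Aut M). whirly M T} = carrier (Aut M)"
proof -
  obtain \<phi> where "lebesgue_coordinate M \<phi>"
    using ex_lebesgue_coordinate[OF assms] by (elim exE) (rule that)
  then show ?thesis by (rule lebesgue_coordinate.whirly_dense_gdelta)
qed

end
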